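(* For any $r\geq 2$ and any $n\geq 2$ there is a trajectory of loops on $\mathbb{CP}^r$ (for the flow on $L\mathbb{CP}^r$ given by the negative gradient of the energy function) which converges in positive time towards a geodesic with period $n$ and in negative time towards a non-constant geodesic with period $n+1$.
   Context: $\mathbb{CP}^r$ carries the Fubini–Study metric. $L\mathbb{CP}^r$ is the Hilbert manifold of closed curves $\gamma:\mathbb{T}=S^1\to\mathbb{CP}^r$ of class $H^1$, with Riemannian metric $\langle\xi,\eta\rangle_1=\int_{\mathbb{T}}(\langle\xi(z),\eta(z)\rangle+\langle\nabla\xi(z),\nabla\eta(z)\rangle)\,dz$ on $T_\gamma L\mathbb{CP}^r$ ($H^1$ vector fields along $\gamma$; $\nabla$ is covariant differentiation along $\gamma$ for the Levi–Civita connection). The energy function is $E(\gamma)=\int_{\mathbb{T}}|\gamma'(z)|^2dz$, whose critical points are the closed geodesics. A closed geodesic with period $n$ means an $n$-fold iterate of a primitive closed geodesic (a geodesic loop $t\mapsto f(nt)$ with $f$ a primitive closed geodesic). A trajectory is a flow line, defined for all real time, of the gradient dynamics in the energy-decreasing direction; convergence in positive (negative) time is the limit as time tends to $+\infty$ ($-\infty$). *)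

theory Defs
  imports "HOL-Analysis.Analysis"
begin

section \<open>Complex projective space with the Fubini--Study metric\<close>

text \<open>
  A point of the projective space of the vector space \<open>complex^'d\<close> (of complex dimension
  \<open>CARD('d) - 1\<close>) is the class of a nonzero vector up to nonzero scalars.  The class of \<open>z\<close> is
  represented by the orthogonal projection \<open>z z\<^sup>* / |z|\<^sup>2\<close> onto the complex line spanned by
  \<open>z\<close>: by \<open>cproj_eq_iff\<close> below, two vectors have the same image exactly if they are proportional.
  This realises the projective space as a compact smooth submanifold of the Euclidean space of
  complex matrices.
\<close>

definition cproj :: "complex^'d \<Rightarrow> complex^'d^'d"
  where "cproj z = (\<chi> i j. z $ i * cnj (z $ j) / complex_of_real ((norm z)\<^sup>2))"

definition CP :: "(complex^'d^'d) set"
  where "CP = cproj ` (- {0})"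

definition tangent_CP :: "complex^'d^'d \<Rightarrow> (complex^'d^'d) set"
  where "tangent_CP p = {X. \<exists>c :: real \<Rightarrow> complex^'d^'d.
           (\<forall>t. c t \<in> CP) \<and> c 0 = p \<and> (c has_vector_derivative X) (at 0)}"

text \<open>
  The factor 1/2 makes this the usual Fubini--Study metric, for which the projection from the unit
  sphere is a Riemannian submersion; see \<open>fs_metric_pullback\<close> below.
\<close>

definition fs_metric :: "complex^'d^'d \<Rightarrow> complex^'d^'d \<Rightarrow> real"
  where "fs_metric X Y = (X \<bullet> Y) / 2"

text \<open>
  Covariant derivative at \<open>t\<close> of a vector field \<open>\<xi>\<close> along the curve \<open>\<gamma>\<close>, for the Levi-Civita
  connection: as the metric is induced by a constant multiple of the Euclidean inner product, this is
  the component of the ordinary derivative tangent to the submanifold.  The tangent space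
  is a linear subspace (\<open>subspace_tangent_CP\<close>), so the nearest point in it is the orthogonal
  projection to it.
\<close>

definition covd :: "(real \<Rightarrow> complex^'d^'d) \<Rightarrow> (real \<Rightarrow> complex^'d^'d) \<Rightarrow> real \<Rightarrow> complex^'d^'d"
  where "covd \<gamma> \<xi> t = closest_point (tangent_CP (\<gamma> t)) (vector_derivative \<xi> (at t))"


section \<open>The Hilbert manifold of loops\<close>

text \<open>
  The circle is \<open>\<real>/\<int>\<close>, so loops and vector fields along them are functions on the real line of
  period 1.  Class \<open>H\<^sup>1\<close> means absolutely continuous with square integrable derivative; absolute
  continuity is expressed as almost everywhere differentiability with integrable derivative satisfying
  the fundamental theorem of calculus.
\<close>

definition H1 :: "(real \<Rightarrow> 'a::euclidean_space) set"
  where "H1 = {f. (\<forall>t. f (t + 1) = f t) \<and>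
     negligible {t. \<not> f differentiable (at t)} \<and>
     (\<lambda>t. vector_derivative f (at t)) absolutely_integrable_on {0..1} \<and>
     (\<lambda>t. (norm (vector_derivative f (at t)))\<^sup>2) integrable_on {0..1} \<and>
     (\<forall>t\<in>{0..1}. f t = f 0 + integral {0..t} (\<lambda>x. vector_derivative f (at x)))}"

definition H1_norm :: "(real \<Rightarrow> 'a::euclidean_space) \<Rightarrow> real"
  where "H1_norm f = sqrt (integral {0..1} (\<lambda>t. (norm (f t))\<^sup>2 + (norm (vector_derivative f (at t)))\<^sup>2))"

text \<open>
  The loop space is a closed Hilbert submanifold of the Hilbert space \<open>H1\<close> of loops of matrices.
  Topology, differentiability of curves, and velocities are those of this ambient Hilbert space.
\<close>

definition LCP :: "(real \<Rightarrow> complex^'d^'d) set"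
  where "LCP = {\<gamma> \<in> H1. \<forall>t. \<gamma> t \<in> CP}"

definition tangent_LCP :: "(real \<Rightarrow> complex^'d^'d) \<Rightarrow> (real \<Rightarrow> complex^'d^'d) set"
  where "tangent_LCP \<gamma> = {\<xi> \<in> H1. \<forall>t. \<xi> t \<in> tangent_CP (\<gamma> t)}"

definition metric1 ::
  "(real \<Rightarrow> complex^'d^'d) \<Rightarrow> (real \<Rightarrow> complex^'d^'d) \<Rightarrow> (real \<Rightarrow> complex^'d^'d) \<Rightarrow> real"
  where "metric1 \<gamma> \<xi> \<eta> =
     integral {0..1} (\<lambda>t. fs_metric (\<xi> t) (\<eta> t) + fs_metric (covd \<gamma> \<xi> t) (covd \<gamma> \<eta> t))"

definition energy :: "(real \<Rightarrow> complex^'d^'d) \<Rightarrow> real"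
  where "energy \<gamma> = integral {0..1}
     (\<lambda>t. fs_metric (vector_derivative \<gamma> (at t)) (vector_derivative \<gamma> (at t)))"

definition H1_has_derivative ::
  "(real \<Rightarrow> real \<Rightarrow> 'a::euclidean_space) \<Rightarrow> (real \<Rightarrow> 'a) \<Rightarrow> real \<Rightarrow> bool"
  where "H1_has_derivative c \<eta> s \<longleftrightarrow>
     ((\<lambda>h. H1_norm (\<lambda>t. (c (s + h) t - c s t) /\<^sub>R h - \<eta> t)) \<longlongrightarrow> 0) (at 0)"

definition H1_tendsto ::
  "(real \<Rightarrow> real \<Rightarrow> 'a::euclidean_space) \<Rightarrow> (real \<Rightarrow> 'a) \<Rightarrow> real filter \<Rightarrow> bool"
  where "H1_tendsto u f F \<longleftrightarrow> ((\<lambda>s. H1_norm (\<lambda>t. u s t - f t)) \<longlongrightarrow> 0) F"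

text \<open>
  \<open>\<xi>\<close> is the gradient of the energy at \<open>\<gamma>\<close>: the differential of the energy at \<open>\<gamma>\<close>, evaluated on
  the velocity \<open>\<eta>\<close> of any curve through \<open>\<gamma>\<close> in the loop space, is the inner product of \<open>\<xi>\<close>
  and \<open>\<eta>\<close>.
\<close>

definition is_energy_gradient :: "(real \<Rightarrow> complex^'d^'d) \<Rightarrow> (real \<Rightarrow> complex^'d^'d) \<Rightarrow> bool"
  where "is_energy_gradient \<gamma> \<xi> \<longleftrightarrow> \<xi> \<in> tangent_LCP \<gamma> \<and>
     (\<forall>c \<eta>. (\<forall>s. c s \<in> LCP) \<longrightarrow> c 0 = \<gamma> \<longrightarrow> \<eta> \<in> tangent_LCP \<gamma> \<longrightarrow> H1_has_derivative c \<eta> 0 \<longrightarrow>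
        ((\<lambda>s. energy (c s)) has_real_derivative metric1 \<gamma> \<xi> \<eta>) (at 0))"

definition trajectory :: "(real \<Rightarrow> real \<Rightarrow> complex^'d^'d) \<Rightarrow> bool"
  where "trajectory u \<longleftrightarrow>
     (\<forall>s. u s \<in> LCP \<and> (\<exists>\<xi>. is_energy_gradient (u s) \<xi> \<and> H1_has_derivative u (\<lambda>t. - \<xi> t) s))"


section \<open>Closed geodesics\<close>

definition closed_geodesic :: "(real \<Rightarrow> complex^'d^'d) \<Rightarrow> bool"
  where "closed_geodesic \<gamma> \<longleftrightarrow>
     (\<forall>t. \<gamma> t \<in> CP \<and> \<gamma> (t + 1) = \<gamma> t \<and> \<gamma> differentiable (at t) \<and>
        (\<lambda>x. vector_derivative \<gamma> (at x)) differentiable (at t) \<and>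
        covd \<gamma> (\<lambda>x. vector_derivative \<gamma> (at x)) t = 0)"

definition primitive_closed_geodesic :: "(real \<Rightarrow> complex^'d^'d) \<Rightarrow> bool"
  where "primitive_closed_geodesic f \<longleftrightarrow> closed_geodesic f \<and> \<not> f constant_on UNIV \<and>
     \<not> (\<exists>m\<ge>2. \<exists>g. closed_geodesic g \<and> f = (\<lambda>t. g (real m * t)))"

definition geodesic_with_period :: "nat \<Rightarrow> (real \<Rightarrow> complex^'d^'d) \<Rightarrow> bool"
  where "geodesic_with_period n \<gamma> \<longleftrightarrow>
     (\<exists>f. primitive_closed_geodesic f \<and> \<gamma> = (\<lambda>t. f (real n * t)))"


section \<open>The projection model and the quotient definition\<close>

definition herm :: "complex^'d \<Rightarrow> complex^'d \<Rightarrow> complex"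
  where "herm a b = (\<Sum>i\<in>UNIV. a $ i * cnj (b $ i))"

definition outer :: "complex^'d \<Rightarrow> complex^'d \<Rightarrow> complex^'d^'d"
  where "outer a b = (\<chi> i j. a $ i * cnj (b $ j))"

definition dcproj :: "complex^'d \<Rightarrow> complex^'d \<Rightarrow> complex^'d^'d"
  where "dcproj z v = (outer v z + outer z v) /\<^sub>R (norm z)\<^sup>2
            - (2 * (z \<bullet> v) / (norm z)^4) *\<^sub>R outer z z"

lemma herm_self: "herm z z = complex_of_real ((norm z)\<^sup>2)"
  unfolding herm_def norm_vec_def L2_set_def
  by (simp add: sum_nonneg complex_norm_square[symmetric])

lemma Re_herm: "Re (herm a b) = a \<bullet> b"
  by (simp add: herm_def inner_vec_def inner_complex_def)

lemma cnj_herm: "cnj (herm a b) = herm b a"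
  by (simp add: herm_def mult.commute)

lemma cproj_outer: "cproj z = outer z z /\<^sub>R (norm z)\<^sup>2"
  by (simp add: vec_eq_iff cproj_def outer_def scaleR_conv_of_real[where 'a = complex] divide_inverse)

lemma cproj_eq_iff:
  fixes z w :: "complex^'d"
  assumes "z \<noteq> 0" "w \<noteq> 0"
  shows "cproj z = cproj w \<longleftrightarrow> (\<exists>c. c \<noteq> 0 \<and> w = c *s z)"
proof
  assume eq: "cproj z = cproj w"
  from \<open>w \<noteq> 0\<close> obtain j where j: "w $ j \<noteq> 0" by (auto simp: vec_eq_iff)
  have E: "z $ i * cnj (z $ j) / (norm z)\<^sup>2 = w $ i * cnj (w $ j) / (norm w)\<^sup>2" for i
    using eq by (auto simp: cproj_def vec_eq_iff)
  define c where "c = cnj (z $ j) * (norm w)\<^sup>2 / ((norm z)\<^sup>2 * cnj (w $ j))"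
  have "w $ i = c * z $ i" for i
    using E[of i] assms j by (simp add: c_def field_simps)
  hence "w = c *s z" by (simp add: vec_eq_iff)
  thus "\<exists>c. c \<noteq> 0 \<and> w = c *s z" using \<open>w \<noteq> 0\<close> by auto
next
  assume "\<exists>c. c \<noteq> 0 \<and> w = c *s z"
  then obtain c where c: "c \<noteq> 0" "w = c *s z" by blast
  have "complex_of_real ((norm w)\<^sup>2) = c * cnj c * complex_of_real ((norm z)\<^sup>2)"
    unfolding herm_self[symmetric] c(2) by (simp add: herm_def sum_distrib_left mult_ac)
  note n = this
  have "w $ i * cnj (w $ j) / complex_of_real ((norm w)\<^sup>2)
      = z $ i * cnj (z $ j) / complex_of_real ((norm z)\<^sup>2)" for i j
    unfolding n using c(1) assms(1) by (simp add: c(2))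
  thus "cproj z = cproj w" by (simp add: cproj_def)
qed

lemma inner_outer: "outer a b \<bullet> outer c d = Re (herm a c * cnj (herm b d))"
proof -
  have "herm a c * cnj (herm b d)
      = (\<Sum>i\<in>UNIV. \<Sum>j\<in>UNIV. (a $ i * cnj (c $ i)) * (cnj (b $ j) * d $ j))"
    unfolding herm_def cnj_sum sum_product by simp
  also have "Re \<dots> = outer a b \<bullet> outer c d"
    by (simp add: outer_def inner_vec_def inner_complex_def) (simp add: algebra_simps)
  finally show ?thesis by simp
qed

lemma bounded_linear_component2: "bounded_linear (\<lambda>x :: complex^'d^'d. x $ i $ j)"
  by (rule bounded_linear_compose[OF bounded_linear_vec_nth bounded_linear_vec_nth])

lemma bounded_bilinear_outer: "bounded_bilinear outer"
  unfolding bilinear_conv_bounded_bilinear[symmetric] bilinear_def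
  by (auto intro!: linearI simp: outer_def vec_eq_iff algebra_simps)

lemma has_derivative_outer: "((\<lambda>z. outer z z) has_derivative (\<lambda>v. outer v z + outer z v)) (at z)"
  by (rule has_derivative_eq_rhs[OF
        bounded_bilinear.FDERIV[OF bounded_bilinear_outer has_derivative_ident has_derivative_ident]])
    (simp add: fun_eq_iff add.commute)

lemma has_derivative_cproj:
  fixes z :: "complex^'d"
  assumes "z \<noteq> 0"
  shows "(cproj has_derivative dcproj z) (at z)"
proof -
  have n: "((\<lambda>z::complex^'d. (norm z)\<^sup>2) has_derivative (\<lambda>v. 2 * (z \<bullet> v))) (at z)"
    unfolding power2_norm_eq_inner
    by (auto intro!: derivative_eq_intros simp: inner_commute)
  have "((\<lambda>z. inverse ((norm z)\<^sup>2) *\<^sub>R outer z z) has_derivative dcproj z) (at z)"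
    apply (rule has_derivative_eq_rhs)
     apply (rule has_derivative_scaleR)
      apply (rule Deriv.has_derivative_inverse[OF _ n])
      apply (use assms in simp)
     apply (rule has_derivative_outer)
    apply (use assms in \<open>simp add: fun_eq_iff dcproj_def divide_inverse power4_eq_xxxx
        power2_eq_square mult_ac\<close>)
    done
  thus ?thesis unfolding cproj_outer[abs_def] .
qed

text \<open>The classical formula for the Fubini--Study metric in homogeneous coordinates.\<close>

lemma fs_metric_pullback:
  fixes z v w :: "complex^'d"
  assumes "z \<noteq> 0"
  shows "fs_metric (dcproj z v) (dcproj z w)
    = Re ((norm z)\<^sup>2 * herm v w - herm v z * herm z w) / (norm z)^4"
proof -
  define N where "N = (norm z)\<^sup>2"
  have N: "N \<noteq> 0" "(norm z)^4 = N\<^sup>2" using assms by (auto simp: N_def)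
  define a where "a = Re (herm v z)"
  define a' where "a' = Im (herm v z)"
  define b where "b = Re (herm w z)"
  define b' where "b' = Im (herm w z)"
  define e where "e = Re (herm v w)"
  have z: "herm z z = complex_of_real N" by (simp add: herm_self N_def)
  have za: "z \<bullet> v = a" "z \<bullet> w = b" by (simp_all add: a_def b_def Re_herm inner_commute)
  have "herm z v = cnj (herm v z)" "herm z w = cnj (herm w z)" "herm w v = cnj (herm v w)"
    by (simp_all add: cnj_herm)
  note h = this
  have r: "Re (herm v z) = a" "Im (herm v z) = a'" "Re (herm w z) = b" "Im (herm w z) = b'"
     "Re (herm v w) = e" by (simp_all add: a_def a'_def b_def b'_def e_def)
  show ?thesis
    unfolding fs_metric_def dcproj_def N(2) N_def[symmetric] za
    using N(1)
    by (simp add: inner_add_left inner_add_right inner_diff_left inner_diff_right inner_outer z h r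
        divide_simps) (simp add: algebra_simps power2_eq_square)
qed

lemma linear_dcproj: "linear (dcproj z)"
proof (rule linearI)
  show "dcproj z (a + b) = dcproj z a + dcproj z b" for a b
  proof -
    have "outer (a + b) z = outer a z + outer b z" "outer z (a + b) = outer z a + outer z b"
      by (simp_all add: outer_def vec_eq_iff algebra_simps)
    thus ?thesis
      by (simp add: dcproj_def inner_add_right scaleR_add_right scaleR_add_left distrib_left
          add_divide_distrib)
  qed
  show "dcproj z (r *\<^sub>R a) = r *\<^sub>R dcproj z a" for r a
  proof -
    have "outer (r *\<^sub>R a) z = r *\<^sub>R outer a z" "outer z (r *\<^sub>R a) = r *\<^sub>R outer z a"
      by (simp_all add: outer_def vec_eq_iff)
    thus ?thesis
      by (simp add: dcproj_def scaleR_diff_right scaleR_add_right mult_ac)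
  qed
qed

lemma tangent_CP_cproj:
  fixes z :: "complex^'d"
  assumes z: "z \<noteq> 0"
  shows "tangent_CP (cproj z) = range (dcproj z)"
proof (intro equalityI subsetI)
  fix X assume "X \<in> range (dcproj z)"
  then obtain v where X: "X = dcproj z v" by blast
  define l where "l = (\<lambda>t::real. z + t *\<^sub>R v)"
  define c where "c = (\<lambda>t. if l t = 0 then cproj z else cproj (l t))"
  have l: "(l has_vector_derivative v) (at 0)"
    unfolding l_def by (auto intro!: derivative_eq_intros)
  have "((cproj \<circ> l) has_vector_derivative X) (at 0)"
    unfolding has_vector_derivative_def o_def
    apply (rule has_derivative_eq_rhs)
     apply (rule has_derivative_compose[OF l[unfolded has_vector_derivative_def]])
     apply (simp add: l_def, rule has_derivative_cproj[OF z])
    apply (simp add: fun_eq_iff X linear_scale[OF linear_dcproj])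
    done
  moreover have "\<forall>\<^sub>F t in at 0. l t \<noteq> 0"
  proof -
    have "isCont l 0" using l by (rule has_vector_derivative_continuous)
    hence "(l \<longlongrightarrow> z) (at 0)" by (simp add: isCont_def l_def)
    thus ?thesis using z by (rule tendsto_imp_eventually_ne)
  qed
  then have "\<forall>\<^sub>F t in at 0. (cproj \<circ> l) t = c t"
    by eventually_elim (simp add: c_def)
  moreover have "(cproj \<circ> l) 0 = c 0" using z by (simp add: c_def l_def)
  ultimately have "(c has_vector_derivative X) (at 0)"
    unfolding has_vector_derivative_def
    by (metis has_derivative_transform_eventually UNIV_I)
  moreover have "c 0 = cproj z" "\<forall>t. c t \<in> CP"
    using z by (auto simp: c_def l_def CP_def)
  ultimately show "X \<in> tangent_CP (cproj z)" unfolding tangent_CP_def by blast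
next
  fix X assume "X \<in> tangent_CP (cproj z)"
  then obtain c where c: "\<And>t. c t \<in> CP" "c 0 = cproj z" "(c has_vector_derivative X) (at 0)"
    unfolding tangent_CP_def by blast
  have d: "((\<lambda>t. c t $ i $ j) has_vector_derivative X $ i $ j) (at 0)" for i j
    by (rule bounded_linear.has_vector_derivative[OF bounded_linear_component2 c(3)])
  have idem: "p $ i $ j = (\<Sum>k\<in>UNIV. p $ i $ k * p $ k $ j)" and sa: "p $ i $ j = cnj (p $ j $ i)"
    if p: "p \<in> CP" for p :: "complex^'d^'d" and i j
  proof -
    obtain y where y: "y \<noteq> 0" "p = cproj y" using p by (auto simp: CP_def)
    have "(\<Sum>k\<in>UNIV. p $ i $ k * p $ k $ j)
        = y $ i * cnj (y $ j) / (complex_of_real ((norm y)\<^sup>2))\<^sup>2 * herm y y"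
      unfolding y cproj_def herm_def
      by (simp add: sum_distrib_left sum_distrib_right power2_eq_square divide_simps mult_ac)
    thus "p $ i $ j = (\<Sum>k\<in>UNIV. p $ i $ k * p $ k $ j)"
      using y(1) unfolding herm_self by (simp add: y(2) cproj_def power2_eq_square)
    show "p $ i $ j = cnj (p $ j $ i)" by (simp add: y(2) cproj_def mult.commute)
  qed
  define P where "P = cproj z"
  have Xp: "X $ i $ j = (\<Sum>k\<in>UNIV. P $ i $ k * X $ k $ j + X $ i $ k * P $ k $ j)" for i j
  proof -
    have "((\<lambda>t. \<Sum>k\<in>UNIV. c t $ i $ k * c t $ k $ j) has_vector_derivative
       (\<Sum>k\<in>UNIV. c 0 $ i $ k * X $ k $ j + X $ i $ k * c 0 $ k $ j)) (at 0)"
      by (intro has_vector_derivative_sum has_vector_derivative_mult d)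
    hence "((\<lambda>t. c t $ i $ j) has_vector_derivative
       (\<Sum>k\<in>UNIV. c 0 $ i $ k * X $ k $ j + X $ i $ k * c 0 $ k $ j)) (at 0)"
      by (simp only: idem[OF c(1), symmetric])
    from vector_derivative_unique_at[OF d this] show ?thesis unfolding c(2) P_def .
  qed
  have Xs: "X $ i $ j = cnj (X $ j $ i)" for i j
  proof -
    have "((\<lambda>t. cnj (c t $ j $ i)) has_vector_derivative cnj (X $ j $ i)) (at 0)"
      by (rule bounded_linear.has_vector_derivative[OF bounded_linear_cnj d])
    hence "((\<lambda>t. c t $ i $ j) has_vector_derivative cnj (X $ j $ i)) (at 0)"
      by (simp only: sa[OF c(1), symmetric])
    from vector_derivative_unique_at[OF d this] show ?thesis .
  qed
  define w where "w = X *v z"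
  define N where "N = complex_of_real ((norm z)\<^sup>2)"
  have N: "N \<noteq> 0" using z by (simp add: N_def)
  have w: "w $ i = (\<Sum>k\<in>UNIV. X $ i $ k * z $ k)" for i
    by (simp add: w_def matrix_vector_mult_def)
  have cw: "cnj (w $ j) = (\<Sum>k\<in>UNIV. cnj (z $ k) * X $ k $ j)" for j
    unfolding w cnj_sum by (rule sum.cong) (simp_all add: Xs[of _ j] mult.commute)
  have X: "X $ i $ j = (w $ i * cnj (z $ j) + z $ i * cnj (w $ j)) / N" for i j
  proof -
    have "X $ i $ j = (\<Sum>k\<in>UNIV. z $ i * (cnj (z $ k) * X $ k $ j) / N)
           + (\<Sum>k\<in>UNIV. (X $ i $ k * z $ k) * cnj (z $ j) / N)"
      by (subst Xp) (simp add: P_def cproj_def N_def sum.distrib mult_ac)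
    thus ?thesis unfolding cw
      by (simp add: w sum_distrib_left sum_distrib_right sum_divide_distrib add_divide_distrib)
  qed
  have "w $ i = w $ i + z $ i * herm z w / N" for i
  proof -
    have "w $ i = (\<Sum>k\<in>UNIV. w $ i * (z $ k * cnj (z $ k)) / N + z $ i * (z $ k * cnj (w $ k)) / N)"
    proof -
      have "X $ i $ k * z $ k = w $ i * (z $ k * cnj (z $ k)) / N + z $ i * (z $ k * cnj (w $ k)) / N"
        for k
        unfolding X by (simp add: algebra_simps add_divide_distrib)
      thus ?thesis by (subst w) simp
    qed
    also have "\<dots> = w $ i * herm z z / N + z $ i * herm z w / N"
      by (simp add: herm_def sum.distrib sum_distrib_left sum_divide_distrib)
    finally show ?thesis using N by (simp add: herm_self N_def)
  qed
  hence "herm z w = 0" using z N by (auto simp: vec_eq_iff)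
  hence zw: "z \<bullet> w = 0" using Re_herm[of z w] by simp
  have "X = dcproj z w"
    unfolding dcproj_def zw
    by (simp add: vec_eq_iff X outer_def N_def scaleR_conv_of_real[where 'a = complex] divide_inverse mult.commute)
  thus "X \<in> range (dcproj z)" by blast
qed

lemma subspace_tangent_CP:
  assumes "p \<in> CP"
  shows "subspace (tangent_CP p)"
proof -
  obtain z where "z \<noteq> 0" "p = cproj z" using assms by (auto simp: CP_def)
  thus ?thesis
    using linear_subspace_image[OF linear_dcproj subspace_UNIV] by (simp add: tangent_CP_cproj)
qed

lemma fs_metric_projection:
  assumes p: "p \<in> CP" and Y: "Y \<in> tangent_CP p"
  shows "fs_metric (closest_point (tangent_CP p) X) Y = fs_metric X Y"
proof -
  let ?T = "tangent_CP p" and ?c = "closest_point (tangent_CP p) X"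
  have T: "subspace ?T" using p by (rule subspace_tangent_CP)
  have cl: "closed ?T" "convex ?T" using T by (simp_all add: closed_subspace subspace_imp_convex)
  have c: "?c \<in> ?T" using cl Y by (intro closest_point_in_set) auto
  have "(X - ?c) \<bullet> ((?c + Y) - ?c) \<le> 0" "(X - ?c) \<bullet> ((?c - Y) - ?c) \<le> 0"
    by (rule closest_point_dot[OF cl(2,1)], rule subspace_add[OF T c Y])
      (rule closest_point_dot[OF cl(2,1)], rule subspace_diff[OF T c Y])
  hence "(X - ?c) \<bullet> Y = 0" by simp
  thus ?thesis by (simp add: fs_metric_def inner_diff_left)
qed

text \<open>
  Compatibility of the covariant derivative with the metric.  (Torsion-freeness is immediate:
  for a parametrised surface the two mixed covariant derivatives are tangent components of the same
  mixed second partial derivative.)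
\<close>

lemma covd_metric:
  assumes "\<And>t. \<gamma> t \<in> CP" "\<And>t. \<xi> t \<in> tangent_CP (\<gamma> t)" "\<And>t. \<eta> t \<in> tangent_CP (\<gamma> t)"
    and "\<xi> differentiable (at t)" "\<eta> differentiable (at t)"
  shows "((\<lambda>t. fs_metric (\<xi> t) (\<eta> t)) has_real_derivative
    fs_metric (covd \<gamma> \<xi> t) (\<eta> t) + fs_metric (\<xi> t) (covd \<gamma> \<eta> t)) (at t)"
proof -
  let ?x = "vector_derivative \<xi> (at t)" and ?e = "vector_derivative \<eta> (at t)"
  have comm: "fs_metric A B = fs_metric B A" for A B :: "complex^'a^'a"
    by (simp add: fs_metric_def inner_commute)
  have "((\<lambda>t. \<xi> t \<bullet> \<eta> t) has_vector_derivative \<xi> t \<bullet> ?e + ?x \<bullet> \<eta> t) (at t)"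
    using assms(4,5) unfolding vector_derivative_works
    by (rule bounded_bilinear.has_vector_derivative[OF bounded_bilinear_inner])
  hence "((\<lambda>t. \<xi> t \<bullet> \<eta> t) has_real_derivative \<xi> t \<bullet> ?e + ?x \<bullet> \<eta> t) (at t)"
    by (simp add: has_real_derivative_iff_has_vector_derivative)
  from DERIV_cdivide[OF this, of 2]
  have "((\<lambda>t. fs_metric (\<xi> t) (\<eta> t)) has_real_derivative
      fs_metric ?x (\<eta> t) + fs_metric (\<xi> t) ?e) (at t)"
    by (simp add: fs_metric_def add_divide_distrib add.commute)
  moreover have "fs_metric (covd \<gamma> \<xi> t) (\<eta> t) = fs_metric ?x (\<eta> t)"
    unfolding covd_def using assms(1,3) by (rule fs_metric_projection)
  moreover have "fs_metric (covd \<gamma> \<eta> t) (\<xi> t) = fs_metric ?e (\<xi> t)"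
    unfolding covd_def using assms(1,2) by (rule fs_metric_projection)
  ultimately show ?thesis by (simp add: comm[of "\<xi> t"])
qed

end

theory Submission
  imports Defs
begin

text \<open>
  Let \<open>U t\<close> be the diagonal unitary matrix with entries \<open>exp(i t a\<^sub>j)\<close>, where
  \<open>a = (0, 2\<pi>n, 2\<pi>(n+1))\<close>.  The loops \<open>t \<mapsto> U t [z]\<close> are the fixed points of an isometric circle
  action on the loop space that preserves the energy, so the gradient is tangent to them and its flow
  becomes an ordinary differential equation for \<open>z\<close>; real vectors \<open>z\<close> are preserved as well.
  The energy of such a loop is the variance of \<open>a\<close> under the probability weights \<open>z\<^sub>j\<^sup>2\<close>, and its
  critical points of energy at least \<open>(2\<pi>n)\<^sup>2/4\<close> are the midpoints of the edges \<open>{1,2}\<close> and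
  \<open>{1,3}\<close> of the simplex of weights, the geodesics of periods \<open>n\<close> and \<open>n + 1\<close>.

  On the wall where the mean of \<open>a\<close> is \<open>\<pi>n\<close> the variance is at least \<open>(2\<pi>n)\<^sup>2/4\<close>, so a flow line
  that drops below this energy stays on one side of the wall.  A path in the interior of the simplex
  from the first to the second vertex begins on one side and ends on the other; by connectedness one
  of its points never drops below.  By LaSalle's principle its flow line converges forwards to the
  first midpoint and backwards to the second.
\<close>

section \<open>Global solutions of Lipschitz ordinary differential equations\<close>

text \<open>\<open>is_energy_gradient\<close> tests against every H1 field along the loop, so the
  gradient equation has to be verified beyond equivariant fields. The gradient X is determined by
  the weak form of X - nabla nabla X = -2 nabla gamma'. Along an equivariant loop every term that
  involves X or gamma is carried around by one unitary conjugation, and integration by parts reduces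
  the equation to t = 0. There nabla sends a real direction x to i \<open>hess\<close> x and ix to
  -\<open>hess\<close> x; two derivatives give minus the square of \<open>hess\<close>, so real
  vectors stay real and the operator to be inverted is 1 + \<open>hess\<close>^2.

  With b = 2 pi n and c = 2 pi (n + 1), the midpoint of the third edge {2,3} has energy (c - b)^2/4,
  which lies below b^2/4 exactly when c < 2b, that is, n >= 2. A flow line kept at or above b^2/4
  then has two possible limits up to signs, and the energy alone decides between them: interior
  points lie below c^2/4, which excludes the second midpoint forwards, and a backward limit at level
  b^2/4 would make the energy constant.\<close>

lemma antiderivative_ex:
  fixes g :: "real \<Rightarrow> 'a::euclidean_space"
  assumes "continuous_on UNIV g"
  shows "\<exists>G. G 0 = 0 \<and> (\<forall>t. (G has_vector_derivative g t) (at t))"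
proof -
  let ?G = "\<lambda>u. LBINT y=ereal 0..ereal u. g y"
  have "(?G has_vector_derivative g t) (at t)" for t
  proof -
    have "(?G has_vector_derivative g t) (at t within {-\<bar>t\<bar>-1..\<bar>t\<bar>+1})"
      by (rule interval_integral_FTC2) (auto intro: continuous_on_subset[OF assms])
    moreover have "at t within {-\<bar>t\<bar>-1..\<bar>t\<bar>+1} = at t"
      by (rule at_within_interior) auto
    ultimately show ?thesis by simp
  qed
  moreover have "?G 0 = 0" by simp
  ultimately show ?thesis by (intro exI[of _ ?G] conjI allI)
qed

text \<open>Integrating K exp(M |t|) from 0 gains the factor 1/M. In the norm with weight exp(-M
  |t|) this gain beats any Lipschitz constant below M.\<close>

lemma norm_le_exp_of_derivative_le:
  fixes G :: "real \<Rightarrow> 'a::euclidean_space"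
  assumes G: "G 0 = 0" "\<And>t. (G has_vector_derivative g t) (at t)"
    and g: "\<And>t. norm (g t) \<le> K * exp (M * \<bar>t\<bar>)" and M: "M > 0"
  shows "norm (G t) \<le> K / M * exp (M * \<bar>t\<bar>)"
proof -
  have pos: "norm (G t) \<le> K / M * exp (M * t)"
    if G: "G 0 = 0" "\<And>t. (G has_vector_derivative g t) (at t)"
    and g: "\<And>t. norm (g t) \<le> K * exp (M * \<bar>t\<bar>)" and t: "t \<ge> 0"
    for G :: "real \<Rightarrow> 'a" and g t
  proof (cases "t = 0")
    case True
    have "0 \<le> K * exp (M * \<bar>0\<bar>)" using order_trans[OF norm_ge_zero g[of 0]] .
    then show ?thesis using True G M by simp
  next
    case False
    have "norm (G t - G 0) \<le> K / M * exp (M * t) - K / M * exp (M * 0)"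
    proof (rule differentiable_bound_general[where f' = g and \<phi>' = "\<lambda>t. K * exp (M * t)"])
      show "continuous_on {0..t} G"
        by (rule differentiable_imp_continuous_on)
          (meson G(2) differentiable_at_imp_differentiable_on differentiableI_vector)
      show "continuous_on {0..t} (\<lambda>t. K / M * exp (M * t))" by (intro continuous_intros)
      show "((\<lambda>t. K / M * exp (M * t)) has_vector_derivative K * exp (M * x)) (at x)" for x
        using M by (auto intro!: derivative_eq_intros simp: has_real_derivative_iff_has_vector_derivative[symmetric])
      show "norm (g x) \<le> K * exp (M * x)" if "0 < x" for x using g[of x] that by simp
    qed (use False t G in auto)
    moreover have "K \<ge> 0" using order_trans[OF norm_ge_zero g[of 0]] by simp
    ultimately show ?thesis using G M by (simp add: field_simps)
  qed
  show ?thesis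
  proof (cases "t \<ge> 0")
    case True then show ?thesis using pos[OF G g] by simp
  next
    case False
    have "norm ((\<lambda>t. G (- t)) (- t)) \<le> K / M * exp (M * (- t))"
    proof (rule pos[where g = "\<lambda>t. - g (- t)"])
      show "((\<lambda>t. G (- t)) has_vector_derivative - g (- t)) (at t)" for t
        proof -
        have "(uminus has_vector_derivative - 1) (at t)" by (auto intro!: derivative_eq_intros)
        from vector_diff_chain_at[OF this G(2)] show ?thesis by (simp add: o_def)
      qed
      show "norm (- g (- t)) \<le> K * exp (M * \<bar>t\<bar>)" for t using g[of "- t"] by simp
    qed (use G False in auto)
    then show ?thesis using False by simp
  qed
qed

text \<open>Picard iteration is a contraction of the bounded continuous functions \<open>y\<close> once a solution is
  written as \<open>x\<^sub>0 + exp (M \<bar>t\<bar>) y(t)\<close> with \<open>M > L\<close>; this gives a global solution in one step.\<close>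

lemma Lipschitz_ode_solution_ex:
  fixes F :: "'a::euclidean_space \<Rightarrow> 'a"
  assumes L: "\<And>x y. norm (F x - F y) \<le> L * norm (x - y)"
  shows "\<exists>x. x 0 = x0 \<and> (\<forall>t. (x has_vector_derivative F (x t)) (at t))"
proof -
  have L0: "L \<ge> 0"
  proof -
    obtain b :: 'a where b: "b \<in> Basis" using nonempty_Basis by blast
    have "0 \<le> L * norm (b - 0)" using L[of b 0] norm_ge_zero order_trans by blast
    then show ?thesis using b by simp
  qed
  have contF: "continuous_on UNIV F"
    by (rule lipschitz_on_continuous_on[of L]) (use L L0 in \<open>auto simp: lipschitz_on_def dist_norm\<close>)
  \<comment> \<open>Any \<open>M > L\<close> would make \<open>L / M < 1\<close>; the summand 1
    keeps \<open>M\<close> positive when \<open>L = 0\<close>.\<close>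
  define M where "M = 2 * L + 1"
  have M: "M > 0" using L0 by (simp add: M_def)
  define w where "w = (\<lambda>(y :: real \<Rightarrow>\<^sub>C 'a) t. x0 + exp (M * \<bar>t\<bar>) *\<^sub>R y t)"
  have contw: "continuous_on UNIV (\<lambda>t. F (w y t))" for y
    unfolding w_def by (intro continuous_intros continuous_on_compose2[OF contF]) auto
  obtain I where I: "\<And>y. I y 0 = 0" "\<And>y t. (I y has_vector_derivative F (w y t)) (at t)"
    using antiderivative_ex[OF contw] by metis
  have Idiff: "norm (I y t - I z t) \<le> L * dist y z / M * exp (M * \<bar>t\<bar>)" for y z t
  proof (rule norm_le_exp_of_derivative_le[where g = "\<lambda>t. F (w y t) - F (w z t)"])
    show "I y 0 - I z 0 = 0" using I by simp
    show "((\<lambda>t. I y t - I z t) has_vector_derivative F (w y t) - F (w z t)) (at t)" for t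
      by (intro derivative_intros I)
    show "norm (F (w y t) - F (w z t)) \<le> L * dist y z * exp (M * \<bar>t\<bar>)" for t
    proof -
      have "norm (w y t - w z t) = exp (M * \<bar>t\<bar>) * dist (y t) (z t)"
        by (simp add: w_def dist_norm flip: scaleR_diff_right)
      also have "\<dots> \<le> exp (M * \<bar>t\<bar>) * dist y z" by (intro mult_left_mono dist_bounded) auto
      finally have "L * norm (w y t - w z t) \<le> L * (exp (M * \<bar>t\<bar>) * dist y z)"
        using L0 by (intro mult_left_mono)
      then show ?thesis using L[of "w y t" "w z t"] by (simp add: mult_ac)
    qed
  qed (rule M)
  \<comment> \<open>At \<open>y = 0\<close> the curve \<open>w 0\<close> is constantly
    \<open>x0\<close>. Together with \<open>Sdiff\<close> this bounds every \<open>S y\<close>, as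
    membership in \<open>bcontfun\<close> requires.\<close>
  have I0: "norm (I 0 t) \<le> norm (F x0) / M * exp (M * \<bar>t\<bar>)" for t
  proof (rule norm_le_exp_of_derivative_le[OF I(1) I(2) _ M])
    show "norm (F (w 0 t)) \<le> norm (F x0) * exp (M * \<bar>t\<bar>)" for t
      using M by (simp add: w_def mult_le_cancel_left1)
  qed
  define S where "S = (\<lambda>y t. exp (- (M * \<bar>t\<bar>)) *\<^sub>R I y t)"
  have Sdiff: "norm (S y t - S z t) \<le> L / M * dist y z" for y z t
  proof -
    have "norm (S y t - S z t) = exp (- (M * \<bar>t\<bar>)) * norm (I y t - I z t)"
      by (simp add: S_def flip: scaleR_diff_right)
    also have "\<dots> \<le> exp (- (M * \<bar>t\<bar>)) * (L * dist y z / M * exp (M * \<bar>t\<bar>))"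
      by (intro mult_left_mono Idiff) auto
    also have "\<dots> = L / M * dist y z" by (simp add: exp_minus field_simps)
    finally show ?thesis .
  qed
  have S0: "norm (S 0 t) \<le> norm (F x0) / M" for t
  proof -
    have "norm (S 0 t) = exp (- (M * \<bar>t\<bar>)) * norm (I 0 t)" by (simp add: S_def)
    also have "\<dots> \<le> exp (- (M * \<bar>t\<bar>)) * (norm (F x0) / M * exp (M * \<bar>t\<bar>))"
      by (intro mult_left_mono I0) auto
    also have "\<dots> = norm (F x0) / M" by (simp add: exp_minus field_simps)
    finally show ?thesis .
  qed
  have "S y \<in> bcontfun" for y
  proof (rule bcontfun_normI)
    have "continuous_on UNIV (I y)"
      by (rule differentiable_imp_continuous_on)
        (meson I(2) differentiable_at_imp_differentiable_on differentiableI_vector)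
    then show "continuous_on UNIV (S y)" unfolding S_def by (intro continuous_intros)
    show "norm (S y t) \<le> L / M * dist y 0 + norm (F x0) / M" for t
      using Sdiff[of y t 0] S0[of t] norm_triangle_sub[of "S y t" "S 0 t"] by linarith
  qed
  then have B: "apply_bcontfun (Bcontfun (S y)) = S y" for y
    by (simp add: Bcontfun_inverse)
  have "\<exists>!y\<in>UNIV. Bcontfun (S y) = y"
  proof (rule Banach_fix[where c = "L / M"])
    show "dist (Bcontfun (S y)) (Bcontfun (S z)) \<le> L / M * dist y z" for y z
      by (rule dist_bound) (use Sdiff[of y _ z] in \<open>simp add: B dist_norm\<close>)
    show "L / M < 1" using M L0 by (simp add: M_def)
  qed (use M L0 in \<open>auto simp: complete_UNIV\<close>)
  then obtain y where y: "Bcontfun (S y) = y" by blast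
  have "y t = exp (- (M * \<bar>t\<bar>)) *\<^sub>R I y t" for t
    using B[of y] y by (simp add: S_def)
  then have wy: "w y t = x0 + I y t" for t
    by (simp add: w_def exp_minus)
  have "w y = (\<lambda>t. x0 + I y t)" using wy by auto
  then have "(w y has_vector_derivative F (w y t)) (at t)" for t
    using I(2)[of y t] by (auto intro!: derivative_eq_intros)
  moreover have "w y 0 = x0" using wy I by simp
  ultimately show ?thesis by blast
qed

text \<open>Gronwall's inequality: exp(-2Lt) times the squared distance has nonpositive derivative,
  and negative times follow by reversing time. This supplies uniqueness, hence the group law of the
  flow, as well as continuity in the initial point.\<close>

lemma ode_solutions_dist_le:
  fixes F :: "'a::euclidean_space \<Rightarrow> 'a"
  assumes L: "\<And>x y. norm (F x - F y) \<le> L * norm (x - y)"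
    and x: "\<And>t. (x has_vector_derivative F (x t)) (at t)"
    and y: "\<And>t. (y has_vector_derivative F (y t)) (at t)"
  shows "norm (x t - y t) \<le> exp (L * \<bar>t\<bar>) * norm (x 0 - y 0)"
proof -
  have pos: "norm (x t - y t) \<le> exp (L * t) * norm (x 0 - y 0)"
    if L: "\<And>x y. norm (F x - F y) \<le> L * norm (x - y)"
    and x: "\<And>t. (x has_vector_derivative F (x t)) (at t)"
    and y: "\<And>t. (y has_vector_derivative F (y t)) (at t)" and t: "t \<ge> 0"
    for F :: "'a \<Rightarrow> 'a" and x y t
  proof -
    define q where "q = (\<lambda>t. exp (- 2 * L * t) * ((x t - y t) \<bullet> (x t - y t)))"
    have "q t \<le> q 0"
    proof (rule DERIV_nonpos_imp_nonincreasing[OF t])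
      fix s :: real
      let ?d = "x s - y s" and ?e = "F (x s) - F (y s)"
      have "((\<lambda>t. x t - y t) has_vector_derivative ?e) (at s)"
        by (intro derivative_intros x y)
      then have d: "((\<lambda>t. (x t - y t) \<bullet> (x t - y t)) has_real_derivative 2 * (?d \<bullet> ?e)) (at s)"
        unfolding has_real_derivative_iff_has_vector_derivative
        by (auto intro!: bounded_bilinear.has_vector_derivative[OF bounded_bilinear_inner, THEN has_vector_derivative_eq_rhs]
            simp: inner_commute)
      have "(q has_real_derivative exp (- 2 * L * s) * (2 * (?d \<bullet> ?e) - 2 * L * (?d \<bullet> ?d))) (at s)"
        unfolding q_def
        by (rule DERIV_cong[OF DERIV_mult[OF DERIV_fun_exp[OF DERIV_cmult_Id] d]])
          (simp add: right_diff_distrib)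
      moreover have "?d \<bullet> ?e \<le> norm ?d * (L * norm ?d)"
        by (rule order_trans[OF norm_cauchy_schwarz]) (intro mult_left_mono L norm_ge_zero)
      then have "?d \<bullet> ?e \<le> L * (?d \<bullet> ?d)"
        by (simp add: power2_norm_eq_inner[symmetric] power2_eq_square mult_ac)
      ultimately show "\<exists>z. (q has_real_derivative z) (at s) \<and> z \<le> 0"
        by (intro exI conjI) (auto simp: mult_le_0_iff)
    qed
    then have "(norm (x t - y t))\<^sup>2 \<le> (exp (L * t) * norm (x 0 - y 0))\<^sup>2"
    proof -
      assume "q t \<le> q 0"
      then have "exp (- 2 * L * t) * (norm (x t - y t))\<^sup>2 \<le> (norm (x 0 - y 0))\<^sup>2"
        by (simp add: q_def power2_norm_eq_inner)
      then have "exp (2 * L * t) * (exp (- 2 * L * t) * (norm (x t - y t))\<^sup>2)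
          \<le> exp (2 * L * t) * (norm (x 0 - y 0))\<^sup>2"
        by (intro mult_left_mono) auto
      moreover have "exp (2 * L * t) * (exp (- 2 * L * t) * z) = z" for z :: real
        by (simp add: mult.assoc[symmetric] exp_add[symmetric])
      moreover have "exp (2 * L * t) = (exp (L * t))\<^sup>2"
        using exp_double[of "L * t"] by (simp add: mult.assoc)
      ultimately show ?thesis by (simp only: power_mult_distrib)
    qed
    then show ?thesis by (rule power2_le_imp_le) simp
  qed
  show ?thesis
  proof (cases "t \<ge> 0")
    case True then show ?thesis using pos[OF L x y] by simp
  next
    case False
    have rev: "((\<lambda>t. x (- t)) has_vector_derivative - F (x (- t))) (at t)"
      if "\<And>t. (x has_vector_derivative F (x t)) (at t)" for x t
    proof -
      have "(uminus has_vector_derivative - 1) (at t)" by (auto intro!: derivative_eq_intros)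
      from vector_diff_chain_at[OF this that] show ?thesis by (simp add: o_def)
    qed
    have "norm (x (- (- t)) - y (- (- t))) \<le> exp (L * - t) * norm (x (- 0) - y (- 0))"
    proof (rule pos[where F = "\<lambda>x. - F x"])
      show "norm (- F x - - F y) \<le> L * norm (x - y)" for x y
        using L[of y x] by (simp add: norm_minus_commute)
    qed (use rev[OF x] rev[OF y] False in auto)
    then show ?thesis using False by simp
  qed
qed

section \<open>Loops of class \<open>H\<^sup>1\<close> and the derivative of the energy\<close>

lemma integrable_inner_of_square_integrable:
  fixes f g :: "real \<Rightarrow> 'a::euclidean_space"
  assumes "f integrable_on {0..1}" "g integrable_on {0..1}"
    and "(\<lambda>t. (norm (f t))\<^sup>2) integrable_on {0..1}" "(\<lambda>t. (norm (g t))\<^sup>2) integrable_on {0..1}"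
  shows "(\<lambda>t. f t \<bullet> g t) integrable_on {0..1}"
proof (rule measurable_bounded_by_integrable_imp_integrable)
  show "(\<lambda>t. f t \<bullet> g t) \<in> borel_measurable (lebesgue_on {0..1})"
    using assms(1,2) by (intro borel_measurable_inner integrable_imp_measurable)
  show "(\<lambda>t. (norm (f t))\<^sup>2 + (norm (g t))\<^sup>2) integrable_on {0..1}"
    using assms(3,4) by (rule integrable_add)
  show "norm (f t \<bullet> g t) \<le> (norm (f t))\<^sup>2 + (norm (g t))\<^sup>2" for t
  proof -
    have "norm (f t \<bullet> g t) \<le> norm (f t) * norm (g t)" by (simp add: Cauchy_Schwarz_ineq2)
    also have "\<dots> \<le> 2 * norm (f t) * norm (g t)" by simp
    also have "\<dots> \<le> (norm (f t))\<^sup>2 + (norm (g t))\<^sup>2" by (rule sum_squares_bound)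
    finally show ?thesis .
  qed
qed auto

lemma vector_derivative_lincomb:
  fixes f g :: "real \<Rightarrow> 'a::euclidean_space"
  assumes "f differentiable (at t)" "g differentiable (at t)"
  shows "(\<lambda>t. a *\<^sub>R f t + b *\<^sub>R g t) differentiable (at t)"
    and "vector_derivative (\<lambda>t. a *\<^sub>R f t + b *\<^sub>R g t) (at t)
       = a *\<^sub>R vector_derivative f (at t) + b *\<^sub>R vector_derivative g (at t)"
proof -
  have "((\<lambda>t. a *\<^sub>R f t + b *\<^sub>R g t) has_vector_derivative
      a *\<^sub>R vector_derivative f (at t) + b *\<^sub>R vector_derivative g (at t)) (at t)"
    using assms by (auto intro!: derivative_eq_intros simp: vector_derivative_works)
  then show "(\<lambda>t. a *\<^sub>R f t + b *\<^sub>R g t) differentiable (at t)"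
    and "vector_derivative (\<lambda>t. a *\<^sub>R f t + b *\<^sub>R g t) (at t)
       = a *\<^sub>R vector_derivative f (at t) + b *\<^sub>R vector_derivative g (at t)"
    by (auto intro: differentiableI_vector vector_derivative_at)
qed

lemma H1_derivative_integrable:
  assumes "f \<in> H1"
  shows "(\<lambda>t. vector_derivative f (at t)) integrable_on {0..1}"
    "(\<lambda>t. norm (vector_derivative f (at t))) integrable_on {0..1}"
    "(\<lambda>t. (norm (vector_derivative f (at t)))\<^sup>2) integrable_on {0..1}"
  using assms unfolding H1_def absolutely_integrable_on_def by blast+

lemma H1_integral_derivative:
  assumes "f \<in> H1" "t \<in> {0..1}"
  shows "integral {0..t} (\<lambda>x. vector_derivative f (at x)) = f t - f 0"
proof -
  have "f t = f 0 + integral {0..t} (\<lambda>x. vector_derivative f (at x))"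
    using assms unfolding H1_def by blast
  then show ?thesis by (simp only: add_diff_cancel_left')
qed

lemma H1_inner_integrable:
  assumes "f \<in> H1" "g \<in> H1"
  shows "(\<lambda>t. vector_derivative f (at t) \<bullet> vector_derivative g (at t)) integrable_on {0..1}"
  using assms by (intro integrable_inner_of_square_integrable H1_derivative_integrable)

lemma H1_continuous_on:
  assumes "f \<in> H1"
  shows "continuous_on {0..1} f"
proof -
  have "continuous_on {0..1} (\<lambda>t. f 0 + integral {0..t} (\<lambda>x. vector_derivative f (at x)))"
    by (intro continuous_intros indefinite_integral_continuous_1 H1_derivative_integrable assms)
  then show ?thesis
    by (rule continuous_on_eq) (simp add: H1_integral_derivative assms)
qed

text \<open>\<open>H1\<close> refers to the pointwise derivative, so the two null sets of
  nondifferentiability are discarded together; the cross term of the squared derivative is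
  integrable by \<open>H1_inner_integrable\<close>. Difference quotients of curves of loops are
  thereby again in \<open>H1\<close>.\<close>

lemma H1_lincomb:
  fixes f g :: "real \<Rightarrow> 'a::euclidean_space"
  assumes f: "f \<in> H1" and g: "g \<in> H1"
  shows "(\<lambda>t. a *\<^sub>R f t + b *\<^sub>R g t) \<in> H1"
proof -
  let ?N = "{t. \<not> f differentiable (at t)} \<union> {t. \<not> g differentiable (at t)}"
  let ?k = "\<lambda>t. a *\<^sub>R f t + b *\<^sub>R g t"
  let ?d = "\<lambda>t. a *\<^sub>R vector_derivative f (at t) + b *\<^sub>R vector_derivative g (at t)"
  have N: "negligible ?N" using f g by (auto simp: H1_def)
  have eq: "vector_derivative ?k (at t) = ?d t" if "t \<in> S - ?N" for t S
    using that by (intro vector_derivative_lincomb) auto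
  note dom = vector_derivative_lincomb(1)
  have per: "\<forall>t. ?k (t + 1) = ?k t" using f g by (simp add: H1_def)
  have diff: "negligible {t. \<not> ?k differentiable (at t)}"
    by (rule negligible_subset[OF N]) (use dom in auto)
  have ai: "?d absolutely_integrable_on {0..1}"
    using f g unfolding H1_def
    by (intro set_integral_add absolutely_integrable_scaleR_left) auto
  have ai': "(\<lambda>t. vector_derivative ?k (at t)) absolutely_integrable_on {0..1}"
    by (rule absolutely_integrable_spike[OF ai N eq])
  have "(\<lambda>t. a\<^sup>2 *\<^sub>R (norm (vector_derivative f (at t)))\<^sup>2
      + (2 * a * b) *\<^sub>R (vector_derivative f (at t) \<bullet> vector_derivative g (at t))
      + b\<^sup>2 *\<^sub>R (norm (vector_derivative g (at t)))\<^sup>2) integrable_on {0..1}"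
    by (intro integrable_add integrable_cmul H1_derivative_integrable H1_inner_integrable f g)
  also have "(\<lambda>t. a\<^sup>2 *\<^sub>R (norm (vector_derivative f (at t)))\<^sup>2
      + (2 * a * b) *\<^sub>R (vector_derivative f (at t) \<bullet> vector_derivative g (at t))
      + b\<^sup>2 *\<^sub>R (norm (vector_derivative g (at t)))\<^sup>2) = (\<lambda>t. (norm (?d t))\<^sup>2)"
    unfolding power2_norm_eq_inner inner_add_left inner_add_right inner_scaleR_left inner_scaleR_right
    by (simp add: inner_commute power2_eq_square algebra_simps)
  finally have sq: "(\<lambda>t. (norm (vector_derivative ?k (at t)))\<^sup>2) integrable_on {0..1}"
    by (rule integrable_spike[OF _ N]) (use eq in auto)
  have "?k t = ?k 0 + integral {0..t} (\<lambda>x. vector_derivative ?k (at x))" if t: "t \<in> {0..1}" for t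
  proof -
    have i: "(\<lambda>x. vector_derivative f (at x)) integrable_on {0..t}"
      "(\<lambda>x. vector_derivative g (at x)) integrable_on {0..t}"
      using t by (auto intro: integrable_on_subinterval[OF H1_derivative_integrable(1)] f g)
    have "integral {0..t} (\<lambda>x. vector_derivative ?k (at x)) = integral {0..t} ?d"
      by (rule integral_spike[OF N]) (use eq in auto)
    also have "\<dots> = a *\<^sub>R integral {0..t} (\<lambda>x. vector_derivative f (at x))
        + b *\<^sub>R integral {0..t} (\<lambda>x. vector_derivative g (at x))"
      using i by (simp add: integral_add integrable_cmul)
    also have "integral {0..t} (\<lambda>x. vector_derivative f (at x)) = f t - f 0"
      using f t by (rule H1_integral_derivative)
    also have "integral {0..t} (\<lambda>x. vector_derivative g (at x)) = g t - g 0"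
      using g t by (rule H1_integral_derivative)
    finally show ?thesis by (simp add: algebra_simps)
  qed
  with per diff ai' sq show ?thesis unfolding H1_def by blast
qed

lemma H1_C1:
  fixes f :: "real \<Rightarrow> 'a::euclidean_space"
  assumes per: "\<And>t. f (t + 1) = f t" and d: "\<And>t. (f has_vector_derivative f' t) (at t)"
    and c: "continuous_on UNIV f'"
  shows "f \<in> H1"
proof -
  have eq: "vector_derivative f (at t) = f' t" for t using d by (rule vector_derivative_at)
  have c': "continuous_on {0..1} f'" using c continuous_on_subset by blast
  have "f t = f 0 + integral {0..t} f'" if "t \<in> {0..1}" for t
  proof -
    have "(f' has_integral f t - f 0) {0..t}"
      by (rule fundamental_theorem_of_calculus)
        (use that d in \<open>auto intro: has_vector_derivative_at_within\<close>)
    then show ?thesis by (simp add: integral_unique)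
  qed
  moreover have "f' absolutely_integrable_on {0..1}"
    using absolutely_integrable_continuous[of 0 1 f'] c' by simp
  moreover have "(\<lambda>t. (norm (f' t))\<^sup>2) integrable_on {0..1}"
    by (intro integrable_continuous_interval continuous_intros c')
  moreover have "{t. \<not> f differentiable (at t)} = {}" using d differentiableI_vector by blast
  then have "negligible {t. \<not> f differentiable (at t)}" by simp
  ultimately show ?thesis using per unfolding H1_def mem_Collect_eq eq by blast
qed

text \<open>Over \<open>[a,b]\<close> the defect \<open>\<psi> b - \<psi> a\<close> of the product rule is at most a multiple of
  \<open>(b - a) \<integral>\<^sub>a\<^sup>b \<bar>\<eta>'\<bar>\<close>, so \<open>\<psi>\<close> has derivative \<open>0\<close> everywhere although \<open>\<eta>\<close> is only absolutely
  continuous.\<close>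

lemma H1_integral_by_parts:
  fixes \<eta> G G' :: "real \<Rightarrow> 'a::euclidean_space"
  assumes eta: "\<eta> \<in> H1" and G: "\<And>t. (G has_vector_derivative G' t) (at t)"
    and contG': "continuous_on UNIV G'" and per: "G 1 = G 0"
  shows "(\<lambda>t. G t \<bullet> vector_derivative \<eta> (at t)) integrable_on {0..1}"
    and "integral {0..1} (\<lambda>t. G t \<bullet> vector_derivative \<eta> (at t)) = - integral {0..1} (\<lambda>t. G' t \<bullet> \<eta> t)"
proof -
  let ?g = "\<lambda>t. vector_derivative \<eta> (at t)"
  note g = H1_derivative_integrable[OF eta]
  have contG: "continuous_on UNIV G"
    by (rule differentiable_imp_continuous_on)
      (meson G differentiable_at_imp_differentiable_on differentiableI_vector)
  have cG: "continuous_on S G" "continuous_on S G'" for S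
    using contG contG' continuous_on_subset by blast+
  have ce: "continuous_on {0..1} \<eta>" by (rule H1_continuous_on[OF eta])
  have sub: "h integrable_on {a..b}" if "h integrable_on {0..1}" "0 \<le> a" "b \<le> 1"
    for h :: "real \<Rightarrow> 'c::euclidean_space" and a b
    using that by (auto intro: integrable_on_subinterval)
  show iG: "(\<lambda>t. G t \<bullet> ?g t) integrable_on {0..1}"
    using g
    by (intro integrable_inner_of_square_integrable) (auto intro!: integrable_continuous_interval continuous_intros cG)
  have iG': "(\<lambda>t. G' t \<bullet> \<eta> t) integrable_on {0..1}"
    by (intro integrable_continuous_interval continuous_intros cG ce)
  have "bounded (G' ` {0..1})"
    by (intro compact_imp_bounded compact_continuous_image cG) auto
  then obtain C where C: "\<And>t. t \<in> {0..1} \<Longrightarrow> norm (G' t) \<le> C" "C > 0"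
    unfolding bounded_pos by (metis imageI)
  have eta_diff: "integral {a..b} ?g = \<eta> b - \<eta> a" if "0 \<le> a" "a \<le> b" "b \<le> 1" for a b
  proof -
    have "integral {0..a} ?g + integral {a..b} ?g = integral {0..b} ?g"
      by (rule Henstock_Kurzweil_Integration.integral_combine) (use sub[OF g(1)] that in auto)
    moreover have "integral {0..a} ?g = \<eta> a - \<eta> 0" "integral {0..b} ?g = \<eta> b - \<eta> 0"
      using that by (auto intro!: H1_integral_derivative eta)
    ultimately have "(\<eta> a - \<eta> 0) + integral {a..b} ?g = \<eta> b - \<eta> 0" by (simp only:)
    then show ?thesis by (simp add: algebra_simps)
  qed
  have G_diff: "(G' has_integral G b - G a) {a..b}" if "a \<le> b" for a b
    by (rule fundamental_theorem_of_calculus) (use that G in \<open>auto intro: has_vector_derivative_at_within\<close>)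
  define \<psi> where "\<psi> = (\<lambda>t. integral {0..t} (\<lambda>t. G t \<bullet> ?g t) + integral {0..t} (\<lambda>t. G' t \<bullet> \<eta> t) - G t \<bullet> \<eta> t)"
  define K where "K = (\<lambda>t. integral {0..t} (\<lambda>t. norm (?g t)))"
  have est: "\<bar>\<psi> b - \<psi> a\<bar> \<le> 2 * C * (b - a) * (K b - K a)" if ab: "0 \<le> a" "a \<le> b" "b \<le> 1" for a b
  proof -
    define k where "k = integral {a..b} (\<lambda>t. norm (?g t))"
    have k: "K b - K a = k"
      using Henstock_Kurzweil_Integration.integral_combine[of 0 a b "\<lambda>t. norm (?g t)"] sub[OF g(2)] ab
      by (simp add: K_def k_def)
    have gab: "?g integrable_on {a..b}" "(\<lambda>t. norm (?g t)) integrable_on {a..b}"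
      using sub g ab by blast+
    have e1: "\<psi> b - \<psi> a = integral {a..b} (\<lambda>t. G t \<bullet> ?g t) + integral {a..b} (\<lambda>t. G' t \<bullet> \<eta> t)
        - G b \<bullet> \<eta> b + G a \<bullet> \<eta> a"
      using Henstock_Kurzweil_Integration.integral_combine[of 0 a b "\<lambda>t. G t \<bullet> ?g t"] sub[OF iG]
        Henstock_Kurzweil_Integration.integral_combine[of 0 a b "\<lambda>t. G' t \<bullet> \<eta> t"] sub[OF iG'] ab
      by (simp add: \<psi>_def)
    \<comment> \<open>Freezing \<open>G\<close> at \<open>a\<close> and \<eta> at \<open>b\<close>
      leaves integrals with exact values, whose sum is the increment of
      \<open>G t \<bullet> \<eta> t\<close>. The defect is thus the sum of the two remainders in
      \<open>d1\<close> and \<open>d2\<close>, each of size at most C (b - a) k.\<close>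
    have i1: "((\<lambda>t. G a \<bullet> ?g t) has_integral G a \<bullet> (\<eta> b - \<eta> a)) {a..b}"
      using has_integral_linear[OF integrable_integral[OF gab(1)] bounded_linear_inner_right[of "G a"]]
      by (simp add: eta_diff ab o_def)
    have i2: "((\<lambda>t. G' t \<bullet> \<eta> b) has_integral (G b - G a) \<bullet> \<eta> b) {a..b}"
      using has_integral_linear[OF G_diff bounded_linear_inner_left[of "\<eta> b"]] ab by (simp add: o_def)
    have j1: "((\<lambda>t. G t \<bullet> ?g t) has_integral integral {a..b} (\<lambda>t. G t \<bullet> ?g t)) {a..b}"
      using sub[OF iG] ab by (intro integrable_integral) auto
    have j2: "((\<lambda>t. G' t \<bullet> \<eta> t) has_integral integral {a..b} (\<lambda>t. G' t \<bullet> \<eta> t)) {a..b}"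
      using sub[OF iG'] ab by (intro integrable_integral) auto
    have d1: "((\<lambda>t. (G t - G a) \<bullet> ?g t) has_integral
        integral {a..b} (\<lambda>t. G t \<bullet> ?g t) - G a \<bullet> (\<eta> b - \<eta> a)) {a..b}"
      using has_integral_diff[OF j1 i1] by (simp add: inner_diff_left)
    have d2: "((\<lambda>t. G' t \<bullet> (\<eta> t - \<eta> b)) has_integral
        integral {a..b} (\<lambda>t. G' t \<bullet> \<eta> t) - (G b - G a) \<bullet> \<eta> b) {a..b}"
      using has_integral_diff[OF j2 i2] by (simp add: inner_diff_right)
    have b1: "norm (integral {a..b} (\<lambda>t. (G t - G a) \<bullet> ?g t)) \<le> integral {a..b} (\<lambda>t. C * (b - a) * norm (?g t))"
    proof (rule integral_norm_bound_integral)
      show "norm ((G t - G a) \<bullet> ?g t) \<le> C * (b - a) * norm (?g t)" if t: "t \<in> {a..b}" for t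
      proof -
        have "norm (G t - G a) \<le> C * norm (t - a)"
          by (rule differentiable_bound[of "{0..1}" G "\<lambda>t h. h *\<^sub>R G' t"])
            (use G C t ab in \<open>auto simp: has_vector_derivative_def[symmetric] onorm_scaleR_left
              bounded_linear_ident onorm_id intro: has_vector_derivative_at_within\<close>)
        also have "\<dots> \<le> C * (b - a)" using t C by auto
        finally have "norm (G t - G a) * norm (?g t) \<le> C * (b - a) * norm (?g t)"
          by (intro mult_right_mono) auto
        then show ?thesis using Cauchy_Schwarz_ineq2[of "G t - G a" "?g t"] by simp
      qed
      show "(\<lambda>t. C * (b - a) * norm (?g t)) integrable_on {a..b}"
        using integrable_cmul[OF gab(2), of "C * (b - a)"] by simp
    qed (use d1 in blast)
    have b2: "norm (integral {a..b} (\<lambda>t. G' t \<bullet> (\<eta> t - \<eta> b))) \<le> integral {a..b} (\<lambda>t. C * k)"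
    proof (rule integral_norm_bound_integral)
      show "norm (G' t \<bullet> (\<eta> t - \<eta> b)) \<le> C * k" if t: "t \<in> {a..b}" for t
      proof -
        have it: "?g integrable_on {t..b}" "(\<lambda>t. norm (?g t)) integrable_on {t..b}"
          using sub[OF g(1), of t b] sub[OF g(2), of t b] t ab by auto
        have "norm (integral {t..b} ?g) \<le> integral {t..b} (\<lambda>t. norm (?g t))"
          by (intro integral_norm_bound_integral it) auto
        then have "norm (\<eta> b - \<eta> t) \<le> integral {t..b} (\<lambda>t. norm (?g t))"
          using eta_diff[of t b] t ab by simp
        also have "\<dots> \<le> k" unfolding k_def
          by (rule integral_subset_le) (use t ab sub[OF g(2)] in auto)
        finally have "norm (G' t) * norm (\<eta> t - \<eta> b) \<le> C * k"
          using C t ab by (intro mult_mono) (auto simp: norm_minus_commute)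
        then show ?thesis using Cauchy_Schwarz_ineq2[of "G' t" "\<eta> t - \<eta> b"] by simp
      qed
    qed (use d2 in auto)
    have "\<psi> b - \<psi> a = integral {a..b} (\<lambda>t. (G t - G a) \<bullet> ?g t) + integral {a..b} (\<lambda>t. G' t \<bullet> (\<eta> t - \<eta> b))"
      unfolding e1 integral_unique[OF d1] integral_unique[OF d2]
      by (simp add: inner_diff_left inner_diff_right)
    moreover have "integral {a..b} (\<lambda>t. C * (b - a) * norm (?g t)) = C * (b - a) * k"
      by (simp add: k_def)
    moreover have "integral {a..b} (\<lambda>t. C * k) = C * (b - a) * k" using ab by simp
    ultimately have "\<bar>\<psi> b - \<psi> a\<bar> \<le> C * (b - a) * k + C * (b - a) * k"
      using b1 b2 unfolding real_norm_def by linarith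
    then show ?thesis unfolding k by (simp add: mult_ac)
  qed
  have contK: "continuous_on {0..1} K"
    unfolding K_def by (intro indefinite_integral_continuous_1 g)
  have "(\<psi> has_derivative (\<lambda>h. 0)) (at x within {0..1})" if x: "x \<in> {0..1}" for x
    unfolding has_derivative_within
  proof (intro conjI)
    have "((\<lambda>y. 2 * C * \<bar>K y - K x\<bar>) \<longlongrightarrow> 2 * C * \<bar>K x - K x\<bar>) (at x within {0..1})"
      using contK x by (intro tendsto_intros) (auto simp: continuous_on_def)
    then have lim: "((\<lambda>y. 2 * C * \<bar>K y - K x\<bar>) \<longlongrightarrow> 0) (at x within {0..1})" by simp
    show "((\<lambda>y. (1 / norm (y - x)) *\<^sub>R (\<psi> y - (\<psi> x + 0))) \<longlongrightarrow> 0) (at x within {0..1})"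
    proof (rule Lim_null_comparison[OF _ lim])
      show "\<forall>\<^sub>F y in at x within {0..1}.
          norm ((1 / norm (y - x)) *\<^sub>R (\<psi> y - (\<psi> x + 0))) \<le> 2 * C * \<bar>K y - K x\<bar>"
        unfolding eventually_at_filter
      proof (intro always_eventually allI impI)
        fix y assume y: "y \<noteq> x" "y \<in> {0..1}"
        have "\<bar>\<psi> y - \<psi> x\<bar> \<le> 2 * C * \<bar>y - x\<bar> * \<bar>K y - K x\<bar>"
        proof (cases "x \<le> y")
          case True
          have "\<bar>\<psi> y - \<psi> x\<bar> \<le> 2 * C * (y - x) * (K y - K x)" using est x y True by auto
          also have "\<dots> \<le> 2 * C * (y - x) * \<bar>K y - K x\<bar>" using C True by (intro mult_left_mono) auto
          finally show ?thesis using True by simp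
        next
          case False
          have "\<bar>\<psi> x - \<psi> y\<bar> \<le> 2 * C * (x - y) * (K x - K y)" using est x y False by auto
          also have "\<dots> \<le> 2 * C * (x - y) * \<bar>K y - K x\<bar>" using C False by (intro mult_left_mono) auto
          finally show ?thesis using False by (simp add: abs_minus_commute)
        qed
        then show "norm ((1 / norm (y - x)) *\<^sub>R (\<psi> y - (\<psi> x + 0))) \<le> 2 * C * \<bar>K y - K x\<bar>"
          using y by (simp add: field_simps)
      qed
    qed
  qed simp
  then obtain c where "\<And>t. t \<in> {0..1} \<Longrightarrow> \<psi> t = c"
    using has_derivative_zero_constant[of "{0..1::real}" \<psi>] by auto
  from this[of 0] this[of 1] have "\<psi> 1 = \<psi> 0" by simp
  moreover have "\<eta> 1 = \<eta> 0" using eta unfolding H1_def by (metis (mono_tags, lifting) add_0 mem_Collect_eq)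
  ultimately show "integral {0..1} (\<lambda>t. G t \<bullet> ?g t) = - integral {0..1} (\<lambda>t. G' t \<bullet> \<eta> t)"
    by (simp add: \<psi>_def per)
qed

section \<open>First variation of the energy in the ambient Hilbert space\<close>

lemma H1_norm_bound:
  fixes f :: "real \<Rightarrow> 'a::euclidean_space"
  assumes "f \<in> H1"
  shows "integral {0..1} (\<lambda>t. (norm (vector_derivative f (at t)))\<^sup>2) \<le> (H1_norm f)\<^sup>2"
    and "H1_norm f \<ge> 0"
proof -
  have i: "(\<lambda>t. (norm (f t))\<^sup>2) integrable_on {0..1}"
    by (intro integrable_continuous_interval continuous_intros H1_continuous_on assms)
  have j: "(\<lambda>t. (norm (f t))\<^sup>2 + (norm (vector_derivative f (at t)))\<^sup>2) integrable_on {0..1}"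
    by (intro integrable_add i H1_derivative_integrable assms)
  have n: "0 \<le> integral {0..1} (\<lambda>t. (norm (f t))\<^sup>2 + (norm (vector_derivative f (at t)))\<^sup>2)"
    by (intro integral_nonneg j) auto
  then show "H1_norm f \<ge> 0" by (simp add: H1_norm_def)
  have "integral {0..1} (\<lambda>t. (norm (vector_derivative f (at t)))\<^sup>2) \<le>
      integral {0..1} (\<lambda>t. (norm (f t))\<^sup>2 + (norm (vector_derivative f (at t)))\<^sup>2)"
    by (intro integral_le H1_derivative_integrable j assms) auto
  then show "integral {0..1} (\<lambda>t. (norm (vector_derivative f (at t)))\<^sup>2) \<le> (H1_norm f)\<^sup>2"
    using n by (simp add: H1_norm_def)
qed

text \<open>Young's inequality with a free weight \<open>e\<close> avoids square roots of integrals;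
  \<open>e\<close> is tuned to the size of the error term where the bound is applied.\<close>

lemma H1_inner_le:
  fixes f g :: "real \<Rightarrow> 'a::euclidean_space"
  assumes f: "f \<in> H1" and g: "g \<in> H1" and e: "e > 0"
  shows "\<bar>integral {0..1} (\<lambda>t. vector_derivative f (at t) \<bullet> vector_derivative g (at t))\<bar>
    \<le> e * integral {0..1} (\<lambda>t. (norm (vector_derivative f (at t)))\<^sup>2)
      + integral {0..1} (\<lambda>t. (norm (vector_derivative g (at t)))\<^sup>2) / e"
proof -
  let ?F = "\<lambda>t. vector_derivative f (at t)" and ?G = "\<lambda>t. vector_derivative g (at t)"
  have i: "(\<lambda>t. e * (norm (?F t))\<^sup>2) integrable_on {0..1}" "(\<lambda>t. (norm (?G t))\<^sup>2 / e) integrable_on {0..1}"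
    using integrable_cmul[OF H1_derivative_integrable(3)[OF f], of e]
      integrable_cmul[OF H1_derivative_integrable(3)[OF g], of "inverse e"]
    by (simp_all add: divide_inverse mult.commute)
  have "norm (integral {0..1} (\<lambda>t. ?F t \<bullet> ?G t)) \<le> integral {0..1} (\<lambda>t. e * (norm (?F t))\<^sup>2 + (norm (?G t))\<^sup>2 / e)"
  proof (rule integral_norm_bound_integral)
    show "norm (?F t \<bullet> ?G t) \<le> e * (norm (?F t))\<^sup>2 + (norm (?G t))\<^sup>2 / e" for t
    proof -
      have "2 * (norm (?F t) * norm (?G t)) * e \<le> (e * norm (?F t))\<^sup>2 + (norm (?G t))\<^sup>2"
        using sum_squares_bound[of "e * norm (?F t)" "norm (?G t)"] by (simp add: mult_ac)
      then have "2 * (norm (?F t) * norm (?G t)) \<le> e * (norm (?F t))\<^sup>2 + (norm (?G t))\<^sup>2 / e"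
        using e by (simp add: field_simps power2_eq_square)
      moreover have "norm (?F t \<bullet> ?G t) \<le> norm (?F t) * norm (?G t)" by (simp add: Cauchy_Schwarz_ineq2)
      moreover have "0 \<le> norm (?F t) * norm (?G t)" by simp
      ultimately show ?thesis by linarith
    qed
  qed (intro H1_inner_integrable f g integrable_add i)+
  also have "\<dots> = e * integral {0..1} (\<lambda>t. (norm (?F t))\<^sup>2) + integral {0..1} (\<lambda>t. (norm (?G t))\<^sup>2) / e"
    using i by (simp add: integral_add)
  finally show ?thesis by simp
qed

lemma energy_altdef: "energy \<gamma> = integral {0..1} (\<lambda>t. (norm (vector_derivative \<gamma> (at t)))\<^sup>2) / 2"
  by (simp add: energy_def fs_metric_def power2_norm_eq_inner)

text \<open>The energy is half a squared Euclidean norm, which absorbs the factor 2 of the cross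
  term.\<close>

lemma energy_lincomb:
  fixes f g :: "real \<Rightarrow> complex^'d^'d"
  assumes f: "f \<in> H1" and g: "g \<in> H1"
  shows "energy (\<lambda>t. a *\<^sub>R f t + b *\<^sub>R g t) = a\<^sup>2 * energy f
    + a * b * integral {0..1} (\<lambda>t. vector_derivative f (at t) \<bullet> vector_derivative g (at t))
    + b\<^sup>2 * energy g"
proof -
  let ?F = "\<lambda>t. vector_derivative f (at t)" and ?G = "\<lambda>t. vector_derivative g (at t)"
  have i: "(\<lambda>t. (norm (?F t))\<^sup>2) integrable_on {0..1}" "(\<lambda>t. (norm (?G t))\<^sup>2) integrable_on {0..1}"
    "(\<lambda>t. ?F t \<bullet> ?G t) integrable_on {0..1}"
    using f g H1_derivative_integrable(3) H1_inner_integrable by auto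
  have "integral {0..1} (\<lambda>t. (norm (vector_derivative (\<lambda>t. a *\<^sub>R f t + b *\<^sub>R g t) (at t)))\<^sup>2)
     = integral {0..1} (\<lambda>t. a\<^sup>2 * (norm (?F t))\<^sup>2 + (2 * a * b) * (?F t \<bullet> ?G t) + b\<^sup>2 * (norm (?G t))\<^sup>2)"
  proof (rule integral_spike)
    show "negligible ({t. \<not> f differentiable (at t)} \<union> {t. \<not> g differentiable (at t)})"
      using f g by (auto simp: H1_def)
    show "a\<^sup>2 * (norm (?F t))\<^sup>2 + (2 * a * b) * (?F t \<bullet> ?G t) + b\<^sup>2 * (norm (?G t))\<^sup>2
        = (norm (vector_derivative (\<lambda>t. a *\<^sub>R f t + b *\<^sub>R g t) (at t)))\<^sup>2"
      if "t \<in> {0..1} - ({t. \<not> f differentiable (at t)} \<union> {t. \<not> g differentiable (at t)})" for t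
      using that vector_derivative_lincomb(2)[of f t g a b]
      unfolding power2_norm_eq_inner inner_add_left inner_add_right inner_scaleR_left inner_scaleR_right
      by (simp add: inner_add_left inner_add_right inner_commute power2_eq_square algebra_simps)
  qed
  also have "\<dots> = a\<^sup>2 * integral {0..1} (\<lambda>t. (norm (?F t))\<^sup>2) + (2 * a * b) * integral {0..1} (\<lambda>t. ?F t \<bullet> ?G t)
      + b\<^sup>2 * integral {0..1} (\<lambda>t. (norm (?G t))\<^sup>2)"
    by (intro integral_unique has_integral_add has_integral_mult_right integrable_integral i)
  finally show ?thesis by (simp add: energy_altdef field_simps)
qed

text \<open>The energy is a quadratic form on the ambient space, so its expansion at
  \<open>c h = c 0 + h (\<eta> + \<delta> h)\<close> is exact. After division by \<open>h\<close>,
  all terms apart from the pairing of \<open>c 0\<close> with \<eta> are controlled by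
  \<open>h\<close> and the H1 norm of \<open>\<delta> h\<close>, both of which tend to 0.\<close>

lemma energy_has_derivative:
  fixes c :: "real \<Rightarrow> real \<Rightarrow> complex^'d^'d"
  assumes c: "\<And>s. c s \<in> H1" and eta: "\<eta> \<in> H1" and der: "H1_has_derivative c \<eta> 0"
  shows "((\<lambda>s. energy (c s)) has_real_derivative
    integral {0..1} (\<lambda>t. vector_derivative (c 0) (at t) \<bullet> vector_derivative \<eta> (at t))) (at 0)"
proof -
  define \<delta> where "\<delta> = (\<lambda>h t. (c h t - c 0 t) /\<^sub>R h - \<eta> t)"
  define N where "N = (\<lambda>h. H1_norm (\<delta> h))"
  have N: "(N \<longlongrightarrow> 0) (at 0)"
    using der by (simp add: H1_has_derivative_def N_def \<delta>_def)
  have dH: "\<delta> h \<in> H1" for h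
  proof -
    have "(\<lambda>t. 1 *\<^sub>R (inverse h *\<^sub>R c h t + (- inverse h) *\<^sub>R c 0 t) + (-1) *\<^sub>R \<eta> t) \<in> H1"
      by (intro H1_lincomb c eta)
    then show ?thesis by (simp add: \<delta>_def scaleR_diff_right)
  qed
  have N0: "N h \<ge> 0" for h using H1_norm_bound(2)[OF dH] by (simp add: N_def)
  have Ed: "energy (\<delta> h) \<le> (N h)\<^sup>2" for h
    using H1_norm_bound(1)[OF dH, of h] zero_le_power2[of "N h"] unfolding energy_altdef N_def by linarith
  have Edp: "energy f \<ge> 0" if "f \<in> H1" for f :: "real \<Rightarrow> complex^'d^'d"
    unfolding energy_altdef using H1_derivative_integrable(3)[OF that] by (simp add: integral_nonneg)
  define IP where "IP = (\<lambda>f g :: real \<Rightarrow> complex^'d^'d.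
      integral {0..1} (\<lambda>t. vector_derivative f (at t) \<bullet> vector_derivative g (at t)))"
  have IP: "\<bar>IP f g\<bar> \<le> e * (2 * energy f) + 2 * energy g / e" if "f \<in> H1" "g \<in> H1" "e > 0" for f g e
    using H1_inner_le[OF that] by (simp add: IP_def energy_altdef)
  have IPadd: "IP f (\<lambda>t. 1 *\<^sub>R g t + 1 *\<^sub>R k t) = IP f g + IP f k" if "f \<in> H1" "g \<in> H1" "k \<in> H1" for f g k
  proof -
    have "IP f (\<lambda>t. 1 *\<^sub>R g t + 1 *\<^sub>R k t) = integral {0..1} (\<lambda>t.
       vector_derivative f (at t) \<bullet> vector_derivative g (at t) + vector_derivative f (at t) \<bullet> vector_derivative k (at t))"
      unfolding IP_def
    proof (rule integral_spike)
      show "negligible ({t. \<not> g differentiable (at t)} \<union> {t. \<not> k differentiable (at t)})"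
        using that by (auto simp: H1_def)
    qed (subst vector_derivative_lincomb, auto simp: inner_add_right)
    then show ?thesis using that by (simp add: IP_def integral_add H1_inner_integrable)
  qed
  define C where "C = 2 * energy (c 0)"
  have bound: "\<bar>(energy (c h) - energy (c 0)) / h - IP (c 0) \<eta>\<bar>
      \<le> (N h + \<bar>h\<bar>) * C + 2 * N h + \<bar>h\<bar> * (3 * energy \<eta> + 3 * (N h)\<^sup>2)" if h: "h \<noteq> 0" for h
  proof -
    define \<beta> where "\<beta> = (\<lambda>t. 1 *\<^sub>R \<eta> t + 1 *\<^sub>R \<delta> h t)"
    have bH: "\<beta> \<in> H1" unfolding \<beta>_def by (intro H1_lincomb eta dH)
    have "c h = (\<lambda>t. 1 *\<^sub>R c 0 t + h *\<^sub>R \<beta> t)"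
      using h by (auto simp: \<beta>_def \<delta>_def)
    then have "energy (c h) = energy (c 0) + h * IP (c 0) \<beta> + h\<^sup>2 * energy \<beta>"
      using energy_lincomb[OF c bH, of 1 0 h] by (simp add: IP_def)
    then have "(energy (c h) - energy (c 0)) / h = IP (c 0) \<beta> + h * energy \<beta>"
      using h by (simp add: field_simps power2_eq_square)
    also have "IP (c 0) \<beta> = IP (c 0) \<eta> + IP (c 0) (\<delta> h)"
      unfolding \<beta>_def by (intro IPadd c eta dH)
    finally have 1: "(energy (c h) - energy (c 0)) / h - IP (c 0) \<eta> = IP (c 0) (\<delta> h) + h * energy \<beta>" by simp
    \<comment> \<open>Young's inequality with \<open>e = N h + |h|\<close>: the first summand
      balances the two terms, the second keeps \<open>e\<close> positive when \<open>N h\<close>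
      vanishes.\<close>
    have "\<bar>IP (c 0) (\<delta> h)\<bar> \<le> (N h + \<bar>h\<bar>) * C + 2 * energy (\<delta> h) / (N h + \<bar>h\<bar>)"
      unfolding C_def using h N0[of h] by (intro IP c dH) (simp add: add_nonneg_pos)
    also have "2 * energy (\<delta> h) / (N h + \<bar>h\<bar>) \<le> 2 * N h"
    proof -
      have "energy (\<delta> h) \<le> N h * (N h + \<bar>h\<bar>)"
        using Ed[of h] mult_nonneg_nonneg[OF abs_ge_zero N0, of h h]
        by (simp add: algebra_simps power2_eq_square)
      then show ?thesis using h N0[of h] by (simp add: divide_le_eq add_nonneg_pos)
    qed
    finally have 2: "\<bar>IP (c 0) (\<delta> h)\<bar> \<le> (N h + \<bar>h\<bar>) * C + 2 * N h" by simp
    have "energy \<beta> = energy \<eta> + IP \<eta> (\<delta> h) + energy (\<delta> h)"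
      unfolding \<beta>_def using energy_lincomb[OF eta dH, of 1 1 h] by (simp add: IP_def)
    also have "\<dots> \<le> 3 * energy \<eta> + 3 * (N h)\<^sup>2"
      using IP[OF eta dH, of 1 h] Ed[of h] by simp
    finally have "\<bar>h * energy \<beta>\<bar> \<le> \<bar>h\<bar> * (3 * energy \<eta> + 3 * (N h)\<^sup>2)"
      using Edp[OF bH] by (simp add: abs_mult mult_left_mono)
    with 1 2 show ?thesis by linarith
  qed
  have lim: "((\<lambda>h. (N h + \<bar>h\<bar>) * C + 2 * N h + \<bar>h\<bar> * (3 * energy \<eta> + 3 * (N h)\<^sup>2)) \<longlongrightarrow> 0) (at 0)"
    by (rule tendsto_eq_intros N refl | simp)+
  have "((\<lambda>h. (energy (c h) - energy (c 0)) / h - IP (c 0) \<eta>) \<longlongrightarrow> 0) (at 0)"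
    by (rule Lim_null_comparison[OF _ lim])
      (use bound in \<open>auto simp: eventually_at_filter intro!: always_eventually\<close>)
  then have "((\<lambda>h. (energy (c h) - energy (c 0)) / h) \<longlongrightarrow> IP (c 0) \<eta>) (at 0)"
    by (simp add: Lim_null[symmetric])
  then show ?thesis unfolding IP_def DERIV_def by simp
qed

section \<open>The gradient flow on the unit sphere\<close>

text \<open>
  For a real symmetric operator \<open>D\<close> the loop \<open>t \<mapsto> exp(itD) z\<close>, \<open>norm z = 1\<close>, has initial velocity
  \<open>i k\<close> with \<open>k = shift D z z\<close>, and \<open>i hess D z\<close> is the covariant derivative of this velocity field,
  seen as an endomorphism of the tangent space at \<open>z\<close>.  On velocities of equivariant loops the
  metric of the loop space is therefore \<open>1 + (hess D z)\<^sup>2\<close>, and \<open>gradfield D z\<close> is the gradient of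
  the energy \<open>speed D\<close> for it.
\<close>

definition tangential :: "'a::euclidean_space \<Rightarrow> 'a \<Rightarrow> 'a"
  where "tangential z v = (z \<bullet> z) *\<^sub>R v - (z \<bullet> v) *\<^sub>R z"

definition shift :: "('a::euclidean_space \<Rightarrow> 'a) \<Rightarrow> 'a \<Rightarrow> 'a \<Rightarrow> 'a"
  where "shift D z v = D v - (z \<bullet> D z) *\<^sub>R v"

definition hess :: "('a::euclidean_space \<Rightarrow> 'a) \<Rightarrow> 'a \<Rightarrow> 'a \<Rightarrow> 'a"
  where "hess D z v = tangential z (shift D z (tangential z v))"

definition speed :: "('a::euclidean_space \<Rightarrow> 'a) \<Rightarrow> 'a \<Rightarrow> real"
  where "speed D z = D z \<bullet> D z - (z \<bullet> D z)\<^sup>2"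

definition grad_rhs :: "('a::euclidean_space \<Rightarrow> 'a) \<Rightarrow> 'a \<Rightarrow> 'a"
  where "grad_rhs D z = 2 *\<^sub>R hess D z (shift D z z)"

definition gradfield :: "('a::euclidean_space \<Rightarrow> 'a) \<Rightarrow> 'a \<Rightarrow> 'a"
  where "gradfield D z = (THE x. x + hess D z (hess D z x) = grad_rhs D z)"

lemma inner_tangential_self: "z \<bullet> tangential z v = 0"
  by (simp add: tangential_def inner_diff_right)

lemma tangential_eq: "norm z = 1 \<Longrightarrow> z \<bullet> v = 0 \<Longrightarrow> tangential z v = v"
  by (simp add: tangential_def power2_norm_eq_inner[symmetric])

lemma tangential_inner_commute: "tangential z u \<bullet> v = u \<bullet> tangential z v"
  by (simp add: tangential_def inner_diff_left inner_diff_right inner_commute)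

lemma linear_tangential: "linear (tangential z)"
  by (rule linearI) (simp_all add: tangential_def algebra_simps)

section \<open>Lipschitz dependence of the gradient field on the base point\<close>

definition Lipschitz_family :: "('a::euclidean_space \<Rightarrow> 'a \<Rightarrow> 'a) \<Rightarrow> bool"
  where "Lipschitz_family F \<longleftrightarrow> (\<forall>z. linear (F z)) \<and> (\<exists>C\<ge>0. \<forall>z w v. norm z \<le> 1 \<longrightarrow> norm w \<le> 1 \<longrightarrow>
     norm (F z v) \<le> C * norm v \<and> norm (F z v - F w v) \<le> C * norm (z - w) * norm v)"

lemma Lipschitz_familyI:
  assumes "\<And>z. linear (F z)" "C \<ge> 0"
    and "\<And>z w v. norm z \<le> 1 \<Longrightarrow> norm w \<le> 1 \<Longrightarrow>
       norm (F z v) \<le> C * norm v \<and> norm (F z v - F w v) \<le> C * norm (z - w) * norm v"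
  shows "Lipschitz_family F"
proof -
  have "\<forall>z w v. norm z \<le> 1 \<longrightarrow> norm w \<le> 1 \<longrightarrow>
     norm (F z v) \<le> C * norm v \<and> norm (F z v - F w v) \<le> C * norm (z - w) * norm v"
    using assms(3) by blast
  with assms(1,2) show ?thesis unfolding Lipschitz_family_def by blast
qed

text \<open>F_z G_z - F_w G_w = F_z (G_z - G_w) + (F_z - F_w) G_w. A Lipschitz bound passes to
  compositions together with a bound on the operators themselves, which is why
  \<open>Lipschitz_family\<close> contains both.\<close>

lemma Lipschitz_family_compose:
  assumes "Lipschitz_family F" "Lipschitz_family G"
  shows "Lipschitz_family (\<lambda>z v. F z (G z v))"
proof -
  obtain C where C: "C \<ge> 0" "\<And>z w v. norm z \<le> 1 \<Longrightarrow> norm w \<le> 1 \<Longrightarrow>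
     norm (F z v) \<le> C * norm v \<and> norm (F z v - F w v) \<le> C * norm (z - w) * norm v"
    using assms unfolding Lipschitz_family_def by metis
  obtain K where K: "K \<ge> 0" "\<And>z w v. norm z \<le> 1 \<Longrightarrow> norm w \<le> 1 \<Longrightarrow>
     norm (G z v) \<le> K * norm v \<and> norm (G z v - G w v) \<le> K * norm (z - w) * norm v"
    using assms unfolding Lipschitz_family_def by metis
  have lin: "linear (F z)" "linear (G z)" for z using assms unfolding Lipschitz_family_def by auto
  have *: "norm (F z (G z v)) \<le> 2 * C * K * norm v \<and>
      norm (F z (G z v) - F w (G w v)) \<le> 2 * C * K * norm (z - w) * norm v"
    if z: "norm z \<le> 1" "norm w \<le> 1" for z w v
  proof
    have "norm (F z (G z v)) \<le> C * (K * norm v)"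
      using C(2)[OF z, of "G z v"] K(2)[OF z, of v] C(1)
      by (meson mult_left_mono order_trans)
    also have "\<dots> \<le> 2 * C * K * norm v" using C K by simp
    finally show "norm (F z (G z v)) \<le> 2 * C * K * norm v" .
    have e: "F z (G z v) - F w (G w v) = F z (G z v - G w v) + (F z (G w v) - F w (G w v))"
      by (simp add: linear_diff[OF lin(1)])
    have "norm (F z (G z v) - F w (G w v)) \<le> norm (F z (G z v - G w v)) + norm (F z (G w v) - F w (G w v))"
      unfolding e by (rule norm_triangle_ineq)
    moreover have "norm (F z (G z v - G w v)) \<le> C * (K * norm (z - w) * norm v)"
      using C(2)[OF z] K(2)[OF z] C(1) by (meson mult_left_mono order_trans)
    moreover have "norm (F z (G w v) - F w (G w v)) \<le> C * norm (z - w) * (K * norm v)"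
    proof -
      have "norm (F z (G w v) - F w (G w v)) \<le> C * norm (z - w) * norm (G w v)" using C(2)[OF z] by blast
      also have "\<dots> \<le> C * norm (z - w) * (K * norm v)"
        using K(2)[OF z(2) z(2)] C(1) by (intro mult_left_mono) auto
      finally show ?thesis .
    qed
    ultimately show "norm (F z (G z v) - F w (G w v)) \<le> 2 * C * K * norm (z - w) * norm v"
      by (simp add: mult_ac)
  qed
  have l: "linear (\<lambda>v. F z (G z v))" for z
    using linear_compose[OF lin(2) lin(1)] by (simp add: o_def)
  show ?thesis by (rule Lipschitz_familyI[where C = "2 * C * K"]; (rule l *; assumption)?) (use C K in simp)
qed

text \<open>The projection to the complement of \<open>z\<close> appears multiplied by |z|^2, hence
  as a polynomial in \<open>z\<close>. In this form it is Lipschitz on the whole unit ball,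
  including the origin, where normalising would divide by zero.\<close>

lemma Lipschitz_family_tangential: "Lipschitz_family tangential"
proof -
  have "norm (tangential z v) \<le> 4 * norm v \<and> norm (tangential z v - tangential w v) \<le> 4 * norm (z - w) * norm v"
    if z: "norm z \<le> 1" "norm w \<le> 1" for z w v :: 'a
  proof
    have "norm (tangential z v) \<le> norm ((z \<bullet> z) *\<^sub>R v) + norm ((z \<bullet> v) *\<^sub>R z)"
      unfolding tangential_def by (rule norm_triangle_ineq4)
    also have "\<dots> = norm z * norm z * norm v + \<bar>z \<bullet> v\<bar> * norm z"
      by (simp add: power2_norm_eq_inner[symmetric] power2_eq_square)
    also have "\<dots> \<le> norm z * norm z * norm v + (norm z * norm v) * norm z"
      by (intro add_left_mono mult_right_mono Cauchy_Schwarz_ineq2) auto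
    also have "\<dots> = 2 * (norm z * norm z) * norm v" by simp
    also have "\<dots> \<le> 2 * (1 * 1) * norm v"
      by (intro mult_right_mono mult_left_mono mult_mono z) auto
    finally show "norm (tangential z v) \<le> 4 * norm v" using norm_ge_zero[of v] by linarith
    have e: "tangential z v - tangential w v = ((z - w) \<bullet> z + w \<bullet> (z - w)) *\<^sub>R v - (((z - w) \<bullet> v) *\<^sub>R z + (w \<bullet> v) *\<^sub>R (z - w))"
      by (simp add: tangential_def inner_diff_left inner_diff_right algebra_simps)
    have i: "norm ((z - w) \<bullet> z + w \<bullet> (z - w)) \<le> 2 * norm (z - w)"
    proof -
      have "\<bar>(z - w) \<bullet> z\<bar> \<le> norm (z - w) * 1"
        by (rule order_trans[OF Cauchy_Schwarz_ineq2]) (intro mult_left_mono z norm_ge_zero)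
      moreover have "\<bar>w \<bullet> (z - w)\<bar> \<le> 1 * norm (z - w)"
        by (rule order_trans[OF Cauchy_Schwarz_ineq2]) (intro mult_right_mono z norm_ge_zero)
      ultimately show ?thesis by simp
    qed
    have j: "norm (((z - w) \<bullet> v) *\<^sub>R z) \<le> norm (z - w) * norm v"
    proof -
      have "norm (((z - w) \<bullet> v) *\<^sub>R z) \<le> (norm (z - w) * norm v) * 1"
        unfolding norm_scaleR by (intro mult_mono z Cauchy_Schwarz_ineq2) auto
      then show ?thesis by simp
    qed
    have k: "norm ((w \<bullet> v) *\<^sub>R (z - w)) \<le> norm (z - w) * norm v"
    proof -
      have "norm ((w \<bullet> v) *\<^sub>R (z - w)) \<le> (norm w * norm v) * norm (z - w)"
        unfolding norm_scaleR by (intro mult_right_mono Cauchy_Schwarz_ineq2) auto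
      also have "\<dots> \<le> (1 * norm v) * norm (z - w)" by (intro mult_right_mono z) auto
      finally show ?thesis by (simp add: mult.commute)
    qed
    have "norm (tangential z v - tangential w v) \<le> norm (((z - w) \<bullet> z + w \<bullet> (z - w)) *\<^sub>R v)
        + (norm (((z - w) \<bullet> v) *\<^sub>R z) + norm ((w \<bullet> v) *\<^sub>R (z - w)))"
      unfolding e by (rule order_trans[OF norm_triangle_ineq4]) (intro add_left_mono norm_triangle_ineq)
    also have "\<dots> \<le> 2 * norm (z - w) * norm v + (norm (z - w) * norm v + norm (z - w) * norm v)"
      using i mult_right_mono[OF i norm_ge_zero[of v]] j k by (intro add_mono) auto
    finally show "norm (tangential z v - tangential w v) \<le> 4 * norm (z - w) * norm v" by (simp add: mult_ac)
  qed
  note * = this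
  show ?thesis by (rule Lipschitz_familyI[where C = 4]; (rule linear_tangential *; assumption)?) simp
qed

locale symmetric_operator =
  fixes D :: "'a::euclidean_space \<Rightarrow> 'a"
  assumes linear_D: "linear D" and D_commute: "D u \<bullet> v = u \<bullet> D v"
begin

lemma Lipschitz_family_shift: "Lipschitz_family (shift D)"
proof -
  obtain K where K: "K > 0" "\<And>x. norm (D x) \<le> K * norm x"
    using linear_bounded_pos[OF linear_D] by blast
  have *: "norm (shift D z v) \<le> 2 * K * norm v \<and> norm (shift D z v - shift D w v) \<le> 2 * K * norm (z - w) * norm v"
    if z: "norm z \<le> 1" "norm w \<le> 1" for z w v
  proof
    have b: "\<bar>x \<bullet> D y\<bar> \<le> K * (norm x * norm y)" for x y
    proof -
      have "\<bar>x \<bullet> D y\<bar> \<le> norm x * norm (D y)" by (rule Cauchy_Schwarz_ineq2)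
      also have "\<dots> \<le> norm x * (K * norm y)" by (intro mult_left_mono K) auto
      finally show ?thesis by (simp add: mult_ac)
    qed
    have "K * (norm z * norm z) \<le> K * (1 * 1)" using K(1) by (intro mult_left_mono mult_mono z) auto
    with b[of z z] have bz: "\<bar>z \<bullet> D z\<bar> \<le> K" by simp
    have "norm (shift D z v) \<le> norm (D v) + norm ((z \<bullet> D z) *\<^sub>R v)"
      unfolding shift_def by (rule norm_triangle_ineq4)
    also have "\<dots> \<le> K * norm v + K * norm v"
      unfolding norm_scaleR by (intro add_mono K mult_right_mono bz) auto
    finally show "norm (shift D z v) \<le> 2 * K * norm v" by simp
    have "shift D z v - shift D w v = - ((((z - w) \<bullet> D z) + (w \<bullet> D (z - w))) *\<^sub>R v)"
      by (simp add: shift_def inner_diff_left inner_diff_right linear_diff[OF linear_D] algebra_simps)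
    then have "norm (shift D z v - shift D w v) = \<bar>(z - w) \<bullet> D z + w \<bullet> D (z - w)\<bar> * norm v" by simp
    also have "\<dots> \<le> (2 * K * norm (z - w)) * norm v"
    proof (rule mult_right_mono)
      have "K * (norm (z - w) * norm z) \<le> K * (norm (z - w) * 1)" "K * (norm w * norm (z - w)) \<le> K * (1 * norm (z - w))"
        using K(1) by (intro mult_left_mono mult_right_mono z; simp)+
      then show "\<bar>(z - w) \<bullet> D z + w \<bullet> D (z - w)\<bar> \<le> 2 * K * norm (z - w)"
        using b[of "z - w" z] b[of w "z - w"] by simp
    qed simp
    finally show "norm (shift D z v - shift D w v) \<le> 2 * K * norm (z - w) * norm v" .
  qed
  have l: "linear (shift D z)" for z
    by (rule linearI) (simp_all add: shift_def linear_add[OF linear_D] linear_scale[OF linear_D] algebra_simps)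
  show ?thesis by (rule Lipschitz_familyI[where C = "2 * K"]; (rule l *; assumption)?) (use K(1) in simp)
qed

lemma Lipschitz_family_hess: "Lipschitz_family (hess D)"
  unfolding hess_def[abs_def] by (rule Lipschitz_family_compose[OF Lipschitz_family_tangential Lipschitz_family_compose[OF Lipschitz_family_shift Lipschitz_family_tangential]])

lemma linear_hess: "linear (hess D z)"
  using Lipschitz_family_hess by (simp add: Lipschitz_family_def)

lemma shift_inner_commute: "shift D z u \<bullet> v = u \<bullet> shift D z v"
  by (simp add: shift_def inner_diff_left inner_diff_right D_commute)

lemma hess_inner_commute: "hess D z u \<bullet> v = u \<bullet> hess D z v"
  by (simp add: hess_def tangential_inner_commute shift_inner_commute)

text \<open>Since \<open>hess\<close> is symmetric, pairing v with the right-hand vector gives |v|^2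
  + |\<open>hess\<close> v|^2. So 1 + \<open>hess\<close>^2 is injective and its inverse has norm at
  most 1, which yields \<open>gradfield\<close> and later its Lipschitz bound.\<close>

lemma norm_le_one_plus_hess: "norm v \<le> norm (v + hess D z (hess D z v))"
proof -
  let ?R = "v + hess D z (hess D z v)"
  have "norm v * norm v \<le> v \<bullet> ?R"
    by (simp add: inner_add_right hess_inner_commute[symmetric] power2_norm_eq_inner[symmetric]
        power2_eq_square[symmetric])
  also have "\<dots> \<le> norm v * norm ?R" by (rule norm_cauchy_schwarz)
  finally show ?thesis by (cases "v = 0") auto
qed

lemma gradfield_eq: "gradfield D z + hess D z (hess D z (gradfield D z)) = grad_rhs D z"
proof -
  let ?R = "\<lambda>v. v + hess D z (hess D z v)"
  have lin: "linear ?R"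
    by (rule linearI) (simp_all add: linear_add[OF linear_hess] linear_scale[OF linear_hess] algebra_simps)
  have "v = 0" if "?R v = 0" for v
  proof -
    have "norm v \<le> norm (0 :: 'a)" using norm_le_one_plus_hess[of v z] unfolding that .
    then show ?thesis by simp
  qed
  then have inj: "inj ?R" unfolding linear_injective_0[OF lin] by blast
  then have "surj ?R" by (rule linear_inj_imp_surj[OF lin])
  then obtain x where "grad_rhs D z = ?R x" by (rule surjE)
  then have x: "?R x = grad_rhs D z" ..
  have "\<exists>!x. ?R x = grad_rhs D z"
  proof (rule ex1I[of _ x])
    show "?R x = grad_rhs D z" by (rule x)
    show "y = x" if "?R y = grad_rhs D z" for y using injD[OF inj, of y x] x that by simp
  qed
  from theI'[OF this] show ?thesis by (simp add: gradfield_def)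
qed

lemma inner_gradfield: "z \<bullet> gradfield D z = 0"
proof -
  have "z \<bullet> hess D z v = 0" for v by (simp add: hess_def inner_tangential_self)
  then show ?thesis using arg_cong[OF gradfield_eq, of "inner z" z] by (simp add: inner_add_right grad_rhs_def)
qed

text \<open>Subtracting the defining equations at \<open>z\<close> and \<open>w\<close> leaves 1 +
  \<open>hess\<close>^2 at \<open>z\<close>, applied to the difference of the solutions, equal to
  two terms of order |z - w|; the inverse does not increase norms.\<close>

lemma gradfield_Lipschitz:
  "\<exists>L. \<forall>z w. norm z \<le> 1 \<longrightarrow> norm w \<le> 1 \<longrightarrow> norm (gradfield D z - gradfield D w) \<le> L * norm (z - w)"
proof -
  have "Lipschitz_family (\<lambda>z v. hess D z (shift D z v))" by (rule Lipschitz_family_compose[OF Lipschitz_family_hess Lipschitz_family_shift])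
  then obtain C where C: "C \<ge> 0" "\<And>z w v. norm z \<le> 1 \<Longrightarrow> norm w \<le> 1 \<Longrightarrow>
     norm (hess D z (shift D z v)) \<le> C * norm v \<and>
     norm (hess D z (shift D z v) - hess D w (shift D w v)) \<le> C * norm (z - w) * norm v"
     and lin: "\<And>z. linear (\<lambda>v. hess D z (shift D z v))"
    unfolding Lipschitz_family_def by metis
  have "Lipschitz_family (\<lambda>z v. hess D z (hess D z v))" by (rule Lipschitz_family_compose[OF Lipschitz_family_hess Lipschitz_family_hess])
  then obtain K where K: "K \<ge> 0" "\<And>z w v. norm z \<le> 1 \<Longrightarrow> norm w \<le> 1 \<Longrightarrow>
     norm (hess D z (hess D z v) - hess D w (hess D w v)) \<le> K * norm (z - w) * norm v"
    unfolding Lipschitz_family_def by metis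
  have "norm (gradfield D z - gradfield D w) \<le> (4 * C + 2 * K * C) * norm (z - w)"
    if z: "norm z \<le> 1" and w: "norm w \<le> 1" for z w
  proof -
    let ?x = "gradfield D z" and ?y = "gradfield D w" and ?H = "\<lambda>z v. hess D z (hess D z v)"
    have "norm (hess D w (shift D w w)) \<le> C * norm w" using C(2)[OF w w] by blast
    also have "\<dots> \<le> C * 1" by (intro mult_left_mono w C)
    finally have "norm (grad_rhs D w) \<le> 2 * C" by (simp add: grad_rhs_def)
    then have y: "norm ?y \<le> 2 * C"
      using norm_le_one_plus_hess[of ?y w] gradfield_eq[of w] by simp
    have e: "hess D z (shift D z z) - hess D w (shift D w w) = hess D z (shift D z (z - w))
        + (hess D z (shift D z w) - hess D w (shift D w w))"
      using linear_diff[OF lin, of z z w] by simp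
    have "norm (hess D z (shift D z z) - hess D w (shift D w w)) \<le> C * norm (z - w) + C * norm (z - w) * norm w"
      unfolding e using C(2)[OF z w, of "z - w"] C(2)[OF z w, of w] by (intro norm_triangle_mono) blast+
    also have "\<dots> \<le> C * norm (z - w) + C * norm (z - w) * 1"
      by (intro add_left_mono mult_left_mono w) (simp add: C)
    finally have r: "norm (grad_rhs D z - grad_rhs D w) \<le> 4 * C * norm (z - w)"
      by (simp add: grad_rhs_def scaleR_diff_right[symmetric])
    have e2: "(?x - ?y) + ?H z (?x - ?y) = (grad_rhs D z - grad_rhs D w) - (?H z ?y - ?H w ?y)"
      unfolding gradfield_eq[symmetric] by (simp add: linear_diff[OF linear_hess])
    have "norm (?x - ?y) \<le> norm (grad_rhs D z - grad_rhs D w) + norm (?H z ?y - ?H w ?y)"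
      using norm_le_one_plus_hess[of "?x - ?y" z] unfolding e2
      by (rule order_trans) (rule norm_triangle_ineq4)
    also have "\<dots> \<le> 4 * C * norm (z - w) + K * norm (z - w) * norm ?y"
      by (intro add_mono r K z w)
    also have "\<dots> \<le> 4 * C * norm (z - w) + K * norm (z - w) * (2 * C)"
      by (intro add_left_mono mult_left_mono y) (simp add: K)
    finally show ?thesis by (simp add: algebra_simps)
  qed
  then show ?thesis by blast
qed

text \<open>The Lipschitz bound is available on the unit ball, so the field is composed with the
  nearest-point map \<open>c\<close> of the ball to make it globally Lipschitz. The new field is
  still orthogonal to the position vector, so norms are conserved, and on the unit sphere it is
  \<open>- gradfield D\<close>.\<close>

lemma gradient_flow_ex:
  "\<exists>\<phi>. (\<forall>z. \<phi> z 0 = z) \<and> (\<forall>s. continuous_on UNIV (\<lambda>z. \<phi> z s)) \<and>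
     (\<forall>z s t. \<phi> (\<phi> z s) t = \<phi> z (s + t)) \<and>
     (\<forall>z s. norm z = 1 \<longrightarrow> norm (\<phi> z s) = 1 \<and>
        (\<phi> z has_vector_derivative - gradfield D (\<phi> z s)) (at s))"
proof -
  obtain L where L: "\<And>z w. norm z \<le> 1 \<Longrightarrow> norm w \<le> 1 \<Longrightarrow>
      norm (gradfield D z - gradfield D w) \<le> L * norm (z - w)"
    using gradfield_Lipschitz by blast
  define c where "c = closest_point (cball (0::'a) 1)"
  have c1: "norm (c z) \<le> 1" for z
    using closest_point_in_set[of "cball (0::'a) 1" z] by (simp add: c_def)
  have c2: "norm (c z - c w) \<le> norm (z - w)" for z w
    using closest_point_lipschitz[of "cball (0::'a) 1" z w] by (simp add: c_def dist_norm)
  have c3: "c z = z" if "norm z \<le> 1" for z using that by (simp add: c_def closest_point_self)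
  \<comment> \<open>Points outside the ball are projected radially. Proportionality of
    \<open>z\<close> and \<open>c z\<close> transfers \<open>inner_gradfield\<close> from
    \<open>c z\<close> to \<open>z\<close>.\<close>
  have c4: "\<exists>r. z = r *\<^sub>R c z" for z
  proof (cases "norm z \<le> 1")
    case True then show ?thesis using c3 by (metis scaleR_one)
  next
    case False
    then have z0: "z \<noteq> 0" by (metis norm_zero zero_le_one)
    have "z /\<^sub>R norm z = c z" unfolding c_def
    proof (rule closest_point_unique)
      show "\<forall>y\<in>cball 0 1. dist z (z /\<^sub>R norm z) \<le> dist z y"
      proof
        fix y :: 'a assume "y \<in> cball 0 1"
        then have "norm z - 1 \<le> norm (z - y)" using norm_triangle_ineq2[of z y] by simp
        moreover have "norm (z - z /\<^sub>R norm z) = norm z - 1"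
        proof -
          have "z - z /\<^sub>R norm z = (1 - 1 / norm z) *\<^sub>R z"
            by (simp add: algebra_simps divide_inverse)
          moreover have le: "1 / norm z \<le> 1" by (rule divide_le_eq_1_pos[THEN iffD2]) (use False in linarith)+
          ultimately have "norm (z - z /\<^sub>R norm z) = \<bar>1 - 1 / norm z\<bar> * norm z"
            by (simp only: norm_scaleR)
          also have "\<bar>1 - 1 / norm z\<bar> = 1 - 1 / norm z" using le by simp
          also have "(1 - 1 / norm z) * norm z = norm z - 1" using z0 by (simp add: field_simps)
          finally show ?thesis .
        qed
        ultimately show "dist z (z /\<^sub>R norm z) \<le> dist z y" by (simp add: dist_norm)
      qed
    qed (use z0 in auto)
    then have "norm z *\<^sub>R c z = norm z *\<^sub>R (z /\<^sub>R norm z)" by simp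
    also have "\<dots> = z" using z0 by simp
    finally have "z = norm z *\<^sub>R c z" by simp
    then show ?thesis by blast
  qed
  define F where "F = (\<lambda>z. - gradfield D (c z))"
  have tangential: "z \<bullet> F z = 0" for z
  proof -
    obtain r where r: "z = r *\<^sub>R c z" using c4 by blast
    have "(r *\<^sub>R c z) \<bullet> F z = 0" by (simp add: F_def inner_gradfield)
    then show ?thesis using r by simp
  qed
  have L1: "\<bar>L\<bar> * norm (c z - c w) \<le> \<bar>L\<bar> * norm (z - w)" for z w by (intro mult_left_mono c2) auto
  have L2: "L * norm (c z - c w) \<le> \<bar>L\<bar> * norm (c z - c w)" for z w by (intro mult_right_mono) auto
  have LF: "norm (F z - F w) \<le> \<bar>L\<bar> * norm (z - w)" for z w
  proof -
    have "norm (F z - F w) = norm (gradfield D (c z) - gradfield D (c w))"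
      by (simp add: F_def norm_minus_commute)
    then show ?thesis using L[OF c1 c1, of z w] L1[of z w] L2[of z w] by linarith
  qed
  obtain \<phi> where \<phi>: "\<And>z. \<phi> z 0 = z" "\<And>z t. (\<phi> z has_vector_derivative F (\<phi> z t)) (at t)"
    using Lipschitz_ode_solution_ex[of F "\<bar>L\<bar>", OF LF] by metis
  have cont: "continuous_on UNIV (\<lambda>z. \<phi> z s)" for s
  proof (rule lipschitz_on_continuous_on)
    have "norm (\<phi> z s - \<phi> w s) \<le> exp (\<bar>L\<bar> * \<bar>s\<bar>) * norm (z - w)" for z w
      using ode_solutions_dist_le[OF LF \<phi>(2) \<phi>(2), of z s w] by (simp add: \<phi>(1))
    then show "lipschitz_on (exp (\<bar>L\<bar> * \<bar>s\<bar>)) UNIV (\<lambda>z. \<phi> z s)"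
      by (simp add: lipschitz_on_def dist_norm)
  qed
  have semi: "\<phi> (\<phi> z s) t = \<phi> z (s + t)" for z s t
  proof -
    have "((\<lambda>t. \<phi> z (s + t)) has_vector_derivative F (\<phi> z (s + t))) (at t)" for t
    proof -
      have "((\<lambda>t. s + t) has_vector_derivative 1) (at t)" by (auto intro!: derivative_eq_intros)
      from vector_diff_chain_at[OF this \<phi>(2)] show ?thesis by (simp add: o_def)
    qed
    from ode_solutions_dist_le[OF LF \<phi>(2) this, of "\<phi> z s" t] show ?thesis by (simp add: \<phi>(1))
  qed
  have nrm: "norm (\<phi> z s) = norm z" for z s
  proof -
    have "((\<lambda>s. \<phi> z s \<bullet> \<phi> z s) has_vector_derivative 0) (at s)" for s
      using bounded_bilinear.has_vector_derivative[OF bounded_bilinear_inner \<phi>(2)[of z s] \<phi>(2)[of z s]]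
      by (simp add: tangential inner_commute[of "F (\<phi> z s)"])
    then have "\<phi> z s \<bullet> \<phi> z s = \<phi> z 0 \<bullet> \<phi> z 0"
      using has_vector_derivative_zero_constant[of UNIV "\<lambda>s. \<phi> z s \<bullet> \<phi> z s"]
      by (metis UNIV_I convex_UNIV)
    then show ?thesis by (simp add: \<phi>(1) norm_eq)
  qed
  show ?thesis
  proof (intro exI[of _ \<phi>] conjI allI impI)
    fix z :: 'a and s assume z: "norm z = 1"
    then show "norm (\<phi> z s) = 1" by (simp add: nrm)
    show "(\<phi> z has_vector_derivative - gradfield D (\<phi> z s)) (at s)"
      using \<phi>(2)[of z s] c3[of "\<phi> z s"] nrm[of z s] z by (simp add: F_def)
  qed (use \<phi>(1) cont semi in auto)
qed

end

section \<open>Monotone energy and limit points of flow lines\<close>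

lemma mono_bounded_tendsto_Sup:
  fixes f :: "real \<Rightarrow> real"
  assumes "mono f" and bd: "bdd_above (range f)"
  shows "(f \<longlongrightarrow> Sup (range f)) at_top"
proof (rule order_tendstoI)
  fix y assume "y < Sup (range f)"
  then obtain s where "y < f s" using less_cSup_iff[OF _ bd] by auto
  then show "\<forall>\<^sub>F x in at_top. y < f x"
    using monoD[OF assms(1), of s] unfolding eventually_at_top_linorder
    by (intro exI[of _ s] allI impI) (rule less_le_trans)
next
  fix y assume "Sup (range f) < y"
  then show "\<forall>\<^sub>F x in at_top. f x < y"
    using cSup_upper[OF _ bd] by (intro always_eventually allI) (meson le_less_trans rangeI)
qed

context symmetric_operator
begin

lemma continuous_on_D: "continuous_on S D"
  by (rule linear_continuous_on) (simp add: linear_D linear_conv_bounded_linear[symmetric])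

lemma continuous_on_speed: "continuous_on S (speed D)"
  unfolding speed_def[abs_def] by (intro continuous_intros continuous_on_D)

text \<open>On tangent vectors x the differential of \<open>speed\<close> is the pairing with
  \<open>grad_rhs\<close>. For x = \<open>gradfield\<close> the defining equation turns it into
  |x|^2 + |\<open>hess\<close> x|^2, the squared length of the gradient in the metric of the loop
  space.\<close>

lemma speed_has_derivative:
  assumes z: "norm (z s) = 1" and d: "(z has_vector_derivative - gradfield D (z s)) (at s)"
  shows "((\<lambda>s. speed D (z s)) has_real_derivative
    - ((norm (gradfield D (z s)))\<^sup>2 + (norm (hess D (z s) (gradfield D (z s))))\<^sup>2)) (at s)"
proof -
  let ?z = "z s" and ?x = "gradfield D (z s)"
  have bl: "bounded_linear D" by (simp add: linear_D linear_conv_bounded_linear[symmetric])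
  have dD: "((\<lambda>s. D (z s)) has_vector_derivative D (- ?x)) (at s)"
    by (rule bounded_linear.has_vector_derivative[OF bl d])
  have 1: "((\<lambda>s. D (z s) \<bullet> D (z s)) has_real_derivative D ?z \<bullet> D (- ?x) + D (- ?x) \<bullet> D ?z) (at s)"
    unfolding has_real_derivative_iff_has_vector_derivative
    by (rule bounded_bilinear.has_vector_derivative[OF bounded_bilinear_inner dD dD])
  have 2: "((\<lambda>s. z s \<bullet> D (z s)) has_real_derivative ?z \<bullet> D (- ?x) + - ?x \<bullet> D ?z) (at s)"
    unfolding has_real_derivative_iff_has_vector_derivative
    by (rule bounded_bilinear.has_vector_derivative[OF bounded_bilinear_inner d dD])
  have neg: "D (- ?x) = - D ?x" by (rule linear_neg[OF linear_D])
  have zx: "?z \<bullet> ?x = 0" by (rule inner_gradfield)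
  have zz: "?z \<bullet> ?z = 1" using z by (simp add: power2_norm_eq_inner[symmetric])
  have px: "tangential ?z ?x = ?x" by (rule tangential_eq[OF z zx])
  have pk: "tangential ?z (shift D ?z ?z) = shift D ?z ?z"
    by (rule tangential_eq[OF z]) (simp add: shift_def inner_diff_right zz)
  have "grad_rhs D ?z \<bullet> ?x = 2 * (shift D ?z (shift D ?z ?z) \<bullet> ?x)"
    by (simp add: grad_rhs_def hess_def pk tangential_inner_commute px)
  also have "shift D ?z (shift D ?z ?z) \<bullet> ?x = D ?z \<bullet> D ?x - 2 * (?z \<bullet> D ?z) * (D ?z \<bullet> ?x)"
    by (simp add: shift_def linear_diff[OF linear_D] linear_scale[OF linear_D] inner_diff_left
        inner_diff_right zx D_commute[of "D ?z"] D_commute[of ?z ?x] algebra_simps)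
  finally have a: "grad_rhs D ?z \<bullet> ?x = 2 * (D ?z \<bullet> D ?x) - 4 * (?z \<bullet> D ?z) * (D ?z \<bullet> ?x)" by simp
  have "grad_rhs D ?z \<bullet> ?x = ?x \<bullet> ?x + hess D ?z ?x \<bullet> hess D ?z ?x"
    unfolding gradfield_eq[symmetric] by (simp add: inner_add_left hess_inner_commute)
  with a have b: "2 * (D ?z \<bullet> D ?x) - 4 * (?z \<bullet> D ?z) * (D ?z \<bullet> ?x) = (norm ?x)\<^sup>2 + (norm (hess D ?z ?x))\<^sup>2"
    by (simp add: power2_norm_eq_inner)
  have "((\<lambda>s. speed D (z s)) has_real_derivative (D ?z \<bullet> D (- ?x) + D (- ?x) \<bullet> D ?z)
     - 2 * (?z \<bullet> D ?z) * (?z \<bullet> D (- ?x) + - ?x \<bullet> D ?z)) (at s)"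
    unfolding speed_def by (rule DERIV_cong[OF DERIV_diff[OF 1 DERIV_power[OF 2, of 2]]]) simp
  moreover have "(D ?z \<bullet> D (- ?x) + D (- ?x) \<bullet> D ?z)
     - 2 * (?z \<bullet> D ?z) * (?z \<bullet> D (- ?x) + - ?x \<bullet> D ?z)
     = - (2 * (D ?z \<bullet> D ?x) - 4 * (?z \<bullet> D ?z) * (D ?z \<bullet> ?x))"
    using D_commute[of ?z ?x] by (simp add: neg inner_commute algebra_simps)
  ultimately show ?thesis unfolding b by simp
qed

end

locale gradient_flow = symmetric_operator D for D :: "'a::euclidean_space \<Rightarrow> 'a" +
  fixes \<phi> :: "'a \<Rightarrow> real \<Rightarrow> 'a"
  assumes flow_0: "\<phi> z 0 = z"
    and continuous_on_flow: "continuous_on UNIV (\<lambda>z. \<phi> z s)"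
    and flow_flow: "\<phi> (\<phi> z s) t = \<phi> z (s + t)"
    and norm_flow: "norm z = 1 \<Longrightarrow> norm (\<phi> z s) = 1"
    and flow_has_derivative: "norm z = 1 \<Longrightarrow> (\<phi> z has_vector_derivative - gradfield D (\<phi> z s)) (at s)"
begin

lemma speed_flow_antimono:
  assumes "norm z = 1" "s \<le> t"
  shows "speed D (\<phi> z t) \<le> speed D (\<phi> z s)"
  by (rule DERIV_nonpos_imp_nonincreasing[OF assms(2)])
    (use speed_has_derivative[OF norm_flow flow_has_derivative] assms(1) in \<open>fastforce intro: add_nonneg_nonneg\<close>)

lemma speed_constant_imp_critical:
  assumes z: "norm z = 1" and const: "\<And>t. speed D (\<phi> z t) = speed D z"
  shows "grad_rhs D z = 0"
proof -
  let ?x = "gradfield D z"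
  have 1: "((\<lambda>s. speed D (\<phi> z s)) has_real_derivative
      - ((norm ?x)\<^sup>2 + (norm (hess D z ?x))\<^sup>2)) (at 0)"
    using speed_has_derivative[OF norm_flow flow_has_derivative, OF z z, of 0] by (simp add: flow_0)
  have "((\<lambda>s. speed D (\<phi> z s)) has_real_derivative 0) (at 0)" by (simp add: const)
  from DERIV_unique[OF 1 this] have "(norm ?x)\<^sup>2 + (norm (hess D z ?x))\<^sup>2 = 0" by linarith
  then have "?x = 0" by (simp add: add_nonneg_eq_0_iff)
  then show ?thesis using gradfield_eq[of z] linear_0[OF linear_hess] by simp
qed

text \<open>The sign \<open>\<sigma>\<close> selects the direction of time.\<close>

lemma flow_limit_critical:
  assumes z: "norm z = 1" and sg: "\<sigma> = 1 \<or> \<sigma> = -1"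
    and S: "filterlim S at_top sequentially" and lim: "(\<lambda>k. \<phi> z (\<sigma> * S k)) \<longlonglongrightarrow> w"
    and L: "((\<lambda>s. speed D (\<phi> z (\<sigma> * s))) \<longlongrightarrow> L) at_top"
  shows "norm w = 1 \<and> speed D w = L \<and> grad_rhs D w = 0"
proof -
  have w: "norm w = 1"
    using tendsto_norm[OF lim] by (simp add: norm_flow z LIMSEQ_const_iff)
  \<comment> \<open>The speed at time \<open>t\<close> along the orbit of \<open>w\<close> is the
    limit of speeds along the orbit of \<open>z\<close> at times shifted by \<open>t\<close>, which
    still run off in the direction \<sigma>. So the speed is constant on the whole orbit of
    \<open>w\<close>.\<close>
  have sp: "speed D (\<phi> w t) = L" for t
  proof -
    have "continuous_on UNIV (\<lambda>z. speed D (\<phi> z t))"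
      by (rule continuous_on_compose2[OF continuous_on_speed continuous_on_flow]) auto
    then have "(\<lambda>k. speed D (\<phi> (\<phi> z (\<sigma> * S k)) t)) \<longlonglongrightarrow> speed D (\<phi> w t)"
      by (rule continuous_on_tendsto_compose[OF _ lim]) auto
    moreover have "\<phi> (\<phi> z (\<sigma> * S k)) t = \<phi> z (\<sigma> * (S k + \<sigma> * t))" for k
      using sg by (auto simp: flow_flow algebra_simps)
    moreover have "filterlim (\<lambda>k. S k + \<sigma> * t) at_top sequentially"
      using filterlim_tendsto_add_at_top[OF tendsto_const S, of "\<sigma> * t"] by (simp add: add.commute)
    then have "(\<lambda>k. speed D (\<phi> z (\<sigma> * (S k + \<sigma> * t)))) \<longlonglongrightarrow> L"
      by (rule filterlim_compose[OF L])
    ultimately show ?thesis using LIMSEQ_unique by simp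
  qed
  then have "speed D w = L" using sp[of 0] by (simp add: flow_0)
  then show ?thesis using speed_constant_imp_critical[OF w] sp w by simp
qed

lemma speed_flow_tendsto:
  assumes z: "norm z = 1" and sg: "\<sigma> = 1 \<or> \<sigma> = -1"
  shows "\<exists>L. ((\<lambda>s. speed D (\<phi> z (\<sigma> * s))) \<longlongrightarrow> L) at_top"
proof -
  \<comment> \<open>The factor -\<sigma> makes the monitored quantity nondecreasing in both
    directions of time.\<close>
  let ?f = "\<lambda>s. - \<sigma> * speed D (\<phi> z (\<sigma> * s))"
  have "compact (speed D ` sphere 0 1)"
    by (intro compact_continuous_image continuous_on_speed) simp
  then have "bounded (speed D ` sphere 0 1)" by (rule compact_imp_bounded)
  then obtain B where B: "\<And>w. norm w = 1 \<Longrightarrow> \<bar>speed D w\<bar> \<le> B"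
    unfolding bounded_iff by force
  have "bdd_above (range ?f)"
  proof (rule bdd_aboveI2)
    show "?f s \<le> B" for s using sg B[of "\<phi> z (\<sigma> * s)"] norm_flow[OF z] by auto
  qed
  moreover have "mono ?f"
    using sg by (auto intro!: monoI speed_flow_antimono[OF z])
  ultimately have "(?f \<longlongrightarrow> Sup (range ?f)) at_top" by (intro mono_bounded_tendsto_Sup)
  then have "((\<lambda>s. - \<sigma> * ?f s) \<longlongrightarrow> - \<sigma> * Sup (range ?f)) at_top" by (intro tendsto_intros)
  moreover have "(\<lambda>s. - \<sigma> * ?f s) = (\<lambda>s. speed D (\<phi> z (\<sigma> * s)))" using sg by auto
  ultimately show ?thesis by auto
qed

text \<open>LaSalle's principle, stated for a test function \<open>g\<close>. In the application the
  critical points at one level differ by signs of coordinates, so convergence is first obtained for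
  functions that agree on all of them, the squares of the coordinates.\<close>

lemma flow_observable_tendsto:
  fixes g :: "'a \<Rightarrow> real"
  assumes z: "norm z = 1" and sg: "\<sigma> = 1 \<or> \<sigma> = -1" and g: "continuous_on UNIV g"
    and L: "((\<lambda>s. speed D (\<phi> z (\<sigma> * s))) \<longlongrightarrow> L) at_top"
    and crit: "\<And>w. norm w = 1 \<Longrightarrow> speed D w = L \<Longrightarrow> grad_rhs D w = 0 \<Longrightarrow> g w = c"
  shows "((\<lambda>s. g (\<phi> z (\<sigma> * s))) \<longlongrightarrow> c) at_top"
proof (rule ccontr)
  assume "\<not> ?thesis"
  then obtain e where e: "e > 0" "\<not> (\<forall>\<^sub>F s in at_top. dist (g (\<phi> z (\<sigma> * s))) c < e)"
    unfolding tendsto_iff by blast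
  have "\<exists>s\<ge>real k. dist (g (\<phi> z (\<sigma> * s))) c \<ge> e" for k :: nat
    using e(2) unfolding eventually_at_top_linorder by (meson not_less)
  then obtain S where S: "\<And>k. S k \<ge> real k" "\<And>k. dist (g (\<phi> z (\<sigma> * S k))) c \<ge> e" by metis
  have "compact (sphere (0::'a) 1)" by simp
  moreover have "\<forall>k. \<phi> z (\<sigma> * S k) \<in> sphere 0 1" using norm_flow[OF z] by simp
  ultimately obtain w r where r: "strict_mono r" "((\<lambda>k. \<phi> z (\<sigma> * S k)) \<circ> r) \<longlonglongrightarrow> w"
    unfolding compact_def by meson
  have "filterlim (\<lambda>k. S (r k)) at_top sequentially"
  proof (rule filterlim_at_top_mono[OF filterlim_real_sequentially])
    show "\<forall>\<^sub>F k in sequentially. real k \<le> S (r k)"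
      using S(1) seq_suble[OF r(1)] by (intro always_eventually allI) (meson of_nat_mono order_trans)
  qed
  from flow_limit_critical[OF z sg this _ L] r(2) have "g w = c"
    using crit by (auto simp: o_def)
  moreover have "(\<lambda>k. g (\<phi> z (\<sigma> * S (r k)))) \<longlonglongrightarrow> g w"
    by (rule continuous_on_tendsto_compose[OF g]) (use r(2) in \<open>auto simp: o_def\<close>)
  ultimately have "\<forall>\<^sub>F k in sequentially. dist (g (\<phi> z (\<sigma> * S (r k)))) c < e"
    using e(1) tendstoD by blast
  then obtain k where "dist (g (\<phi> z (\<sigma> * S (r k)))) c < e"
    unfolding eventually_sequentially by blast
  with S(2)[of "r k"] show False by simp
qed

end

section \<open>The connecting orbit\<close>

definition diag_op :: "('k::finite \<Rightarrow> real) \<Rightarrow> real^'k \<Rightarrow> real^'k"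
  where "diag_op a z = (\<chi> j. a j * z $ j)"

lemma symmetric_operator_diag_op: "symmetric_operator (diag_op a)"
proof (rule symmetric_operator.intro)
  show "linear (diag_op a)" by (rule linearI) (simp_all add: diag_op_def vec_eq_iff algebra_simps)
  show "diag_op a u \<bullet> v = u \<bullet> diag_op a v" for u v
    by (simp add: diag_op_def inner_vec_def mult_ac)
qed

text \<open>If the square has a nonzero limit, the function is eventually nonzero, and by the
  intermediate value theorem its sign is then fixed. This selects one of the limit points that
  differ by signs.\<close>

lemma tendsto_of_power2_tendsto:
  fixes f :: "real \<Rightarrow> real"
  assumes f: "continuous_on UNIV f" and q: "((\<lambda>s. (f s)\<^sup>2) \<longlongrightarrow> q) at_top"
  shows "\<exists>y. y\<^sup>2 = q \<and> (f \<longlongrightarrow> y) at_top"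
proof -
  have q0: "q \<ge> 0"
    by (rule tendsto_lowerbound[OF q]) auto
  have abs: "((\<lambda>s. \<bar>f s\<bar>) \<longlongrightarrow> sqrt q) at_top" using tendsto_real_sqrt[OF q] by simp
  show ?thesis
  proof (cases "q = 0")
    case True
    then show ?thesis using abs by (intro exI[of _ 0]) (simp add: tendsto_rabs_zero_iff)
  next
    case False
    then have "\<forall>\<^sub>F s in at_top. 0 < (f s)\<^sup>2" using q0 by (intro order_tendstoD(1)[OF q]) simp
    then obtain S where S: "\<And>s. s \<ge> S \<Longrightarrow> f s \<noteq> 0" unfolding eventually_at_top_linorder by auto
    have sgn: "sgn (f s) = sgn (f S)" if s: "s \<ge> S" for s
    proof (rule ccontr)
      assume "sgn (f s) \<noteq> sgn (f S)"
      then have "f S \<le> 0 \<and> 0 \<le> f s \<or> f s \<le> 0 \<and> 0 \<le> f S"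
        using S[of s] S[of S] s by (auto simp: sgn_if split: if_splits)
      then obtain x where "S \<le> x" "f x = 0"
        using IVT'[of f S 0 s] IVT2'[of f s 0 S] s continuous_on_subset[OF f] by (metis subset_UNIV)
      then show False using S by blast
    qed
    have "((\<lambda>s. sgn (f S) * \<bar>f s\<bar>) \<longlongrightarrow> sgn (f S) * sqrt q) at_top" by (intro tendsto_intros abs)
    moreover have "\<forall>\<^sub>F s in at_top. sgn (f S) * \<bar>f s\<bar> = f s"
      using eventually_ge_at_top[of S] by eventually_elim (metis sgn sgn_mult_abs)
    ultimately have "(f \<longlongrightarrow> sgn (f S) * sqrt q) at_top" by (rule Lim_transform_eventually)
    moreover have "(sgn (f S) * sqrt q)\<^sup>2 = q"
      using q0 S[of S] by (simp add: power_mult_distrib sgn_if)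
    ultimately show ?thesis by blast
  qed
qed

section \<open>The energy as a variance on the simplex of weights\<close>

context
  fixes a :: "3 \<Rightarrow> real" and b c :: real
  assumes a: "a 1 = 0" "a 2 = b" "a 3 = c" and bc: "0 < b" "b < c" "c < 2 * b"
begin

lemma norm_eq_1_vec3: "norm z = 1 \<longleftrightarrow> (z $ 1)\<^sup>2 + (z $ 2)\<^sup>2 + (z $ 3)\<^sup>2 = 1" for z :: "real^3"
  by (simp add: norm_eq_1 inner_vec_def sum_3 power2_eq_square)

lemma mean_diag_op: "z \<bullet> diag_op a z = b * (z $ 2)\<^sup>2 + c * (z $ 3)\<^sup>2"
  by (simp add: diag_op_def inner_vec_def sum_3 a power2_eq_square mult_ac)

lemma speed_diag_op: "speed (diag_op a) z = b\<^sup>2 * (z $ 2)\<^sup>2 + c\<^sup>2 * (z $ 3)\<^sup>2 - (b * (z $ 2)\<^sup>2 + c * (z $ 3)\<^sup>2)\<^sup>2"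
  unfolding speed_def mean_diag_op
  by (simp add: diag_op_def inner_vec_def sum_3 a power2_eq_square mult_ac)

text \<open>Each of the values 0, b, c is 0 or at least \<open>b\<close>, so the second moment is at
  least \<open>b\<close> times the mean. With mean b/2 the variance is at least b^2/2 -
  b^2/4.\<close>

lemma speed_ge_of_mean_eq:
  assumes "z \<bullet> diag_op a z = b / 2"
  shows "speed (diag_op a) z \<ge> b\<^sup>2 / 4"
proof -
  have e: "b * (z $ 2)\<^sup>2 + c * (z $ 3)\<^sup>2 = b / 2" using assms unfolding mean_diag_op .
  have "b * (b * (z $ 2)\<^sup>2 + c * (z $ 3)\<^sup>2) \<le> b\<^sup>2 * (z $ 2)\<^sup>2 + c\<^sup>2 * (z $ 3)\<^sup>2"
    using mult_right_mono[of b c "c * (z $ 3)\<^sup>2"] bc by (simp add: algebra_simps power2_eq_square)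
  then show ?thesis unfolding speed_diag_op e by (simp add: power2_eq_square)
qed

text \<open>Lagrange's condition: at a critical point (a_j - m)^2 has one and the same value on the
  support of \<open>z\<close>, where \<open>m\<close> is the mean. Three distinct weights cannot be
  equally far from \<open>m\<close>, so the support lies in an edge; the energy bound then excludes
  the vertices and the edge {2,3}.\<close>

lemma critical_diag_op:
  assumes z: "norm z = 1" and r: "grad_rhs (diag_op a) z = 0" and sp: "speed (diag_op a) z \<ge> b\<^sup>2 / 4"
  shows "(z $ 1)\<^sup>2 = 1/2 \<and> (z $ 2)\<^sup>2 = 1/2 \<and> z $ 3 = 0 \<and> speed (diag_op a) z = b\<^sup>2 / 4
    \<or> (z $ 1)\<^sup>2 = 1/2 \<and> z $ 2 = 0 \<and> (z $ 3)\<^sup>2 = 1/2 \<and> speed (diag_op a) z = c\<^sup>2 / 4"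
proof -
  define m where "m = z \<bullet> diag_op a z"
  define k where "k = shift (diag_op a) z z"
  define W where "W = z \<bullet> shift (diag_op a) z k"
  have zz: "z \<bullet> z = 1" using z by (simp add: norm_eq_1)
  have "z \<bullet> k = 0" by (simp add: k_def shift_def inner_diff_right zz)
  then have "tangential z (shift (diag_op a) z k) = 0"
    using r tangential_eq[OF z, of k] by (simp add: grad_rhs_def hess_def k_def)
  then have "shift (diag_op a) z k = W *\<^sub>R z" by (simp add: tangential_def zz W_def)
  then have eq: "(a j - m)\<^sup>2 * z $ j = W * z $ j" for j
    by (simp add: vec_eq_iff k_def shift_def diag_op_def m_def[unfolded diag_op_def, symmetric] power2_eq_square algebra_simps)
  have sum: "(z $ 1)\<^sup>2 + (z $ 2)\<^sup>2 + (z $ 3)\<^sup>2 = 1" using z norm_eq_1_vec3 by blast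
  have W: "z $ j \<noteq> 0 \<Longrightarrow> (a j - m)\<^sup>2 = W" for j using eq[of j] by simp
  consider "z $ 3 = 0" | "z $ 3 \<noteq> 0" "z $ 2 = 0" | "z $ 3 \<noteq> 0" "z $ 2 \<noteq> 0" "z $ 1 \<noteq> 0"
    | "z $ 3 \<noteq> 0" "z $ 2 \<noteq> 0" "z $ 1 = 0" by blast
  then show ?thesis
  proof cases
    case 1
    define p where "p = (z $ 2)\<^sup>2"
    have s: "speed (diag_op a) z = b\<^sup>2 * p - b\<^sup>2 * p\<^sup>2"
      unfolding speed_diag_op by (simp add: 1 p_def power_mult_distrib)
    \<comment> \<open>On the edge {1,2} the energy b^2 p (1 - p) has its maximum b^2/4 at the
      midpoint, so the lower bound on the energy forces p = 1/2.\<close>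
    then have "b\<^sup>2 * (p - 1/2)\<^sup>2 \<le> 0" using sp by (simp add: power2_eq_square algebra_simps)
    then have "(p - 1/2)\<^sup>2 \<le> 0" using bc by (simp add: mult_le_0_iff)
    then have p: "p = 1/2" by simp
    have "speed (diag_op a) z = b\<^sup>2 / 4" unfolding s p by (simp add: power2_eq_square)
    then show ?thesis using 1 sum p by (simp add: p_def)
  next
    case 2
    define p where "p = (z $ 3)\<^sup>2"
    have m: "m = c * p" unfolding m_def mean_diag_op by (simp add: 2 p_def)
    have s: "speed (diag_op a) z = c\<^sup>2 * p - c\<^sup>2 * p\<^sup>2"
      unfolding speed_diag_op by (simp add: 2 p_def power_mult_distrib)
    have "z $ 1 \<noteq> 0"
    proof
      assume "z $ 1 = 0"
      then have "p = 1" using sum 2 by (simp add: p_def)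
      then show False using s sp bc by simp
    qed
    then have "m\<^sup>2 = (c - m)\<^sup>2" using W[of 1] W[of 3] 2 a by simp
    then have "c * (c - 2 * m) = 0" by (auto simp: power2_eq_square algebra_simps)
    then have p: "p = 1/2" using bc m by simp
    have "speed (diag_op a) z = c\<^sup>2 / 4" unfolding s p by (simp add: power2_eq_square)
    then show ?thesis using 2 sum p by (simp add: p_def)
  next
    case 3
    have "m\<^sup>2 = (b - m)\<^sup>2" "m\<^sup>2 = (c - m)\<^sup>2" using W[of 1] W[of 2] W[of 3] 3 a by simp_all
    then have "b * (b - 2 * m) = 0" "c * (c - 2 * m) = 0"
      by (auto simp: power2_eq_square algebra_simps)
    then show ?thesis using bc by simp
  next
    case 4
    define p where "p = (z $ 3)\<^sup>2"
    have p2: "(z $ 2)\<^sup>2 = 1 - p" using sum 4 by (simp add: p_def)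
    have "speed (diag_op a) z = (c - b)\<^sup>2 * (p * (1 - p))"
      unfolding speed_diag_op p2 p_def[symmetric] by (simp add: power2_eq_square algebra_simps)
    also have "\<dots> \<le> (c - b)\<^sup>2 * (1/4)"
    proof (rule mult_left_mono)
      have "0 \<le> (p - 1/2)\<^sup>2" by simp
      then show "p * (1 - p) \<le> 1/4" by (simp add: power2_eq_square algebra_simps)
    qed simp
    \<comment> \<open>The edge {2,3} carries energies up to (c - b)^2/4; \<open>c < 2 * b\<close>
      places them below the required level.\<close>
    also have "\<dots> < b\<^sup>2 / 4" using bc power_strict_mono[of "c - b" b 2] by simp
    finally show ?thesis using sp by simp
  qed
qed

text \<open>Completing the square of the mean around c/2 leaves the deficit b (c - b) p, positive as
  soon as the second weight p is. The bound keeps forward limits of interior points below the level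
  of the second midpoint.\<close>

lemma speed_less_max:
  assumes z: "norm z = 1" and "z $ 2 \<noteq> 0"
  shows "speed (diag_op a) z < c\<^sup>2 / 4"
proof -
  define p q where "p = (z $ 2)\<^sup>2" and "q = (z $ 3)\<^sup>2"
  have "p > 0" using assms by (simp add: p_def)
  then have "b * (c - b) * p > 0" using bc by simp
  moreover have "0 \<le> (b * p + c * q - c / 2)\<^sup>2" by simp
  moreover have "speed (diag_op a) z = c\<^sup>2 / 4 - b * (c - b) * p - (b * p + c * q - c / 2)\<^sup>2"
    unfolding speed_diag_op p_def[symmetric] q_def[symmetric] by (simp add: power2_eq_square algebra_simps)
  ultimately show ?thesis by linarith
qed

lemma connecting_orbit:
  "\<exists>z w1 w2. (\<forall>s. norm (z s) = 1 \<and> (z has_vector_derivative - gradfield (diag_op a) (z s)) (at s)) \<and>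
    (z \<longlongrightarrow> w1) at_top \<and> (w1 $ 1)\<^sup>2 = 1/2 \<and> (w1 $ 2)\<^sup>2 = 1/2 \<and> w1 $ 3 = 0 \<and>
    (z \<longlongrightarrow> w2) at_bot \<and> (w2 $ 1)\<^sup>2 = 1/2 \<and> w2 $ 2 = 0 \<and> (w2 $ 3)\<^sup>2 = 1/2"
proof -
  interpret symmetric_operator "diag_op a" by (rule symmetric_operator_diag_op)
  obtain \<phi> where *: "(\<forall>z. \<phi> z 0 = z) \<and> (\<forall>s. continuous_on UNIV (\<lambda>z. \<phi> z s)) \<and>
     (\<forall>z s t. \<phi> (\<phi> z s) t = \<phi> z (s + t)) \<and>
     (\<forall>z s. norm z = 1 \<longrightarrow> norm (\<phi> z s) = 1 \<and>
        (\<phi> z has_vector_derivative - gradfield (diag_op a) (\<phi> z s)) (at s))"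
    using gradient_flow_ex by (elim exE)
  have \<phi>: "gradient_flow (diag_op a) \<phi>"
    by (intro gradient_flow.intro gradient_flow_axioms.intro symmetric_operator_axioms) (use * in blast)+
  interpret gradient_flow "diag_op a" \<phi> by (rule \<phi>)
  let ?V = "speed (diag_op a)"
  \<comment> \<open>The bump t (1 - t) makes all three coordinates nonzero except at t = 0 and t =
    1, where \<open>v\<close> is the first and the second basis vector. The parameter runs over the
    whole real line, whose connectedness is used below.\<close>
  define v where "v = (\<lambda>t::real. (1 - t) *\<^sub>R axis 1 1 + t *\<^sub>R axis 2 1 + (t * (1 - t)) *\<^sub>R axis 3 (1::real) :: real^3)"
  have v: "v t $ 1 = 1 - t" "v t $ 2 = t" "v t $ 3 = t * (1 - t)" for t
    by (simp_all add: v_def axis_def)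
  have v0: "v t \<noteq> 0" for t
  proof
    assume "v t = 0"
    then have "v t $ 1 = 0" "v t $ 2 = 0" by simp_all
    then show False by (simp add: v)
  qed
  define \<zeta> where "\<zeta> = (\<lambda>t. v t /\<^sub>R norm (v t))"
  have \<zeta>1: "norm (\<zeta> t) = 1" for t using v0[of t] by (simp add: \<zeta>_def)
  have \<zeta>c: "continuous_on UNIV \<zeta>"
  proof -
    have "continuous_on UNIV v" unfolding v_def by (intro continuous_intros)
    then show ?thesis unfolding \<zeta>_def by (intro continuous_intros) (simp_all add: v0)
  qed
  define low where "low = {w. ?V w < b\<^sup>2 / 4 \<and> w \<bullet> diag_op a w < b / 2}"
  define high where "high = {w. ?V w < b\<^sup>2 / 4 \<and> w \<bullet> diag_op a w > b / 2}"
  have mc: "continuous_on UNIV (\<lambda>w. w \<bullet> diag_op a w)" by (intro continuous_intros continuous_on_D)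
  have olow: "open low" and ohigh: "open high"
    unfolding low_def high_def Collect_conj_eq
    by (intro open_Int open_Collect_less continuous_on_speed mc continuous_on_const)+
  define U where "U = (\<lambda>B. \<Union>s\<in>{0..}. {t. \<phi> (\<zeta> t) s \<in> B})"
  have oU: "open (U B)" if "open B" for B
  proof -
    have "open ((\<lambda>t. \<phi> (\<zeta> t) s) -` B)" for s
      by (intro open_vimage that continuous_on_compose2[OF continuous_on_flow \<zeta>c]) auto
    then show ?thesis unfolding U_def vimage_def by (intro open_UN) simp
  qed
  have below: "?V (\<phi> w t) < b\<^sup>2 / 4" if "norm w = 1" "?V (\<phi> w s) < b\<^sup>2 / 4" "s \<le> t" for w s t
    using speed_flow_antimono[OF that(1,3)] that(2) by linarith
  have flow_cont: "continuous_on S (\<phi> w)" if "norm w = 1" for w S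
    using flow_has_derivative[OF that]
    by (intro continuous_at_imp_continuous_on ballI) (rule has_vector_derivative_continuous)
  have "U low \<inter> U high = {}"
  proof (rule ccontr)
    assume "U low \<inter> U high \<noteq> {}"
    then obtain t s s' where s: "s \<ge> 0" "\<phi> (\<zeta> t) s \<in> low" and s': "s' \<ge> 0" "\<phi> (\<zeta> t) s' \<in> high"
      by (auto simp: U_def)
    let ?m = "\<lambda>s. \<phi> (\<zeta> t) s \<bullet> diag_op a (\<phi> (\<zeta> t) s)"
    have mcont: "continuous_on S ?m" for S
      by (rule continuous_on_compose2[OF mc flow_cont[OF \<zeta>1]]) auto
    \<comment> \<open>The mean takes the value b/2 between the two times, hence after the earlier
      one, when the energy is already too small for the wall.\<close>
    have "\<exists>x\<ge>min s s'. ?m x = b / 2"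
    proof (cases "s \<le> s'")
      case True
      have "\<exists>x. s \<le> x \<and> x \<le> s' \<and> ?m x = b / 2"
        using s s' True by (intro IVT'[OF _ _ _ mcont]) (auto simp: low_def high_def)
      then show ?thesis by auto
    next
      case False
      have "\<exists>x. s' \<le> x \<and> x \<le> s \<and> ?m x = b / 2"
        using s s' False by (intro IVT2'[OF _ _ _ mcont]) (auto simp: low_def high_def)
      then show ?thesis by auto
    qed
    then obtain x where x: "x \<ge> min s s'" "?m x = b / 2" by blast
    have "?V (\<phi> (\<zeta> t) (min s s')) < b\<^sup>2 / 4"
      using s(2) s'(2) by (auto simp: low_def high_def min_def)
    from below[OF \<zeta>1 this x(1)] speed_ge_of_mean_eq[OF x(2)] show False by simp
  qed
  moreover have "0 \<in> U low"
  proof -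
    have "\<zeta> 0 $ 2 = 0" "\<zeta> 0 $ 3 = 0" by (simp_all add: \<zeta>_def v)
    then have "\<phi> (\<zeta> 0) 0 \<in> low" using bc by (simp add: flow_0 low_def speed_diag_op mean_diag_op)
    then show ?thesis unfolding U_def by force
  qed
  moreover have "1 \<in> U high"
  proof -
    have 1: "\<zeta> 1 $ 1 = 0" "\<zeta> 1 $ 3 = 0" by (simp_all add: \<zeta>_def v)
    then have "(\<zeta> 1 $ 2)\<^sup>2 = 1" using \<zeta>1[of 1] norm_eq_1_vec3[of "\<zeta> 1"] by simp
    then have "\<phi> (\<zeta> 1) 0 \<in> high" using bc 1 by (simp add: flow_0 high_def speed_diag_op mean_diag_op)
    then show ?thesis unfolding U_def by force
  qed
  moreover have "connected (UNIV :: real set)" by simp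
  ultimately have "U low \<union> U high \<noteq> UNIV"
    unfolding connected_def using oU[OF olow] oU[OF ohigh] by blast
  then obtain t where t: "t \<notin> U low" "t \<notin> U high" by blast
  define z0 where "z0 = \<zeta> t"
  have z0: "norm z0 = 1" by (simp add: z0_def \<zeta>1)
  have "t \<noteq> 0" "t \<noteq> 1" using t \<open>0 \<in> U low\<close> \<open>1 \<in> U high\<close> by auto
  then have z023: "z0 $ 2 \<noteq> 0" "z0 $ 3 \<noteq> 0" using v0[of t] by (auto simp: z0_def \<zeta>_def v)
  have Vge: "?V (\<phi> z0 s) \<ge> b\<^sup>2 / 4" if "s \<ge> 0" for s
  proof (rule ccontr)
    assume less: "\<not> ?V (\<phi> z0 s) \<ge> b\<^sup>2 / 4"
    then have "\<phi> z0 s \<bullet> diag_op a (\<phi> z0 s) \<noteq> b / 2" using speed_ge_of_mean_eq by blast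
    with less have "\<phi> z0 s \<in> low \<union> high" by (auto simp: low_def high_def)
    then show False using t that by (auto simp: U_def z0_def)
  qed
  have Vge0: "?V z0 \<ge> b\<^sup>2 / 4" using Vge[of 0] by (simp add: flow_0)
  \<comment> \<open>A critical point with at least this energy has a vanishing second or third
    coordinate.\<close>
  have not_crit: "grad_rhs (diag_op a) z0 \<noteq> 0" using critical_diag_op[OF z0 _ Vge0] z023 by auto
  have conv: "\<exists>w. ((\<lambda>s. \<phi> z0 (\<sigma> * s)) \<longlongrightarrow> w) at_top \<and> (\<forall>j. (w $ j)\<^sup>2 = q j)"
    if sg: "\<sigma> = 1 \<or> \<sigma> = -1" and L: "((\<lambda>s. ?V (\<phi> z0 (\<sigma> * s))) \<longlongrightarrow> L) at_top"
      and crit: "\<And>w j. norm w = 1 \<Longrightarrow> ?V w = L \<Longrightarrow> grad_rhs (diag_op a) w = 0 \<Longrightarrow> (w $ j)\<^sup>2 = q j" for \<sigma> L q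
  proof -
    have sc: "continuous_on UNIV (\<lambda>s. \<phi> z0 (\<sigma> * s))"
      by (rule continuous_on_compose2[OF flow_cont[OF z0, of UNIV]]) (auto intro: continuous_intros)
    have "\<exists>y. y\<^sup>2 = q j \<and> ((\<lambda>s. \<phi> z0 (\<sigma> * s) $ j) \<longlongrightarrow> y) at_top" for j
    proof (rule tendsto_of_power2_tendsto)
      show "continuous_on UNIV (\<lambda>s. \<phi> z0 (\<sigma> * s) $ j)" by (intro continuous_intros sc)
      show "((\<lambda>s. (\<phi> z0 (\<sigma> * s) $ j)\<^sup>2) \<longlongrightarrow> q j) at_top"
        by (rule flow_observable_tendsto[OF z0 sg _ L, where g = "\<lambda>w. (w $ j)\<^sup>2"])
          (intro continuous_intros crit; assumption)+
    qed
    then obtain y where y: "\<And>j. (y j)\<^sup>2 = q j" "\<And>j. ((\<lambda>s. \<phi> z0 (\<sigma> * s) $ j) \<longlongrightarrow> y j) at_top" by metis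
    have "((\<lambda>s. \<phi> z0 (\<sigma> * s)) \<longlongrightarrow> (\<chi> j. y j)) at_top"
      by (rule vec_tendstoI) (simp add: y)
    then show ?thesis using y(1) by (intro exI[of _ "\<chi> j. y j"]) simp
  qed
  obtain L where L: "((\<lambda>s. ?V (\<phi> z0 (1 * s))) \<longlongrightarrow> L) at_top"
    using speed_flow_tendsto[OF z0, of 1] by blast
  have Lge: "L \<ge> b\<^sup>2 / 4"
    by (rule tendsto_lowerbound[OF L]) (use Vge in \<open>auto simp: eventually_at_top_linorder\<close>)
  have "L \<le> ?V z0"
  proof (rule tendsto_upperbound[OF L])
    show "\<forall>\<^sub>F s in at_top. ?V (\<phi> z0 (1 * s)) \<le> ?V z0"
      using speed_flow_antimono[OF z0, of 0] by (auto simp: flow_0 eventually_at_top_linorder)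
  qed simp
  then have Lless: "L < c\<^sup>2 / 4" using speed_less_max[OF z0 z023(1)] by simp
  have "\<exists>w. ((\<lambda>s. \<phi> z0 (1 * s)) \<longlongrightarrow> w) at_top \<and> (\<forall>j. (w $ j)\<^sup>2 = (if j = 3 then 0 else 1 / 2))"
  proof (rule conv[OF _ L])
    fix w and j :: 3 assume w: "norm w = 1" "?V w = L" "grad_rhs (diag_op a) w = 0"
    show "(w $ j)\<^sup>2 = (if j = 3 then 0 else 1 / 2)"
      using critical_diag_op[OF w(1,3)] w(2) Lge Lless exhaust_3[of j] by auto
  qed simp
  then obtain w1 where w1: "(\<phi> z0 \<longlongrightarrow> w1) at_top" "\<And>j. (w1 $ j)\<^sup>2 = (if j = 3 then 0 else 1 / 2)" by auto
  obtain L' where L': "((\<lambda>s. ?V (\<phi> z0 (-1 * s))) \<longlongrightarrow> L') at_top"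
    using speed_flow_tendsto[OF z0, of "-1"] by blast
  have L'up: "?V (\<phi> z0 (- s)) \<le> L'" if "s \<ge> 0" for s
  proof (rule tendsto_lowerbound[OF L'])
    show "\<forall>\<^sub>F x in at_top. ?V (\<phi> z0 (- s)) \<le> ?V (\<phi> z0 (-1 * x))"
      using eventually_ge_at_top[of s] by eventually_elim (simp add: speed_flow_antimono[OF z0])
  qed simp
  \<comment> \<open>Otherwise monotonicity squeezes the energy to b^2/4 for all time, since it is at
    least b^2/4 forwards and would be at most b^2/4 backwards. Then \<open>z0\<close> would be
    critical.\<close>
  have L'gt: "L' > b\<^sup>2 / 4"
  proof (rule ccontr)
    assume "\<not> L' > b\<^sup>2 / 4"
    then have le: "?V (\<phi> z0 s) \<le> b\<^sup>2 / 4" if "s \<le> 0" for s using L'up[of "- s"] that by simp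
    have "?V (\<phi> z0 s) = ?V z0" for s
    proof (cases "s \<ge> 0")
      case True
      then show ?thesis using Vge[of s] speed_flow_antimono[OF z0, of 0 s] le[of 0] Vge0 by (simp add: flow_0)
    next
      case False
      then show ?thesis using le[of s] speed_flow_antimono[OF z0, of s 0] le[of 0] Vge0 by (simp add: flow_0)
    qed
    then show False using speed_constant_imp_critical[OF z0] not_crit by blast
  qed
  have "\<exists>w. ((\<lambda>s. \<phi> z0 (-1 * s)) \<longlongrightarrow> w) at_top \<and> (\<forall>j. (w $ j)\<^sup>2 = (if j = 2 then 0 else 1 / 2))"
  proof (rule conv[OF _ L'])
    fix w and j :: 3 assume w: "norm w = 1" "?V w = L'" "grad_rhs (diag_op a) w = 0"
    show "(w $ j)\<^sup>2 = (if j = 2 then 0 else 1 / 2)"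
      using critical_diag_op[OF w(1,3)] w(2) L'gt exhaust_3[of j] by auto
  qed simp
  then obtain w2 where w2: "((\<lambda>s. \<phi> z0 (- s)) \<longlongrightarrow> w2) at_top" "\<And>j. (w2 $ j)\<^sup>2 = (if j = 2 then 0 else 1 / 2)" by auto
  have "(\<phi> z0 \<longlongrightarrow> w2) at_bot"
    using w2(1) by (simp add: filterlim_at_bot_mirror)
  moreover have "norm (\<phi> z0 s) = 1 \<and> (\<phi> z0 has_vector_derivative - gradfield (diag_op a) (\<phi> z0 s)) (at s)" for s
    using norm_flow[OF z0] flow_has_derivative[OF z0] by blast
  ultimately show ?thesis
    using w1(1) w1(2)[of 1] w1(2)[of 2] w1(2)[of 3] w2(2)[of 1] w2(2)[of 2] w2(2)[of 3]
    by - (rule exI[of _ "\<phi> z0"], rule exI[of _ w1], rule exI[of _ w2], simp)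
qed

end

section \<open>Equivariant loops in projective space\<close>

text \<open>Conjugation of a projection matrix by the diagonal unitary matrix with phases t
  \<alpha>_j; an entry sees only the difference of two weights. Its generator \<open>ad_diag\<close>
  is the commutator with i diag(\<alpha>).\<close>

definition conj_diag :: "('d::finite \<Rightarrow> real) \<Rightarrow> real \<Rightarrow> complex^'d^'d \<Rightarrow> complex^'d^'d"
  where "conj_diag \<alpha> t M = (\<chi> i j. cis (t * (\<alpha> i - \<alpha> j)) * M $ i $ j)"

definition ad_diag :: "('d::finite \<Rightarrow> real) \<Rightarrow> complex^'d^'d \<Rightarrow> complex^'d^'d"
  where "ad_diag \<alpha> M = (\<chi> i j. \<i> * of_real (\<alpha> i - \<alpha> j) * M $ i $ j)"

definition skew_diag :: "('d::finite \<Rightarrow> real) \<Rightarrow> complex^'d \<Rightarrow> complex^'d"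
  where "skew_diag \<alpha> v = (\<chi> j. \<i> * of_real (\<alpha> j) * v $ j)"

lemma linear_conj_diag: "linear (conj_diag \<alpha> t)"
  by (rule linearI) (simp_all add: conj_diag_def vec_eq_iff algebra_simps)

lemma linear_ad_diag: "linear (ad_diag \<alpha>)"
  by (rule linearI) (simp_all add: ad_diag_def vec_eq_iff algebra_simps)

lemma bounded_linear_conj_diag: "bounded_linear (conj_diag \<alpha> t)"
  by (simp add: linear_conj_diag linear_conv_bounded_linear[symmetric])

lemma bounded_linear_ad_diag: "bounded_linear (ad_diag \<alpha>)"
  by (simp add: linear_ad_diag linear_conv_bounded_linear[symmetric])

lemma cis_mult_inner: "(cis \<theta> * x) \<bullet> (cis \<theta> * y) = x \<bullet> y"
proof -
  have "(cis \<theta> * x) \<bullet> (cis \<theta> * y) = ((cos \<theta>)\<^sup>2 + (sin \<theta>)\<^sup>2) * (x \<bullet> y)"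
    unfolding inner_complex_def power2_eq_square
    by (simp add: algebra_simps del: sin_cos_squared_add3)
  then show ?thesis by simp
qed

lemma conj_diag_inner: "conj_diag \<alpha> t M \<bullet> conj_diag \<alpha> t N = M \<bullet> N"
  by (simp add: conj_diag_def inner_vec_def cis_mult_inner)

lemma norm_conj_diag: "norm (conj_diag \<alpha> t M) = norm M"
  by (simp add: norm_eq_sqrt_inner conj_diag_inner)

lemma conj_diag_conj_diag: "conj_diag \<alpha> s (conj_diag \<alpha> t M) = conj_diag \<alpha> (s + t) M"
proof -
  have "cis (s * r) * (cis (t * r) * m) = cis ((s + t) * r) * m" for r m
    by (simp only: mult.assoc[symmetric] cis_mult distrib_right)
  then show ?thesis by (simp add: conj_diag_def vec_eq_iff)
qed

lemma conj_diag_0: "conj_diag \<alpha> 0 M = M"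
  by (simp add: conj_diag_def vec_eq_iff)

lemma has_vector_derivative_componentwise:
  fixes f :: "real \<Rightarrow> 'a::euclidean_space^'n"
  assumes "\<And>i. ((\<lambda>t. f t $ i) has_vector_derivative f' $ i) (at t)"
  shows "(f has_vector_derivative f') (at t)"
  unfolding has_vector_derivative_def has_derivative_within
proof
  show "((\<lambda>y. (1 / norm (y - t)) *\<^sub>R (f y - (f t + (y - t) *\<^sub>R f'))) \<longlongrightarrow> 0) (at t)"
    using assms unfolding has_vector_derivative_def has_derivative_within
    by (intro vec_tendstoI) simp
qed (rule bounded_linear_scaleR_left)

lemma conj_diag_has_vector_derivative:
  "((\<lambda>t. conj_diag \<alpha> t M) has_vector_derivative conj_diag \<alpha> t (ad_diag \<alpha> M)) (at t)"
proof -
  have c: "((\<lambda>t. cis (t * r)) has_vector_derivative \<i> * of_real r * cis (t * r)) (at t)" for r t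
  proof -
    have "((\<lambda>w. exp (\<i> * (w * of_real r))) has_field_derivative
        \<i> * of_real r * exp (\<i> * (of_real t * of_real r))) (at (of_real t))"
      by (auto intro!: derivative_eq_intros)
    from has_vector_derivative_real_field[OF this] show ?thesis by (simp add: cis_conv_exp)
  qed
  have "((\<lambda>t. cis (t * r) * m) has_vector_derivative cis (t * r) * (\<i> * of_real r * m)) (at t)" for r m
    using has_vector_derivative_mult_left[OF c[of r t], of m] by (simp add: mult_ac)
  then show ?thesis
    by (intro has_vector_derivative_componentwise) (simp add: conj_diag_def ad_diag_def del: of_real_diff)
qed

lemma vector_derivative_conj_diag: "vector_derivative (\<lambda>t. conj_diag \<alpha> t M) (at t) = conj_diag \<alpha> t (ad_diag \<alpha> M)"
  by (rule vector_derivative_at[OF conj_diag_has_vector_derivative])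

lemma continuous_on_conj_diag: "continuous_on S (\<lambda>t. conj_diag \<alpha> t M)"
  by (intro continuous_at_imp_continuous_on ballI)
    (rule has_vector_derivative_continuous[OF conj_diag_has_vector_derivative])

lemma conj_diag_outer: "conj_diag \<alpha> t (outer u v) = outer (\<chi> j. cis (t * \<alpha> j) * u $ j) (\<chi> j. cis (t * \<alpha> j) * v $ j)"
proof -
  have "cis (t * (\<alpha> i - \<alpha> j)) = cis (t * \<alpha> i) * cnj (cis (t * \<alpha> j))" for i j
    by (simp add: cis_cnj cis_mult right_diff_distrib)
  then show ?thesis by (simp add: conj_diag_def outer_def vec_eq_iff)
qed

lemma CP_unit: "p \<in> CP \<longleftrightarrow> (\<exists>z. norm z = 1 \<and> p = outer z z)"
proof
  assume "p \<in> CP"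
  then obtain z where z: "z \<noteq> 0" "p = cproj z" by (auto simp: CP_def)
  let ?w = "z /\<^sub>R norm z"
  have "outer ?w ?w = outer z z /\<^sub>R (norm z)\<^sup>2"
    by (simp add: outer_def vec_eq_iff power2_eq_square divide_inverse)
  then have "p = outer ?w ?w" using z by (simp add: cproj_outer)
  then show "\<exists>z. norm z = 1 \<and> p = outer z z" using z by (intro exI[of _ ?w]) simp
next
  assume "\<exists>z. norm z = 1 \<and> p = outer z z"
  then obtain z where z: "norm z = 1" "p = outer z z" by blast
  then have "p = cproj z" "z \<noteq> 0" by (auto simp: cproj_outer)
  then show "p \<in> CP" by (auto simp: CP_def)
qed

lemma conj_diag_CP: "p \<in> CP \<Longrightarrow> conj_diag \<alpha> t p \<in> CP"
proof -
  assume "p \<in> CP"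
  then obtain z where z: "norm z = 1" "p = outer z z" by (auto simp: CP_unit)
  moreover have "norm (\<chi> j. cis (t * \<alpha> j) * z $ j) = norm z"
    by (simp add: norm_vec_def norm_mult)
  ultimately show ?thesis unfolding CP_unit
    by (intro exI[of _ "\<chi> j. cis (t * \<alpha> j) * z $ j"]) (simp add: conj_diag_outer)
qed

lemma conj_diag_tangent_CP: "X \<in> tangent_CP p \<Longrightarrow> conj_diag \<alpha> t X \<in> tangent_CP (conj_diag \<alpha> t p)"
proof -
  assume "X \<in> tangent_CP p"
  then obtain c where c: "\<And>s. c s \<in> CP" "c 0 = p" "(c has_vector_derivative X) (at 0)"
    unfolding tangent_CP_def by blast
  have "((\<lambda>s. conj_diag \<alpha> t (c s)) has_vector_derivative conj_diag \<alpha> t X) (at 0)"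
    by (rule bounded_linear.has_vector_derivative[OF bounded_linear_conj_diag c(3)])
  then show ?thesis unfolding tangent_CP_def using c conj_diag_CP
    by (intro CollectI exI[of _ "\<lambda>s. conj_diag \<alpha> t (c s)"]) auto
qed

lemma tangent_CP_conj_diagE:
  assumes "Y \<in> tangent_CP (conj_diag \<alpha> t p)"
  obtains X where "X \<in> tangent_CP p" "Y = conj_diag \<alpha> t X"
proof
  show "conj_diag \<alpha> (- t) Y \<in> tangent_CP p"
    using conj_diag_tangent_CP[OF assms, of \<alpha> "- t"] by (simp add: conj_diag_conj_diag conj_diag_0)
  show "Y = conj_diag \<alpha> t (conj_diag \<alpha> (- t) Y)" by (simp add: conj_diag_conj_diag conj_diag_0)
qed

section \<open>Covariant derivatives and gradients along translated fields\<close>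

lemma closest_point_subspaceI:
  fixes S :: "'a::euclidean_space set"
  assumes S: "subspace S" and Z: "Z \<in> S" and orth: "\<And>Y. Y \<in> S \<Longrightarrow> (X - Z) \<bullet> Y = 0"
  shows "closest_point S X = Z"
proof (rule closest_point_unique[symmetric])
  show "\<forall>Y\<in>S. dist X Z \<le> dist X Y"
  proof
    fix Y assume Y: "Y \<in> S"
    have "(X - Z) \<bullet> (Z - Y) = 0" by (rule orth) (rule subspace_diff[OF S Z Y])
    then have "(norm (X - Y))\<^sup>2 = (norm (X - Z))\<^sup>2 + (norm (Z - Y))\<^sup>2"
      using norm_add_Pythagorean[of "X - Z" "Z - Y"] by (simp add: orthogonal_def)
    then have "(norm (X - Z))\<^sup>2 \<le> (norm (X - Y))\<^sup>2" by simp
    then show "dist X Z \<le> dist X Y" unfolding dist_norm by (rule power2_le_imp_le) simp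
  qed
qed (use S Z in \<open>auto simp: closed_subspace subspace_imp_convex\<close>)

lemma closest_point_subspace_orth:
  fixes S :: "'a::euclidean_space set"
  assumes S: "subspace S" and Y: "Y \<in> S"
  shows "(X - closest_point S X) \<bullet> Y = 0"
proof -
  obtain y z where yz: "y \<in> span S" "\<And>w. w \<in> span S \<Longrightarrow> orthogonal z w" "X = y + z"
    using orthogonal_subspace_decomp_exists[of S X] by metis
  have "span S = S" using S by (simp add: span_eq_iff)
  with yz have "closest_point S X = y"
    by (intro closest_point_subspaceI[OF S]) (auto simp: orthogonal_def)
  then show ?thesis using yz \<open>span S = S\<close> Y by (simp add: orthogonal_def)
qed

definition cov_diag :: "('d::finite \<Rightarrow> real) \<Rightarrow> complex^'d^'d \<Rightarrow> complex^'d^'d \<Rightarrow> complex^'d^'d"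
  where "cov_diag \<alpha> p X = closest_point (tangent_CP p) (ad_diag \<alpha> X)"

lemma cov_diag_tangent: "p \<in> CP \<Longrightarrow> cov_diag \<alpha> p X \<in> tangent_CP p"
  unfolding cov_diag_def
  using subspace_tangent_CP[of p] subspace_0 by (intro closest_point_in_set closed_subspace) blast+

text \<open>Conjugation is a Euclidean isometry that carries tangent spaces to tangent spaces, so it
  commutes with orthogonal projection onto them. Covariant differentiation of a translated field is
  therefore governed by the single map \<open>cov_diag\<close> at time 0.\<close>

lemma covd_conj_diag:
  assumes p: "p \<in> CP"
  shows "covd (\<lambda>t. conj_diag \<alpha> t p) (\<lambda>t. conj_diag \<alpha> t X) t = conj_diag \<alpha> t (cov_diag \<alpha> p X)"
  unfolding covd_def vector_derivative_conj_diag
proof (rule closest_point_subspaceI)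
  show "subspace (tangent_CP (conj_diag \<alpha> t p))" by (intro subspace_tangent_CP conj_diag_CP p)
  show "conj_diag \<alpha> t (cov_diag \<alpha> p X) \<in> tangent_CP (conj_diag \<alpha> t p)" by (intro conj_diag_tangent_CP cov_diag_tangent p)
  fix Y assume "Y \<in> tangent_CP (conj_diag \<alpha> t p)"
  then obtain Z where Z: "Z \<in> tangent_CP p" "Y = conj_diag \<alpha> t Z" by (rule tangent_CP_conj_diagE)
  have "(conj_diag \<alpha> t (ad_diag \<alpha> X) - conj_diag \<alpha> t (cov_diag \<alpha> p X)) \<bullet> Y = (ad_diag \<alpha> X - cov_diag \<alpha> p X) \<bullet> Z"
    by (simp add: Z linear_diff[OF linear_conj_diag, symmetric] conj_diag_inner)
  then show "(conj_diag \<alpha> t (ad_diag \<alpha> X) - conj_diag \<alpha> t (cov_diag \<alpha> p X)) \<bullet> Y = 0"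
    unfolding cov_diag_def using closest_point_subspace_orth[OF subspace_tangent_CP[OF p] Z(1)] by simp
qed

context
  fixes \<alpha> :: "'d::finite \<Rightarrow> real"
  assumes integral_weights: "\<And>j. \<exists>k::int. \<alpha> j = 2 * pi * of_int k"
begin

lemma conj_diag_periodic: "conj_diag \<alpha> (t + 1) M = conj_diag \<alpha> t M"
proof -
  have "cis ((t + 1) * (\<alpha> i - \<alpha> j)) = cis (t * (\<alpha> i - \<alpha> j))" for i j
  proof -
    obtain k l :: int where k: "\<alpha> i = 2 * pi * of_int k" "\<alpha> j = 2 * pi * of_int l"
      using integral_weights by metis
    have e: "(t + 1) * (\<alpha> i - \<alpha> j) = t * (\<alpha> i - \<alpha> j) + 2 * pi * of_int (k - l)"
      unfolding k by (simp add: algebra_simps)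
    show ?thesis unfolding e cis_mult[symmetric] by (simp add: cis_multiple_2pi del: of_int_diff)
  qed
  then show ?thesis by (simp add: conj_diag_def)
qed

lemma conj_diag_H1: "(\<lambda>t. conj_diag \<alpha> t M) \<in> H1"
  by (rule H1_C1[OF conj_diag_periodic conj_diag_has_vector_derivative continuous_on_conj_diag])

lemma conj_diag_LCP: "p \<in> CP \<Longrightarrow> (\<lambda>t. conj_diag \<alpha> t p) \<in> LCP"
  using conj_diag_H1 conj_diag_CP by (auto simp: LCP_def)

text \<open>On translates of a matrix the integrand is constant in time, and the H1 norm becomes a
  norm on matrices. Limits and derivatives of such loops thus reduce to finite-dimensional
  ones.\<close>

lemma H1_norm_conj_diag: "H1_norm (\<lambda>t. conj_diag \<alpha> t M) = sqrt ((norm M)\<^sup>2 + (norm (ad_diag \<alpha> M))\<^sup>2)"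
  by (simp add: H1_norm_def vector_derivative_conj_diag norm_conj_diag)

lemma H1_norm_conj_diag_tendsto_0:
  assumes "(M \<longlongrightarrow> 0) F"
  shows "((\<lambda>s. H1_norm (\<lambda>t. conj_diag \<alpha> t (M s))) \<longlongrightarrow> 0) F"
proof -
  have "((\<lambda>s. ad_diag \<alpha> (M s)) \<longlongrightarrow> ad_diag \<alpha> 0) F"
    by (rule bounded_linear.tendsto[OF bounded_linear_ad_diag assms])
  then have d: "((\<lambda>s. ad_diag \<alpha> (M s)) \<longlongrightarrow> 0) F" by (simp add: linear_0[OF linear_ad_diag])
  have "((\<lambda>s. sqrt ((norm (M s))\<^sup>2 + (norm (ad_diag \<alpha> (M s)))\<^sup>2)) \<longlongrightarrow> sqrt ((norm (0::complex^'d^'d))\<^sup>2 + (norm (0::complex^'d^'d))\<^sup>2)) F"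
    by (intro tendsto_intros assms d)
  then show ?thesis by (simp add: H1_norm_conj_diag)
qed

lemma H1_tendsto_conj_diag:
  assumes "(P \<longlongrightarrow> p) F"
  shows "H1_tendsto (\<lambda>s t. conj_diag \<alpha> t (P s)) (\<lambda>t. conj_diag \<alpha> t p) F"
proof -
  have "((\<lambda>s. P s - p) \<longlongrightarrow> 0) F" using assms by (simp add: Lim_null[symmetric])
  from H1_norm_conj_diag_tendsto_0[OF this] show ?thesis
    by (simp add: H1_tendsto_def linear_diff[OF linear_conj_diag])
qed

lemma H1_has_derivative_conj_diag:
  assumes "(P has_vector_derivative X) (at s)"
  shows "H1_has_derivative (\<lambda>s t. conj_diag \<alpha> t (P s)) (\<lambda>t. conj_diag \<alpha> t X) s"
proof -
  have "((\<lambda>h. norm ((P (s + h) - P s) /\<^sub>R h - X)) \<longlongrightarrow> 0) (at 0)"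
  proof (rule Lim_transform_eventually)
    show "((\<lambda>h. norm (P (s + h) - P s - h *\<^sub>R X) / norm h) \<longlongrightarrow> 0) (at 0)"
      using assms unfolding has_vector_derivative_def has_derivative_at by blast
    show "\<forall>\<^sub>F h in at 0. norm (P (s + h) - P s - h *\<^sub>R X) / norm h = norm ((P (s + h) - P s) /\<^sub>R h - X)"
      unfolding eventually_at_filter
    proof (intro always_eventually allI impI)
      fix h :: real assume h: "h \<noteq> 0"
      have "(P (s + h) - P s) /\<^sub>R h - X = (P (s + h) - P s - h *\<^sub>R X) /\<^sub>R h"
        using h by (simp add: scaleR_diff_right)
      then show "norm (P (s + h) - P s - h *\<^sub>R X) / norm h = norm ((P (s + h) - P s) /\<^sub>R h - X)"
        by (simp only: norm_scaleR) (simp add: divide_inverse mult.commute)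
    qed
  qed
  then have "((\<lambda>h. (P (s + h) - P s) /\<^sub>R h - X) \<longlongrightarrow> 0) (at 0)"
    by (rule tendsto_norm_zero_cancel)
  from H1_norm_conj_diag_tendsto_0[OF this] show ?thesis
    by (simp add: H1_has_derivative_def linear_diff[OF linear_conj_diag] linear_scale[OF linear_conj_diag])
qed

text \<open>The assumption \<open>eq\<close> is X - nabla nabla X + 2 nabla gamma' = 0 at time 0,
  tested on tangent vectors. Each value of a test field is the translate of a tangent vector at
  \<open>p\<close>, and integration by parts moves the derivative off the test field, so the
  equation at time 0 suffices.\<close>

lemma energy_gradient_conj_diag:
  assumes p: "p \<in> CP" and X: "X \<in> tangent_CP p"
    and eq: "\<And>Y. Y \<in> tangent_CP p \<Longrightarrow> (X - ad_diag \<alpha> (cov_diag \<alpha> p X) + 2 *\<^sub>R ad_diag \<alpha> (ad_diag \<alpha> p)) \<bullet> Y = 0"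
  shows "is_energy_gradient (\<lambda>t. conj_diag \<alpha> t p) (\<lambda>t. conj_diag \<alpha> t X)"
  unfolding is_energy_gradient_def
proof (intro conjI allI impI)
  show "(\<lambda>t. conj_diag \<alpha> t X) \<in> tangent_LCP (\<lambda>t. conj_diag \<alpha> t p)"
    using X by (simp add: tangent_LCP_def conj_diag_H1 conj_diag_tangent_CP)
next
  fix c \<eta>
  assume c: "\<forall>s. c s \<in> LCP" "c 0 = (\<lambda>t. conj_diag \<alpha> t p)" and \<eta>: "\<eta> \<in> tangent_LCP (\<lambda>t. conj_diag \<alpha> t p)"
    and d: "H1_has_derivative c \<eta> 0"
  let ?S = "cov_diag \<alpha> p X" and ?g = "\<lambda>t. vector_derivative \<eta> (at t)"
  have \<eta>H: "\<eta> \<in> H1" and \<eta>T: "\<And>t. \<eta> t \<in> tangent_CP (conj_diag \<alpha> t p)" using \<eta> by (auto simp: tangent_LCP_def)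
  have cont: "continuous_on {0..1} \<eta>" by (rule H1_continuous_on[OF \<eta>H])
  have per: "conj_diag \<alpha> 1 M = conj_diag \<alpha> 0 M" for M using conj_diag_periodic[of 0 M] by simp
  note parts = H1_integral_by_parts[OF \<eta>H conj_diag_has_vector_derivative continuous_on_conj_diag per]
  have int: "(\<lambda>t. conj_diag \<alpha> t M \<bullet> \<eta> t) integrable_on {0..1}" for M
    by (intro integrable_continuous_interval continuous_intros cont continuous_on_conj_diag)
  \<comment> \<open>The other factor is tangent, so the projection inside \<open>covd\<close> may be
    dropped. This leaves the plain derivative, to which integration by parts applies.\<close>
  have proj: "fs_metric (conj_diag \<alpha> t ?S) (covd (\<lambda>t. conj_diag \<alpha> t p) \<eta> t) = conj_diag \<alpha> t ?S \<bullet> ?g t / 2" for t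
  proof -
    have "fs_metric (covd (\<lambda>t. conj_diag \<alpha> t p) \<eta> t) (conj_diag \<alpha> t ?S) = fs_metric (?g t) (conj_diag \<alpha> t ?S)"
      unfolding covd_def by (intro fs_metric_projection conj_diag_CP conj_diag_tangent_CP cov_diag_tangent p)
    then show ?thesis by (simp add: fs_metric_def inner_commute)
  qed
  have "metric1 (\<lambda>t. conj_diag \<alpha> t p) (\<lambda>t. conj_diag \<alpha> t X) \<eta>
      = integral {0..1} (\<lambda>t. (1/2) *\<^sub>R (conj_diag \<alpha> t X \<bullet> \<eta> t) + (1/2) *\<^sub>R (conj_diag \<alpha> t ?S \<bullet> ?g t))"
    unfolding metric1_def covd_conj_diag[OF p] proj by (simp add: fs_metric_def)
  also have "\<dots> = (1/2) *\<^sub>R integral {0..1} (\<lambda>t. conj_diag \<alpha> t X \<bullet> \<eta> t) + (1/2) *\<^sub>R integral {0..1} (\<lambda>t. conj_diag \<alpha> t ?S \<bullet> ?g t)"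
    by (subst integral_add) (intro integrable_cmul int parts, intro integrable_cmul int parts, simp only: integral_cmul)
  also have "\<dots> = (1/2) *\<^sub>R (integral {0..1} (\<lambda>t. conj_diag \<alpha> t X \<bullet> \<eta> t) - integral {0..1} (\<lambda>t. conj_diag \<alpha> t (ad_diag \<alpha> ?S) \<bullet> \<eta> t))"
    unfolding parts by (simp add: algebra_simps)
  also have "integral {0..1} (\<lambda>t. conj_diag \<alpha> t X \<bullet> \<eta> t) - integral {0..1} (\<lambda>t. conj_diag \<alpha> t (ad_diag \<alpha> ?S) \<bullet> \<eta> t)
      = integral {0..1} (\<lambda>t. conj_diag \<alpha> t X \<bullet> \<eta> t - conj_diag \<alpha> t (ad_diag \<alpha> ?S) \<bullet> \<eta> t)"
    by (rule integral_diff[symmetric, OF int int])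
  also have "(\<lambda>t. conj_diag \<alpha> t X \<bullet> \<eta> t - conj_diag \<alpha> t (ad_diag \<alpha> ?S) \<bullet> \<eta> t) = (\<lambda>t. (-2) *\<^sub>R (conj_diag \<alpha> t (ad_diag \<alpha> (ad_diag \<alpha> p)) \<bullet> \<eta> t))"
  proof
    fix t
    obtain Y where Y: "Y \<in> tangent_CP p" "\<eta> t = conj_diag \<alpha> t Y" using \<eta>T by (rule tangent_CP_conj_diagE)
    show "conj_diag \<alpha> t X \<bullet> \<eta> t - conj_diag \<alpha> t (ad_diag \<alpha> ?S) \<bullet> \<eta> t = (-2) *\<^sub>R (conj_diag \<alpha> t (ad_diag \<alpha> (ad_diag \<alpha> p)) \<bullet> \<eta> t)"
      using eq[OF Y(1)] by (simp add: Y(2) conj_diag_inner inner_add_left inner_diff_left)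
  qed
  also have "(1/2) *\<^sub>R integral {0..1} (\<lambda>t. (-2) *\<^sub>R (conj_diag \<alpha> t (ad_diag \<alpha> (ad_diag \<alpha> p)) \<bullet> \<eta> t))
      = - integral {0..1} (\<lambda>t. conj_diag \<alpha> t (ad_diag \<alpha> (ad_diag \<alpha> p)) \<bullet> \<eta> t)"
    by (subst integral_cmul) simp
  also have "\<dots> = integral {0..1} (\<lambda>t. vector_derivative (c 0) (at t) \<bullet> ?g t)"
    unfolding c vector_derivative_conj_diag parts ..
  finally have e: "metric1 (\<lambda>t. conj_diag \<alpha> t p) (\<lambda>t. conj_diag \<alpha> t X) \<eta> = \<dots>" .
  have "c s \<in> H1" for s using c(1) by (simp add: LCP_def)
  from energy_has_derivative[OF this \<eta>H d]
  show "((\<lambda>s. energy (c s)) has_real_derivative metric1 (\<lambda>t. conj_diag \<alpha> t p) (\<lambda>t. conj_diag \<alpha> t X) \<eta>) (at 0)"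
    unfolding e .
qed

lemma trajectory_conj_diag:
  assumes p: "\<And>s. P s \<in> CP" and X: "\<And>s. X s \<in> tangent_CP (P s)"
    and d: "\<And>s. (P has_vector_derivative - X s) (at s)"
    and eq: "\<And>s Y. Y \<in> tangent_CP (P s) \<Longrightarrow>
      (X s - ad_diag \<alpha> (cov_diag \<alpha> (P s) (X s)) + 2 *\<^sub>R ad_diag \<alpha> (ad_diag \<alpha> (P s))) \<bullet> Y = 0"
  shows "trajectory (\<lambda>s t. conj_diag \<alpha> t (P s))"
  unfolding trajectory_def
proof (intro allI conjI exI)
  fix s
  show "(\<lambda>t. conj_diag \<alpha> t (P s)) \<in> LCP" by (rule conj_diag_LCP[OF p])
  show "is_energy_gradient (\<lambda>t. conj_diag \<alpha> t (P s)) (\<lambda>t. conj_diag \<alpha> t (X s))"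
    by (rule energy_gradient_conj_diag[OF p X eq])
  show "H1_has_derivative (\<lambda>s t. conj_diag \<alpha> t (P s)) (\<lambda>t. - conj_diag \<alpha> t (X s)) s"
    using H1_has_derivative_conj_diag[OF d] by (simp add: linear_neg[OF linear_conj_diag])
qed

text \<open>The acceleration is translated along the loop like the loop itself, so its tangential
  part vanishes everywhere once it vanishes at time 0.\<close>

lemma closed_geodesic_conj_diag:
  assumes p: "p \<in> CP" and eq: "\<And>Y. Y \<in> tangent_CP p \<Longrightarrow> ad_diag \<alpha> (ad_diag \<alpha> p) \<bullet> Y = 0"
  shows "closed_geodesic (\<lambda>t. conj_diag \<alpha> t p)"
proof -
  have "cov_diag \<alpha> p (ad_diag \<alpha> p) = 0"
    unfolding cov_diag_def using subspace_tangent_CP[OF p] eq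
    by (intro closest_point_subspaceI) (auto simp: subspace_0)
  then show ?thesis
    unfolding closed_geodesic_def vector_derivative_conj_diag
    by (auto simp: conj_diag_CP p conj_diag_periodic covd_conj_diag linear_0[OF linear_conj_diag]
        intro: differentiableI_vector conj_diag_has_vector_derivative)
qed

end

section \<open>Real orbits and the geodesics at their ends\<close>

lemma herm_simps:
  "herm (u + v) w = herm u w + herm v w" "herm (u - v) w = herm u w - herm v w"
  "herm w (u + v) = herm w u + herm w v"
  "herm (c *s u) w = c * herm u w" "herm w (c *s u) = cnj c * herm w u"
  "herm (- u) w = - herm u w" "herm (r *\<^sub>R u) w = of_real r * herm u w"
  by (simp_all add: herm_def sum.distrib sum_subtractf sum_distrib_left sum_negf scaleR_conv_of_real[where 'a = complex]
      algebra_simps)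

lemma ad_diag_outer: "ad_diag \<alpha> (outer u v) = outer (skew_diag \<alpha> u) v + outer u (skew_diag \<alpha> v)"
  by (simp add: ad_diag_def outer_def skew_diag_def vec_eq_iff algebra_simps)

text \<open>For unit \<open>z\<close> and \<open>herm v z = 0\<close> this identifies the horizontal
  vectors at \<open>z\<close> with tangent vectors of the projective space. It doubles squared
  lengths, which the factor 1/2 in \<open>fs_metric\<close> undoes.\<close>

definition tang :: "complex^'d \<Rightarrow> complex^'d \<Rightarrow> complex^'d^'d"
  where "tang z v = outer v z + outer z v"

lemma tang_simps:
  "tang z (u + v) = tang z u + tang z v" "tang z (u - v) = tang z u - tang z v"
  "tang z (- v) = - tang z v"
  by (simp_all add: tang_def outer_def vec_eq_iff algebra_simps)

lemma tang_inner:
  assumes z: "norm z = 1" and "herm y z = 0" "herm v z = 0"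
  shows "tang z y \<bullet> tang z v = 2 * Re (herm y v)"
proof -
  have "herm z y = 0" "herm z v = 0" using assms cnj_herm[of y z] cnj_herm[of v z] by simp_all
  moreover have "herm z z = 1" by (simp add: herm_self z)
  ultimately show ?thesis using assms by (simp add: tang_def inner_add_left inner_add_right inner_outer)
qed

lemma ad_diag_tang_inner:
  assumes z: "norm z = 1" and "herm y z = 0" "herm v z = 0"
  shows "ad_diag \<alpha> (tang z y) \<bullet> tang z v = 2 * Re (herm (skew_diag \<alpha> y) v + herm y v * cnj (herm (skew_diag \<alpha> z) z))"
proof -
  have "herm z y = 0" "herm z v = 0" using assms cnj_herm[of y z] cnj_herm[of v z] by simp_all
  moreover have "herm z z = 1" by (simp add: herm_self z)
  ultimately show ?thesis using assms
    by (simp add: tang_def linear_add[OF linear_ad_diag] ad_diag_outer inner_add_left inner_add_right inner_outer)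
qed

lemma cproj_unit: "norm z = 1 \<Longrightarrow> cproj z = outer z z"
  by (simp add: cproj_outer)

lemma tang_tangent:
  assumes z: "norm z = 1" and v: "herm v z = 0"
  shows "tang z v \<in> tangent_CP (outer z z)"
proof -
  have "z \<noteq> 0" using z by auto
  moreover have "z \<bullet> v = 0" using v Re_herm[of v z] by (simp add: inner_commute)
  then have "tang z v = dcproj z v" using z by (simp add: tang_def dcproj_def)
  ultimately show ?thesis using tangent_CP_cproj[of z] cproj_unit[OF z] by auto
qed

lemma tangent_CP_tangE:
  assumes z: "norm z = 1" and Y: "Y \<in> tangent_CP (outer z z)"
  obtains v where "herm v z = 0" "Y = tang z v"
proof -
  have "z \<noteq> 0" using z by auto
  then obtain w where w: "Y = dcproj z w"
    using Y tangent_CP_cproj[of z] cproj_unit[OF z] by auto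
  let ?c = "herm w z"
  \<comment> \<open>The real part of \<open>?c\<close> is already removed by \<open>dcproj\<close>;
    its imaginary part is the direction of a phase rotation of \<open>z\<close>, invisible to
    \<open>outer z z\<close>.\<close>
  let ?v = "w - ?c *s z"
  have "herm ?v z = 0" by (simp add: herm_simps herm_self z)
  moreover have "Y = tang z ?v"
  proof -
    have e: "cnj ?c = 2 * of_real (z \<bullet> w) - ?c"
      using Re_herm[of w z] by (simp add: complex_eq_iff inner_commute)
    show ?thesis
      unfolding w dcproj_def tang_def using z
      by (simp add: e outer_def vec_eq_iff scaleR_conv_of_real[where 'a = complex] algebra_simps)
  qed
  ultimately show ?thesis by (rule that)
qed

section \<open>Real vectors supported on three coordinates\<close>

context
  fixes \<iota> :: "3 \<Rightarrow> 'd::finite"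
  assumes inj: "inj \<iota>"
begin

text \<open>Three coordinates chosen by \<iota> carry the whole construction, so one computation in
  \<open>real^3\<close> serves every r >= 2. The other coordinates are zero, and
  \<open>embed_weight\<close> gives them weight 0, which keeps all weights in 2 pi Z.\<close>

definition embed :: "real^3 \<Rightarrow> complex^'d"
  where "embed x = (\<chi> l. if l \<in> range \<iota> then of_real (x $ inv \<iota> l) else 0)"

definition embed_weight :: "(3 \<Rightarrow> real) \<Rightarrow> 'd \<Rightarrow> real"
  where "embed_weight a l = (if l \<in> range \<iota> then a (inv \<iota> l) else 0)"

lemma embed_nth: "embed x $ \<iota> k = of_real (x $ k)"
  by (simp add: embed_def inv_f_f[OF inj])

lemma embed_weight_nth: "embed_weight a (\<iota> k) = a k"
  by (simp add: embed_weight_def inv_f_f[OF inj])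

lemma linear_embed: "linear embed"
  by (rule linearI) (simp_all add: embed_def vec_eq_iff scaleR_conv_of_real[where 'a = complex])

lemma herm_embed: "herm (embed x) (embed y) = of_real (x \<bullet> y)"
proof -
  have "herm (embed x) (embed y) = (\<Sum>l\<in>range \<iota>. embed x $ l * cnj (embed y $ l))"
    unfolding herm_def by (rule sum.mono_neutral_right) (auto simp: embed_def)
  also have "\<dots> = (\<Sum>k\<in>UNIV. embed x $ \<iota> k * cnj (embed y $ \<iota> k))"
    by (subst sum.reindex[OF inj]) simp
  finally show ?thesis by (simp add: embed_nth inner_vec_def)
qed

lemma norm_embed: "norm (embed x) = norm x"
proof -
  have "complex_of_real ((norm (embed x))\<^sup>2) = complex_of_real ((norm x)\<^sup>2)"
    unfolding herm_self[symmetric] herm_embed by (simp add: power2_norm_eq_inner)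
  then show ?thesis by (simp only: of_real_eq_iff power2_eq_iff_nonneg norm_ge_zero)
qed

lemma skew_diag_embed: "skew_diag (embed_weight a) (embed x) = \<i> *s embed (diag_op a x)"
  by (auto simp: skew_diag_def embed_def embed_weight_def diag_op_def vec_eq_iff)

lemma skew_diag_i_embed: "skew_diag (embed_weight a) (\<i> *s embed x) = - embed (diag_op a x)"
proof -
  have "\<i> * complex_of_real r * (\<i> * c) = - (of_real r * c)" for r c
    by (simp add: complex_eq_iff)
  then show ?thesis by (auto simp: skew_diag_def embed_def embed_weight_def diag_op_def vec_eq_iff)
qed

context
  fixes a :: "3 \<Rightarrow> real" and z :: "real^3"
  assumes z: "norm z = 1"
begin

text \<open>A horizontal \<open>v\<close> does not see multiples of \<open>z\<close>, and for a unit
  vector \<open>z\<close> the map \<open>tangential z\<close> only subtracts such a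
  multiple.\<close>

lemma herm_embed_tangential:
  assumes "herm v (embed z) = 0"
  shows "herm (embed (tangential z u)) v = herm (embed u) v"
proof -
  have "herm (embed z) v = 0" using assms cnj_herm[of v "embed z"] by simp
  moreover have "tangential z u = u - (z \<bullet> u) *\<^sub>R z" using z by (simp add: tangential_def norm_eq_1)
  ultimately show ?thesis
    by (simp add: linear_diff[OF linear_embed] linear_scale[OF linear_embed] herm_simps)
qed

text \<open>Differentiation multiplies the direction by i D, and rotation of the base point
  subtracts i times the mean; together they give i times \<open>shift\<close>. So real directions
  become imaginary, and imaginary ones become real with a minus sign.\<close>

lemma ad_diag_tang_embed:
  assumes x: "z \<bullet> x = 0" and v: "herm v (embed z) = 0"
  shows "ad_diag (embed_weight a) (tang (embed z) (embed x)) \<bullet> tang (embed z) v = 2 * Re (\<i> * herm (embed (shift (diag_op a) z x)) v)"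
    and "ad_diag (embed_weight a) (tang (embed z) (\<i> *s embed x)) \<bullet> tang (embed z) v = - (2 * Re (herm (embed (shift (diag_op a) z x)) v))"
proof -
  have h: "herm (embed x) (embed z) = 0" "herm (\<i> *s embed x) (embed z) = 0"
    using x by (simp_all add: herm_simps herm_embed inner_commute)
  have n: "norm (embed z) = 1" by (simp add: norm_embed z)
  have m: "herm (skew_diag (embed_weight a) (embed z)) (embed z) = \<i> * of_real (z \<bullet> diag_op a z)"
    by (simp add: skew_diag_embed herm_simps herm_embed inner_commute)
  have s: "herm (embed (shift (diag_op a) z x)) v = herm (embed (diag_op a x)) v - of_real (z \<bullet> diag_op a z) * herm (embed x) v"
    by (simp add: shift_def linear_diff[OF linear_embed] linear_scale[OF linear_embed] herm_simps)
  show "ad_diag (embed_weight a) (tang (embed z) (embed x)) \<bullet> tang (embed z) v = 2 * Re (\<i> * herm (embed (shift (diag_op a) z x)) v)"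
    unfolding ad_diag_tang_inner[OF n h(1) v] m s skew_diag_embed
    by (simp add: herm_simps herm_embed inner_commute[of "diag_op a z" z] algebra_simps)
  show "ad_diag (embed_weight a) (tang (embed z) (\<i> *s embed x)) \<bullet> tang (embed z) v = - (2 * Re (herm (embed (shift (diag_op a) z x)) v))"
    unfolding ad_diag_tang_inner[OF n h(2) v] m s skew_diag_i_embed
    by (simp add: herm_simps herm_embed inner_commute[of "diag_op a z" z] algebra_simps)
qed

lemma hess_tangential: "z \<bullet> x = 0 \<Longrightarrow> hess (diag_op a) z x = tangential z (shift (diag_op a) z x)"
  by (simp add: hess_def tangential_eq[OF z])

lemma cov_diag_tang_embed:
  assumes x: "z \<bullet> x = 0"
  shows "cov_diag (embed_weight a) (outer (embed z) (embed z)) (tang (embed z) (embed x)) = tang (embed z) (\<i> *s embed (hess (diag_op a) z x))"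
  unfolding cov_diag_def
proof (rule closest_point_subspaceI)
  have n: "norm (embed z) = 1" by (simp add: norm_embed z)
  show "subspace (tangent_CP (outer (embed z) (embed z)))"
    by (rule subspace_tangent_CP) (use n in \<open>auto simp: CP_unit\<close>)
  have h: "herm (\<i> *s embed (hess (diag_op a) z x)) (embed z) = 0"
    by (simp add: herm_simps herm_embed hess_def inner_tangential_self inner_commute[of _ z])
  then show "tang (embed z) (\<i> *s embed (hess (diag_op a) z x)) \<in> tangent_CP (outer (embed z) (embed z))"
    by (rule tang_tangent[OF n])
  fix Y assume "Y \<in> tangent_CP (outer (embed z) (embed z))"
  then obtain v where v: "herm v (embed z) = 0" "Y = tang (embed z) v" by (rule tangent_CP_tangE[OF n])
  show "(ad_diag (embed_weight a) (tang (embed z) (embed x)) - tang (embed z) (\<i> *s embed (hess (diag_op a) z x))) \<bullet> Y = 0"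
    unfolding v(2) inner_diff_left ad_diag_tang_embed(1)[OF x v(1)] tang_inner[OF n h v(1)]
    by (simp add: herm_simps hess_tangential[OF x] herm_embed_tangential[OF v(1)])
qed

lemma ad_diag_ad_diag_embed:
  assumes v: "herm v (embed z) = 0"
  shows "ad_diag (embed_weight a) (ad_diag (embed_weight a) (outer (embed z) (embed z))) \<bullet> tang (embed z) v = - Re (herm (embed (grad_rhs (diag_op a) z)) v)"
proof -
  let ?k = "shift (diag_op a) z z" and ?m = "z \<bullet> diag_op a z"
  have k: "z \<bullet> ?k = 0" using z by (simp add: shift_def inner_diff_right norm_eq_1)
  have "diag_op a z = ?k + ?m *\<^sub>R z" by (simp add: shift_def)
  then have e: "embed (diag_op a z) = embed ?k + ?m *\<^sub>R embed z"
    by (metis linear_add[OF linear_embed] linear_scale[OF linear_embed])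
  have "ad_diag (embed_weight a) (outer (embed z) (embed z)) = tang (embed z) (\<i> *s embed (diag_op a z))"
    by (simp add: ad_diag_outer skew_diag_embed tang_def)
  \<comment> \<open>Real multiples of i z are phase directions, annihilated by \<open>tang\<close>;
    what remains of D z is its part \<open>?k\<close> orthogonal to \<open>z\<close>.\<close>
  also have "\<dots> = tang (embed z) (\<i> *s embed ?k)"
    unfolding e by (simp add: tang_def outer_def vec_eq_iff scaleR_conv_of_real[where 'a = complex] algebra_simps)
  finally have "ad_diag (embed_weight a) (ad_diag (embed_weight a) (outer (embed z) (embed z))) \<bullet> tang (embed z) v
      = - (2 * Re (herm (embed (shift (diag_op a) z ?k)) v))"
    using ad_diag_tang_embed(2)[OF k v] by simp
  also have "herm (embed (shift (diag_op a) z ?k)) v = herm (embed (hess (diag_op a) z ?k)) v"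
    by (simp add: hess_tangential[OF k] herm_embed_tangential[OF v])
  also have "2 * Re \<dots> = Re (herm (embed (grad_rhs (diag_op a) z)) v)"
    by (simp add: grad_rhs_def linear_scale[OF linear_embed] herm_simps)
  finally show ?thesis .
qed

text \<open>Two covariant derivatives of a real direction amount to minus the square of
  \<open>hess\<close>, and twice the acceleration of the loop is minus \<open>grad_rhs\<close>. The
  gradient equation thus becomes the defining equation of \<open>gradfield\<close>.\<close>

lemma gradient_equation_embed:
  assumes Y: "Y \<in> tangent_CP (outer (embed z) (embed z))"
  shows "(tang (embed z) (embed (gradfield (diag_op a) z))
      - ad_diag (embed_weight a) (cov_diag (embed_weight a) (outer (embed z) (embed z)) (tang (embed z) (embed (gradfield (diag_op a) z))))
      + 2 *\<^sub>R ad_diag (embed_weight a) (ad_diag (embed_weight a) (outer (embed z) (embed z)))) \<bullet> Y = 0"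
proof -
  interpret symmetric_operator "diag_op a" by (rule symmetric_operator_diag_op)
  let ?x = "gradfield (diag_op a) z"
  have x: "z \<bullet> ?x = 0" by (rule inner_gradfield)
  have hx: "z \<bullet> hess (diag_op a) z ?x = 0" by (simp add: hess_def inner_tangential_self)
  have n: "norm (embed z) = 1" by (simp add: norm_embed z)
  obtain v where v: "herm v (embed z) = 0" "Y = tang (embed z) v" using Y by (rule tangent_CP_tangE[OF n])
  have h: "herm (embed ?x) (embed z) = 0" using x by (simp add: herm_embed inner_commute)
  have "embed (grad_rhs (diag_op a) z) = embed ?x + embed (hess (diag_op a) z (hess (diag_op a) z ?x))"
    unfolding gradfield_eq[symmetric] by (simp add: linear_add[OF linear_embed])
  then show ?thesis
    unfolding v(2) cov_diag_tang_embed[OF x] inner_add_left inner_diff_left inner_scaleR_left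
      ad_diag_tang_embed(2)[OF hx v(1)] tang_inner[OF n h v(1)] ad_diag_ad_diag_embed[OF v(1)]
    by (simp add: hess_tangential[OF hx] herm_embed_tangential[OF v(1)] herm_simps)
qed

end

lemma bounded_linear_embed: "bounded_linear embed"
  by (simp add: linear_embed linear_conv_bounded_linear[symmetric])

lemma trajectory_embed:
  assumes a: "\<And>k. \<exists>j::int. a k = 2 * pi * of_int j"
    and z: "\<And>s. norm (z s) = 1" and d: "\<And>s. (z has_vector_derivative - gradfield (diag_op a) (z s)) (at s)"
  shows "trajectory (\<lambda>s t. conj_diag (embed_weight a) t (outer (embed (z s)) (embed (z s))))"
proof (rule trajectory_conj_diag)
  interpret symmetric_operator "diag_op a" by (rule symmetric_operator_diag_op)
  have n: "norm (embed (z s)) = 1" for s by (simp add: norm_embed z)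
  show "\<exists>k::int. embed_weight a j = 2 * pi * of_int k" for j
    using a by (auto simp: embed_weight_def intro: exI[of _ 0])
  show "outer (embed (z s)) (embed (z s)) \<in> CP" for s using n by (auto simp: CP_unit)
  show "tang (embed (z s)) (embed (gradfield (diag_op a) (z s))) \<in> tangent_CP (outer (embed (z s)) (embed (z s)))" for s
    by (intro tang_tangent n) (simp add: herm_embed inner_gradfield inner_commute[of _ "z s"])
  show "((\<lambda>s. outer (embed (z s)) (embed (z s))) has_vector_derivative
      - tang (embed (z s)) (embed (gradfield (diag_op a) (z s)))) (at s)" for s
  proof -
    have e: "((\<lambda>s. embed (z s)) has_vector_derivative embed (- gradfield (diag_op a) (z s))) (at s)"
      by (rule bounded_linear.has_vector_derivative[OF bounded_linear_embed d])
    have "((\<lambda>s. outer (embed (z s)) (embed (z s))) has_vector_derivative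
        tang (embed (z s)) (embed (- gradfield (diag_op a) (z s)))) (at s)"
      using bounded_bilinear.has_vector_derivative[OF bounded_bilinear_outer e e]
      by (simp add: tang_def add.commute)
    then show ?thesis by (simp add: linear_neg[OF linear_embed] tang_simps)
  qed
qed (rule gradient_equation_embed[OF z])

lemma tendsto_outer_embed: "(z \<longlongrightarrow> w) F \<Longrightarrow> ((\<lambda>s. outer (embed (z s)) (embed (z s))) \<longlongrightarrow> outer (embed w) (embed w)) F"
  by (intro bounded_bilinear.tendsto[OF bounded_bilinear_outer] bounded_linear.tendsto[OF bounded_linear_embed])

text \<open>On the support of \<open>w\<close> the weights are 0 and 2 pi N, so the loop is the
  N-fold iterate of the loop \<open>f\<close> with weights 0 and 2 pi. One matrix entry of
  \<open>f\<close> is a nonzero multiple of exp(2 pi i t), so \<open>f\<close> is not itself an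
  iterate.\<close>

lemma geodesic_embed:
  assumes N: "N \<ge> 1" and a: "a 1 = 0" "a k = 2 * pi * real N" and k: "k \<noteq> 1"
    and w: "(w $ 1)\<^sup>2 = 1 / 2" "(w $ k)\<^sup>2 = 1 / 2" "\<And>j. j \<noteq> 1 \<Longrightarrow> j \<noteq> k \<Longrightarrow> w $ j = 0"
  shows "geodesic_with_period N (\<lambda>t. conj_diag (embed_weight a) t (outer (embed w) (embed w))) \<and>
    \<not> (\<lambda>t. conj_diag (embed_weight a) t (outer (embed w) (embed w))) constant_on UNIV"
proof -
  define b where "b = (\<lambda>j. if j = k then 2 * pi else 0 :: real)"
  define P where "P = outer (embed w) (embed w)"
  define f where "f = (\<lambda>t. conj_diag (embed_weight b) t P)"
  have sum: "(\<Sum>j\<in>UNIV. g j * (w $ j)\<^sup>2) = (g 1 + g k) / 2" for g :: "3 \<Rightarrow> real"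
  proof -
    have "(\<Sum>j\<in>UNIV. g j * (w $ j)\<^sup>2) = (\<Sum>j\<in>{1, k}. g j * (w $ j)\<^sup>2)"
      by (rule sum.mono_neutral_right) (use w(3) in auto)
    then show ?thesis using k w by simp
  qed
  have nw: "norm w = 1"
    using sum[of "\<lambda>_. 1"] by (simp add: norm_eq_1 inner_vec_def power2_eq_square)
  have m: "w \<bullet> diag_op b w = pi"
    using sum[of b] k by (simp add: diag_op_def inner_vec_def power2_eq_square mult_ac b_def)
  \<comment> \<open>On the support of \<open>w\<close> the weights deviate from the mean pi by pi or
    -pi, so applying the shift twice multiplies \<open>w\<close> by pi^2.\<close>
  have "shift (diag_op b) w (shift (diag_op b) w w) = pi\<^sup>2 *\<^sub>R w"
  proof -
    have "b j * (b j * w $ j - pi * w $ j) - pi * (b j * w $ j - pi * w $ j) = pi\<^sup>2 * w $ j" for j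
      using w(3)[of j] k by (cases "j = 1"; cases "j = k") (auto simp: b_def power2_eq_square)
    then show ?thesis
      by (simp add: shift_def m) (simp add: diag_op_def vec_eq_iff)
  qed
  moreover have "w \<bullet> shift (diag_op b) w w = 0" using nw by (simp add: shift_def inner_diff_right norm_eq_1)
  ultimately have crit: "grad_rhs (diag_op b) w = 0"
    using nw by (simp add: grad_rhs_def hess_tangential[OF nw] tangential_def norm_eq_1)
  have n: "norm (embed w) = 1" by (simp add: norm_embed nw)
  have geo: "closed_geodesic f" unfolding f_def
  proof (rule closed_geodesic_conj_diag)
    show "\<exists>k::int. embed_weight b j = 2 * pi * of_int k" for j
      by (auto simp: embed_weight_def b_def intro: exI[of _ 0] exI[of _ 1])
    show "P \<in> CP" using n by (auto simp: CP_unit P_def)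
    fix Y assume "Y \<in> tangent_CP P"
    then obtain v where v: "herm v (embed w) = 0" "Y = tang (embed w) v"
      unfolding P_def by (rule tangent_CP_tangE[OF n])
    show "ad_diag (embed_weight b) (ad_diag (embed_weight b) P) \<bullet> Y = 0"
      unfolding v(2) P_def ad_diag_ad_diag_embed[OF nw v(1)] crit by (simp add: linear_0[OF linear_embed] herm_def)
  qed
  have wne: "w $ 1 \<noteq> 0" "w $ k \<noteq> 0" using w by auto
  have entry: "f t $ \<iota> k $ \<iota> 1 = cis (2 * pi * t) * of_real (w $ k * w $ 1)" for t
    using k by (simp add: f_def conj_diag_def P_def outer_def embed_nth embed_weight_nth b_def mult_ac)
  have ne: "f t \<noteq> f 0" if "cis (2 * pi * t) \<noteq> 1" for t
  proof
    assume "f t = f 0"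
    then show False using entry[of t] entry[of 0] wne that by simp
  qed
  have "f (1 / 2) \<noteq> f 0" by (rule ne) simp
  then have nonconst: "\<not> f constant_on UNIV" unfolding constant_on_def by (metis UNIV_I)
  have prim: "\<not> (\<exists>m\<ge>2. \<exists>g. closed_geodesic g \<and> f = (\<lambda>t. g (real m * t)))"
  proof
    assume "\<exists>m\<ge>2. \<exists>g. closed_geodesic g \<and> f = (\<lambda>t. g (real m * t))"
    then obtain m :: nat and g where m: "m \<ge> 2" and g: "closed_geodesic g" "f = (\<lambda>t. g (real m * t))" by blast
    have "g (0 + 1) = g 0" using g(1) unfolding closed_geodesic_def by blast
    then have "f (1 / real m) = f 0" using m by (simp add: g(2))
    moreover have "cis (2 * pi * (1 / real m)) \<noteq> 1"
    proof
      assume "cis (2 * pi * (1 / real m)) = 1"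
      then have "cos (2 * pi * (1 / real m)) = 1" by (metis cis.sel(1) one_complex.sel(1))
      then obtain l :: int where "2 * pi * (1 / real m) = of_int l * 2 * pi"
        using cos_one_2pi_int by blast
      then have "(2 * pi) * (1 / real m) = (2 * pi) * of_int l" by (simp only: mult_ac)
      then have "1 / real m = of_int l" unfolding mult_cancel_left by simp
      then have "1 = of_int l * real m" using m by (simp add: field_simps)
      then have "(1::int) = l * int m" by (metis (mono_tags) of_int_1 of_int_eq_iff of_int_mult of_int_of_nat_eq)
      then have "int m dvd 1" by (metis dvd_triv_right)
      then show False using m by simp
    qed
    ultimately show False using ne by blast
  qed
  have fN: "(\<lambda>t. conj_diag (embed_weight a) t (outer (embed w) (embed w))) = (\<lambda>t. f (real N * t))"
  proof
    fix t
    \<comment> \<open>At the remaining vertex \<open>a\<close> need not be N times \<open>b\<close>;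
      the identity is claimed where \<open>embed w\<close> is nonzero, and all other matrix entries
      vanish.\<close>
    have e: "embed_weight a i = real N * embed_weight b i" if "embed w $ i \<noteq> 0" for i
    proof -
      obtain j where j: "i = \<iota> j" using \<open>embed w $ i \<noteq> 0\<close> by (auto simp: embed_def split: if_splits)
      then have "w $ j \<noteq> 0" using \<open>embed w $ i \<noteq> 0\<close> by (simp add: embed_nth)
      then have "j = 1 \<or> j = k" using w(3) by blast
      then show ?thesis using a k by (auto simp: j embed_weight_nth b_def)
    qed
    have "cis (t * (embed_weight a i - embed_weight a j)) * (embed w $ i * cnj (embed w $ j))
        = cis (real N * t * (embed_weight b i - embed_weight b j)) * (embed w $ i * cnj (embed w $ j))" for i j
    proof (cases "embed w $ i = 0 \<or> embed w $ j = 0")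
      case False
      then have "t * (embed_weight a i - embed_weight a j) = real N * t * (embed_weight b i - embed_weight b j)" using e by (simp add: algebra_simps)
      then show ?thesis by (simp only:)
    qed auto
    then show "conj_diag (embed_weight a) t (outer (embed w) (embed w)) = f (real N * t)"
      by (simp add: f_def P_def conj_diag_def outer_def vec_eq_iff)
  qed
  have "\<not> (\<lambda>t. f (real N * t)) constant_on UNIV"
  proof
    assume "(\<lambda>t. f (real N * t)) constant_on UNIV"
    then obtain c where c: "\<And>t. f (real N * t) = c" unfolding constant_on_def by blast
    have "f t = c" for t using c[of "t / real N"] N by simp
    then show False using nonconst unfolding constant_on_def by blast
  qed
  moreover have "primitive_closed_geodesic f"
    unfolding primitive_closed_geodesic_def using geo nonconst prim by blast
  ultimately show ?thesis unfolding fN geodesic_with_period_def by blast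
qed

end

theorem corollary13p11:
  fixes r n :: nat
  assumes "r \<ge> 2" and "CARD('d::finite) = r + 1" and "n \<ge> 2"
  shows "\<exists>(u :: real \<Rightarrow> real \<Rightarrow> complex^'d^'d) \<gamma>\<^sub>1 \<gamma>\<^sub>2.
      trajectory u \<and>
      geodesic_with_period n \<gamma>\<^sub>1 \<and> H1_tendsto u \<gamma>\<^sub>1 at_top \<and>
      geodesic_with_period (n + 1) \<gamma>\<^sub>2 \<and> \<not> \<gamma>\<^sub>2 constant_on UNIV \<and> H1_tendsto u \<gamma>\<^sub>2 at_bot"
proof -
  have "\<exists>\<iota> :: 3 \<Rightarrow> 'd. inj \<iota>"
    using card_le_inj[of "UNIV :: 3 set" "UNIV :: 'd set"] assms(1,2) by auto
  then obtain \<iota> :: "3 \<Rightarrow> 'd" where \<iota>: "inj \<iota>" by blast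
  define a :: "3 \<Rightarrow> real" where "a = (\<lambda>j. if j = 1 then 0 else if j = 2 then 2 * pi * real n else 2 * pi * real (n + 1))"
  have a: "a 1 = 0" "a 2 = 2 * pi * real n" "a 3 = 2 * pi * real (n + 1)"
    by (simp_all add: a_def)
  \<comment> \<open>The last of the three inequalities says n + 1 < 2n, which is where n >= 2 enters
    in full.\<close>
  have "0 < 2 * pi * real n" "2 * pi * real n < 2 * pi * real (n + 1)"
    "2 * pi * real (n + 1) < 2 * (2 * pi * real n)"
    using assms(3) by simp_all
  from connecting_orbit[OF a this] obtain z w1 w2
    where z: "\<And>s. norm (z s) = 1" "\<And>s. (z has_vector_derivative - gradfield (diag_op a) (z s)) (at s)"
      and w1: "(z \<longlongrightarrow> w1) at_top" "(w1 $ 1)\<^sup>2 = 1/2" "(w1 $ 2)\<^sup>2 = 1/2" "w1 $ 3 = 0"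
      and w2: "(z \<longlongrightarrow> w2) at_bot" "(w2 $ 1)\<^sup>2 = 1/2" "w2 $ 2 = 0" "(w2 $ 3)\<^sup>2 = 1/2"
    by blast
  have ai: "\<exists>j::int. a k = 2 * pi * of_int j" for k
    using a exhaust_3[of k] by (metis mult_zero_right of_int_0 of_int_of_nat_eq)
  have wi: "\<exists>k::int. embed_weight \<iota> a j = 2 * pi * of_int k" for j
    using ai by (auto simp: embed_weight_def[OF \<iota>] intro: exI[of _ 0])
  define u where "u = (\<lambda>s t. conj_diag (embed_weight \<iota> a) t (outer (embed \<iota> (z s)) (embed \<iota> (z s))))"
  define g where "g = (\<lambda>w t. conj_diag (embed_weight \<iota> a) t (outer (embed \<iota> w) (embed \<iota> w)))"
  have lim: "H1_tendsto u (g w) F" if "(z \<longlongrightarrow> w) F" for w F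
    unfolding u_def g_def by (rule H1_tendsto_conj_diag[OF wi tendsto_outer_embed[OF \<iota> that]])
  have "trajectory u"
    unfolding u_def by (rule trajectory_embed[OF \<iota> ai z])
  moreover have "geodesic_with_period n (g w1) \<and> \<not> g w1 constant_on UNIV"
    unfolding g_def
  proof (rule geodesic_embed[OF \<iota>])
    show "w1 $ j = 0" if "j \<noteq> 1" "j \<noteq> 2" for j using exhaust_3[of j] that w1 by auto
  qed (use assms(3) a w1 in auto)
  moreover have "geodesic_with_period (n + 1) (g w2) \<and> \<not> g w2 constant_on UNIV"
    unfolding g_def
  proof (rule geodesic_embed[OF \<iota>])
    show "w2 $ j = 0" if "j \<noteq> 1" "j \<noteq> 3" for j using exhaust_3[of j] that w2 by auto
  qed (use a w2 in auto)
  ultimately show ?thesis using lim w1(1) w2(1) by blast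
qed

end
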